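(* Let $f:\mathbb{R}^n\to\mathbb{R}^n$ be a smooth asymptotically quasi-homogeneous vector field of type $\alpha=(\alpha_1,\dots,\alpha_n)$ and order $k+1$ at infinity, and consider $y'=f(y)$. Let $(T,\mathcal{D},\mathcal{E},g,h)$ be one of the following three data, all defined in the context: the directional data; the Poincaré-type data with $k/(2c)\in\mathbb{N}$; or the parabolic-type data. Let the blow-up time be given by $$t_{\max}=t_0+\int_{\tau_0}^\infty h(x(\tau))\,d\tau ,$$ where $x(\tau)=(T(y))(\tau)$ is the image under $T$ of the solution $y$, expressed in the desingularized time $\tau$, and $\tau_0$ is the $\tau$-time corresponding to the initial time $t_0$. Let $W^s_{\rm loc}(p_*;g)$ be a local stable manifold of a hyperbolic saddle $p_*\in\mathcal{E}$ on the horizon for the desingularized vector field $g$, given by a parameterization $P$ and satisfying all the requirements (analyticity of $g$ near $p_*$, (A1), (A2), (A3), and $W^s_{\rm loc}(p_*;g)=P(B_1^m)$ with $P(0)=p_*$) listed in the context. Let $y_0\in\mathbb{R}^n$ be a point such that the solution $y(t)$ of $y'=f(y)$ with $y(t_0)=y_0$ is mapped, through $T$ and the corresponding time-scale desingularization, into a trajectory $\{(T(y))(\tau)\}_{\tau\ge\tau_0}$ included in $W^s_{\rm loc}(p_*;g)$. Then the blow-up time $t_{\max}$ is real analytic at $y_0$ in ${\rm int}_{T^{-1}(\mathcal{D})}\,T^{-1}(W^s_{\rm loc}(p_*;g))$. Moreover, $t_{\max}=t_{\max}(y_0)$ converges to $0$ as $y_0$ goes to infinity along the solution $y(t)$.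
   Context: **Notation.** ${\rm int}_{T^{-1}(\mathcal D)}$ denotes the interior taken in $T^{-1}(\mathcal D)$. In the last assertion, for a point $y_0$ lying on a solution and reached at desingularized time $\bar\tau$, $t_{\max}(y_0)$ is the contribution $\int_{\bar\tau}^\infty h(x(\tau))\,d\tau$ of the remaining part of the trajectory; going to infinity along the solution corresponds to $\bar\tau\to\infty$. **Asymptotic quasi-homogeneity.** $\alpha_1,\dots,\alpha_n,k\ge 1$ are natural numbers. A smooth (that is, $C^r$ with $r\ge1$) function $f_0:\mathbb{R}^n\to\mathbb{R}$ is quasi-homogeneous of type $\alpha$ and order $l$ if $f_0(s^{\alpha_1}x_1,\dots,s^{\alpha_n}x_n)=s^{l}f_0(x)$ for all $x\in\mathbb{R}^n$, $s\in\mathbb{R}$. A vector field is quasi-homogeneous of type $\alpha$ and order $k+1$ if its $j$-th component is quasi-homogeneous of type $\alpha$ and order $k+\alpha_j$ for each $j$. $f=(f_1,\dots,f_n)$ is asymptotically quasi-homogeneous of type $\alpha$ and order $k+1$ at infinity if there is a quasi-homogeneous vector field $(f_{j;\alpha,k})_{j=1}^n$ of type $\alpha$ and order $k+1$ such that for each $j$, $s^{-(k+\alpha_j)}\{f_j(s^{\alpha_1}x_1,\dots,s^{\alpha_n}x_n)-s^{k+\alpha_j}f_{j;\alpha,k}(x)\}\to0$ as $s\to+\infty$, uniformly for $x$ in the unit sphere $S^{n-1}$. **Directional data.** $T=T_d$ maps $\{y_1>0\}$ onto $\mathcal{D}=\{(s,\hat x_2,\dots,\hat x_n): s>0,\ \hat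 x_i\in\mathbb{R}\}$ by $T_d(y)=(s,\hat x_2,\dots,\hat x_n)$, where $y_1=s^{-\alpha_1}$, $y_i=s^{-\alpha_i}\hat x_i$ ($i\ge2$). The horizon is $\mathcal{E}=\{s=0\}$. With $\hat f_i(s,\hat x)=s^{k+\alpha_i}f_i(s^{-\alpha_1},s^{-\alpha_2}\hat x_2,\dots,s^{-\alpha_n}\hat x_n)$ (extended to $s=0$), the desingularized vector field $g=g_d$ is $$\frac{ds}{d\tau}=-\frac{1}{\alpha_1}s\hat f_1,\qquad \frac{d\hat x_i}{d\tau}=\hat f_i-\frac{\alpha_i}{\alpha_1}\hat x_i\hat f_1\quad(i=2,\dots,n),$$ where $d\tau=s^{-k}dt$; and $h(s,\hat x)=s^k$. **Poincaré-type and parabolic-type data.** Let $\beta_1,\dots,\beta_n,c$ be natural numbers with $\alpha_1\beta_1=\dots=\alpha_n\beta_n=c$, and $p(y)=\bigl(\sum_{i}y_i^{2\beta_i}\bigr)^{1/2c}$. Put $\mathcal{D}=\{x\in\mathbb{R}^n:p(x)<1\}$, with horizon $\mathcal{E}=\{p(x)=1\}$. The map $T:\mathbb{R}^n\to\mathcal{D}$ is the bijection $T(y)=x$, $x_i=y_i/\kappa^{\alpha_i}$, where - Poincaré-type: $\kappa=(1+p(y)^{2c})^{1/2c}=(1-p(x)^{2c})^{-1/2c}$; - parabolic-type: $\kappa=(1-p(x)^{2c})^{-1}$ (equivalently, $\kappa\ge1$ is the unique solution of $\kappa^{2c}-\kappa^{2c-1}=p(y)^{2c}$ with $\kappa=1$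 at $y=0$). Put $\tilde f_j(x)=\kappa^{-(k+\alpha_j)}f_j(\kappa^{\alpha_1}x_1,\dots,\kappa^{\alpha_n}x_n)$, extended continuously to $\mathcal{E}$. The desingularized vector field $g$, the desingularized time $\tau$ and $h$ are: - Poincaré-type: $g_i(x)=\tilde f_i(x)-\alpha_ix_i\sum_{j=1}^n\frac{x_j^{2\beta_j-1}}{\alpha_j}\tilde f_j(x)$, $h(x)=(1-p(x)^{2c})^{k/2c}$, $dt=h\,d\tau$; - parabolic-type: $g_i(x)=\bigl(1-\frac{2c-1}{2c}(1-p(x)^{2c})\bigr)\tilde f_i(x)-\alpha_ix_i\sum_{j=1}^n\frac{x_j^{2\beta_j-1}}{\alpha_j}\tilde f_j(x)$, $h(x)=\bigl(1-\frac{2c-1}{2c}(1-p(x)^{2c})\bigr)(1-p(x)^{2c})^k$, $dt=h\,d\tau$. In all three cases $T$ followed by the time change $dt=h\,d\tau$ transforms solutions of $y'=f(y)$ into solutions of $dx/d\tau=g(x)$. **Requirements on $g$, $p_*$ and $P$.** $g$ is analytic in a neighborhood of $p_*$. (A1) $g$ is a polynomial vector field on $\mathbb{R}^n$ and $g(p_* )=0$. (A2) The eigenvalues of $Dg(p_* )$ are real, nonzero and distinct. Let $\lambda_1,\dots,\lambda_m<0$ be the negative ones, with eigenvectors $\xi_1,\dots,\xi_m\in\mathbb{R}^n$, and $\Lambda=\mathrm{diag}(\lambda_1,\dots,\lambda_m)$. (A3) Non-resonance: $\gamma_1\lambda_1+\dots+\gamma_m\lambda_m\ne\lambda_j$ for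 all $j\in\{1,\dots,m\}$ and all $\gamma\in\mathbb{Z}_{\ge0}^m$ with $|\gamma|=\gamma_1+\dots+\gamma_m\ge2$. Parameterization: $B_1^m=\{z\in\mathbb{C}^m:|z_k|\le1,\ k=1,\dots,m\}$ is the unit polydisc, and $P:B_1^m\to\mathbb{R}^n$ (as the paper writes it) is given by a power series $P(\theta)=\sum_{\gamma}a_\gamma\theta^\gamma$, $a_\gamma\in\mathbb{R}^n$, converging on $B_1^m$, with $P(0)=p_*$, $DP(0)=[\xi_1|\cdots|\xi_m]$ and $\varphi(\tau,P(\theta))=P(e^{\Lambda\tau}\theta)$ for $\theta\in B_1^m$, where $\varphi$ is the flow of $g$; and $W^s_{\rm loc}(p_*;g)=P(B_1^m)$. *)

theory Defs
  imports "HOL-Analysis.Analysis"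
begin

definition C1 :: "('a::real_normed_vector \<Rightarrow> 'b::real_normed_vector) \<Rightarrow> bool" where
  "C1 f \<longleftrightarrow> (\<exists>f'. (\<forall>x. (f has_derivative blinfun_apply (f' x)) (at x)) \<and> continuous_on UNIV f')"

definition monomial :: "'a::comm_monoid_mult ^ 'm \<Rightarrow> ('m::finite \<Rightarrow> nat) \<Rightarrow> 'a" where
  "monomial z \<gamma> = (\<Prod>i\<in>UNIV. (z $ i) ^ \<gamma> i)"

definition real_analytic_at :: "(real ^ 'n::finite \<Rightarrow> real) \<Rightarrow> real ^ 'n \<Rightarrow> bool" where
  "real_analytic_at F y0 \<longleftrightarrow>
     (\<exists>r>0. \<exists>c :: ('n \<Rightarrow> nat) \<Rightarrow> real.
        \<forall>y. (\<forall>i. \<bar>y $ i - y0 $ i\<bar> < r) \<longrightarrow>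
            ((\<lambda>\<gamma>. c \<gamma> * monomial (y - y0) \<gamma>) has_sum F y) UNIV)"

text \<open>Analyticity at a point of a function which only matters on a set \<open>S\<close> (typically an embedded
  submanifold): near the point it is the restriction of a real analytic function of the
  ambient space.\<close>

definition real_analytic_within ::
    "(real ^ 'n::finite \<Rightarrow> real) \<Rightarrow> real ^ 'n \<Rightarrow> (real ^ 'n) set \<Rightarrow> bool" where
  "real_analytic_within F y0 S \<longleftrightarrow>
     (\<exists>G. real_analytic_at G y0 \<and> (\<forall>\<^sub>F y in inf (nhds y0) (principal S). F y = G y))"

definition qscale :: "('n::finite \<Rightarrow> nat) \<Rightarrow> real \<Rightarrow> real ^ 'n \<Rightarrow> real ^ 'n" where
  "qscale \<alpha> s x = (\<chi> i. s ^ \<alpha> i * x $ i)"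

definition quasi_homogeneous ::
    "('n::finite \<Rightarrow> nat) \<Rightarrow> nat \<Rightarrow> (real ^ 'n \<Rightarrow> real) \<Rightarrow> bool" where
  "quasi_homogeneous \<alpha> l f0 \<longleftrightarrow> C1 f0 \<and> (\<forall>x s. f0 (qscale \<alpha> s x) = s ^ l * f0 x)"

text \<open>The parameter \<open>k\<close> is one less than the order of the vector field.\<close>

definition quasi_homogeneous_field ::
    "('n::finite \<Rightarrow> nat) \<Rightarrow> nat \<Rightarrow> (real ^ 'n \<Rightarrow> real ^ 'n) \<Rightarrow> bool" where
  "quasi_homogeneous_field \<alpha> k f \<longleftrightarrow> (\<forall>j. quasi_homogeneous \<alpha> (k + \<alpha> j) (\<lambda>x. f x $ j))"

definition asymptotically_quasi_homogeneous ::
    "('n::finite \<Rightarrow> nat) \<Rightarrow> nat \<Rightarrow> (real ^ 'n \<Rightarrow> real ^ 'n) \<Rightarrow> bool" where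
  "asymptotically_quasi_homogeneous \<alpha> k f \<longleftrightarrow>
     (\<exists>fq. quasi_homogeneous_field \<alpha> k fq \<and>
        (\<forall>j. uniform_limit (sphere 0 1)
               (\<lambda>s x. inverse (s ^ (k + \<alpha> j)) *
                      (f (qscale \<alpha> s x) $ j - s ^ (k + \<alpha> j) * fq x $ j))
               (\<lambda>_. 0) at_top))"

text \<open>\<open>Directional d\<close> uses the chart \<open>y\<^sub>d > 0\<close>, the coordinate \<open>d\<close> of the image being \<open>s\<close>; the index
  \<open>d\<close> plays the role of the first coordinate.  The other two constructors carry \<open>\<beta>\<close> and \<open>c\<close>.\<close>

datatype 'n compactification =
    Directional 'n
  | Poincare "'n \<Rightarrow> nat" nat
  | Parabolic "'n \<Rightarrow> nat" nat

fun admissible :: "('n::finite \<Rightarrow> nat) \<Rightarrow> nat \<Rightarrow> 'n compactification \<Rightarrow> bool" where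
  "admissible \<alpha> k (Directional d) \<longleftrightarrow> True"
| "admissible \<alpha> k (Poincare \<beta> c) \<longleftrightarrow> c \<ge> 1 \<and> (\<forall>i. \<alpha> i * \<beta> i = c) \<and> 2 * c dvd k"
| "admissible \<alpha> k (Parabolic \<beta> c) \<longleftrightarrow> c \<ge> 1 \<and> (\<forall>i. \<alpha> i * \<beta> i = c)"

definition pfun :: "('n::finite \<Rightarrow> nat) \<Rightarrow> nat \<Rightarrow> real ^ 'n \<Rightarrow> real" where
  "pfun \<beta> c y = (\<Sum>i\<in>UNIV. (y $ i) ^ (2 * \<beta> i)) powr (1 / (2 * real c))"

text \<open>The domain of \<open>T\<close>, that is \<open>T\<^sup>-\<^sup>1(\<D>)\<close>; outside of it \<open>tmap\<close> has no meaning.\<close>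

fun tdom :: "'n::finite compactification \<Rightarrow> (real ^ 'n) set" where
  "tdom (Directional d) = {y. y $ d > 0}"
| "tdom (Poincare \<beta> c) = UNIV"
| "tdom (Parabolic \<beta> c) = UNIV"

fun tmap :: "('n::finite \<Rightarrow> nat) \<Rightarrow> 'n compactification \<Rightarrow> real ^ 'n \<Rightarrow> real ^ 'n" where
  "tmap \<alpha> (Directional d) y =
     (let s = (y $ d) powr (- 1 / real (\<alpha> d)) in \<chi> i. if i = d then s else s ^ \<alpha> i * y $ i)"
| "tmap \<alpha> (Poincare \<beta> c) y =
     (let \<kappa> = (1 + pfun \<beta> c y ^ (2 * c)) powr (1 / (2 * real c)) in \<chi> i. y $ i / \<kappa> ^ \<alpha> i)"
| "tmap \<alpha> (Parabolic \<beta> c) y =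
     (let \<kappa> = (THE \<kappa>. \<kappa> \<ge> 1 \<and> \<kappa> ^ (2 * c) - \<kappa> ^ (2 * c - 1) = pfun \<beta> c y ^ (2 * c))
      in \<chi> i. y $ i / \<kappa> ^ \<alpha> i)"

definition tpreimage ::
    "('n::finite \<Rightarrow> nat) \<Rightarrow> 'n compactification \<Rightarrow> (real ^ 'n) set \<Rightarrow> (real ^ 'n) set" where
  "tpreimage \<alpha> K A = {y \<in> tdom K. tmap \<alpha> K y \<in> A}"

fun image_dom :: "'n::finite compactification \<Rightarrow> (real ^ 'n) set" where
  "image_dom (Directional d) = {x. x $ d > 0}"
| "image_dom (Poincare \<beta> c) = {x. pfun \<beta> c x < 1}"
| "image_dom (Parabolic \<beta> c) = {x. pfun \<beta> c x < 1}"

fun horizon :: "'n::finite compactification \<Rightarrow> (real ^ 'n) set" where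
  "horizon (Directional d) = {x. x $ d = 0}"
| "horizon (Poincare \<beta> c) = {x. pfun \<beta> c x = 1}"
| "horizon (Parabolic \<beta> c) = {x. pfun \<beta> c x = 1}"

fun hfun :: "nat \<Rightarrow> 'n::finite compactification \<Rightarrow> real ^ 'n \<Rightarrow> real" where
  "hfun k (Directional d) x = (x $ d) ^ k"
| "hfun k (Poincare \<beta> c) x = (1 - pfun \<beta> c x ^ (2 * c)) powr (real k / (2 * real c))"
| "hfun k (Parabolic \<beta> c) x =
     (1 - (2 * real c - 1) / (2 * real c) * (1 - pfun \<beta> c x ^ (2 * c)))
       * (1 - pfun \<beta> c x ^ (2 * c)) ^ k"

text \<open>The rescaled field (\<open>f\<close> with a hat in the directional case, with a tilde in the others) and the
  desingularized field, both as given on \<open>\<D>\<close>.  The values on the horizon are not part of these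
  formulas; they are those of the continuous extension.\<close>

fun rescaled_field ::
    "('n::finite \<Rightarrow> nat) \<Rightarrow> nat \<Rightarrow> 'n compactification \<Rightarrow> (real ^ 'n \<Rightarrow> real ^ 'n) \<Rightarrow> real ^ 'n \<Rightarrow> real ^ 'n"
where
  "rescaled_field \<alpha> k (Directional d) f x =
     (let s = x $ d in
      \<chi> j. s ^ (k + \<alpha> j) * f (\<chi> i. if i = d then inverse (s ^ \<alpha> i) else inverse (s ^ \<alpha> i) * x $ i) $ j)"
| "rescaled_field \<alpha> k (Poincare \<beta> c) f x =
     (let \<kappa> = (1 - pfun \<beta> c x ^ (2 * c)) powr (- 1 / (2 * real c)) in
      \<chi> j. inverse (\<kappa> ^ (k + \<alpha> j)) * f (qscale \<alpha> \<kappa> x) $ j)"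
| "rescaled_field \<alpha> k (Parabolic \<beta> c) f x =
     (let \<kappa> = inverse (1 - pfun \<beta> c x ^ (2 * c)) in
      \<chi> j. inverse (\<kappa> ^ (k + \<alpha> j)) * f (qscale \<alpha> \<kappa> x) $ j)"

fun desing_field ::
    "('n::finite \<Rightarrow> nat) \<Rightarrow> nat \<Rightarrow> 'n compactification \<Rightarrow> (real ^ 'n \<Rightarrow> real ^ 'n) \<Rightarrow> real ^ 'n \<Rightarrow> real ^ 'n"
where
  "desing_field \<alpha> k (Directional d) f x =
     (let F = rescaled_field \<alpha> k (Directional d) f x in
      \<chi> i. if i = d then - (1 / real (\<alpha> d)) * x $ d * F $ d
           else F $ i - real (\<alpha> i) / real (\<alpha> d) * x $ i * F $ d)"
| "desing_field \<alpha> k (Poincare \<beta> c) f x =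
     (let F = rescaled_field \<alpha> k (Poincare \<beta> c) f x in
      \<chi> i. F $ i
           - real (\<alpha> i) * x $ i * (\<Sum>j\<in>UNIV. (x $ j) ^ (2 * \<beta> j - 1) / real (\<alpha> j) * F $ j))"
| "desing_field \<alpha> k (Parabolic \<beta> c) f x =
     (let F = rescaled_field \<alpha> k (Parabolic \<beta> c) f x in
      \<chi> i. (1 - (2 * real c - 1) / (2 * real c) * (1 - pfun \<beta> c x ^ (2 * c))) * F $ i
           - real (\<alpha> i) * x $ i * (\<Sum>j\<in>UNIV. (x $ j) ^ (2 * \<beta> j - 1) / real (\<alpha> j) * F $ j))"

text \<open>\<open>x\<close> is on \<open>[\<tau>0, \<infinity>)\<close> the image under \<open>T\<close> of the solution \<open>y\<close> of \<open>y' = f(y)\<close>, \<open>y(t0) = y0\<close>, expressed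
  in the desingularized time: \<open>x(\<tau>) = T(y(t(\<tau>)))\<close> with \<open>dt/d\<tau> = h(x(\<tau>))\<close>, \<open>t(\<tau>0) = t0\<close>.\<close>

definition image_trajectory ::
    "('n::finite \<Rightarrow> nat) \<Rightarrow> nat \<Rightarrow> 'n compactification \<Rightarrow> (real ^ 'n \<Rightarrow> real ^ 'n) \<Rightarrow>
     real \<Rightarrow> real \<Rightarrow> real ^ 'n \<Rightarrow> (real \<Rightarrow> real ^ 'n) \<Rightarrow> bool" where
  "image_trajectory \<alpha> k K f t0 \<tau>0 y0 x \<longleftrightarrow>
     (\<exists>J (y :: real \<Rightarrow> real ^ 'n) (t :: real \<Rightarrow> real).
        is_interval J \<and> t0 \<in> J \<and> J \<subseteq> {t0..} \<and>
        y t0 = y0 \<and> (\<forall>u\<in>J. (y has_vector_derivative f (y u)) (at u within J)) \<and>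
        t \<tau>0 = t0 \<and>
        (\<forall>\<tau>\<ge>\<tau>0. t \<tau> \<in> J \<and> y (t \<tau>) \<in> tdom K \<and> x \<tau> = tmap \<alpha> K (y (t \<tau>)) \<and>
                (t has_real_derivative hfun k K (x \<tau>)) (at \<tau> within {\<tau>0..})))"

text \<open>\<open>t\<^sub>m\<^sub>a\<^sub>x = t0 + \<integral>\<^bsub>\<tau>0\<^esub>\<^bsup>\<infinity>\<^esup> h(x(\<tau>)) d\<tau>\<close> as a function of the initial point \<open>y\<close>; an unspecified number if there
  is no image trajectory on \<open>[\<tau>0, \<infinity>)\<close> or if the integral diverges.\<close>

definition blowup_time ::
    "('n::finite \<Rightarrow> nat) \<Rightarrow> nat \<Rightarrow> 'n compactification \<Rightarrow> (real ^ 'n \<Rightarrow> real ^ 'n) \<Rightarrow>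
     real \<Rightarrow> real \<Rightarrow> real ^ 'n \<Rightarrow> real" where
  "blowup_time \<alpha> k K f t0 \<tau>0 y =
     (THE b. \<exists>x. image_trajectory \<alpha> k K f t0 \<tau>0 y x \<and>
        ((\<lambda>\<tau>. hfun k K (x \<tau>)) has_integral (b - t0)) {\<tau>0..})"

definition eigenvalues :: "(real ^ 'n::finite \<Rightarrow> real ^ 'n) \<Rightarrow> real set" where
  "eigenvalues A = {\<mu>. \<exists>v. v \<noteq> 0 \<and> A v = \<mu> *\<^sub>R v}"

text \<open>\<open>\<phi>(\<tau>, x0) = x1\<close> for the (possibly only local) flow \<open>\<phi>\<close> of \<open>g\<close>, \<open>\<tau> \<ge> 0\<close>.\<close>

definition flows_to ::
    "(real ^ 'n::finite \<Rightarrow> real ^ 'n) \<Rightarrow> real \<Rightarrow> real ^ 'n \<Rightarrow> real ^ 'n \<Rightarrow> bool" where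
  "flows_to g \<tau> x0 x1 \<longleftrightarrow>
     (\<exists>u. u 0 = x0 \<and> u \<tau> = x1 \<and>
          (\<forall>\<sigma>\<in>{0..\<tau>}. (u has_vector_derivative g (u \<sigma>)) (at \<sigma> within {0..\<tau>})))"

definition unit_cube :: "(real ^ 'm::finite) set" where
  "unit_cube = {\<theta>. \<forall>k. \<bar>\<theta> $ k\<bar> \<le> 1}"

definition open_unit_cube :: "(real ^ 'm::finite) set" where
  "open_unit_cube = {\<theta>. \<forall>k. \<bar>\<theta> $ k\<bar> < 1}"

definition complex_polydisc :: "(complex ^ 'm::finite) set" where
  "complex_polydisc = {z. \<forall>k. cmod (z $ k) \<le> 1}"

text \<open>In (A2), having \<open>n\<close> different real eigenvalues in dimension \<open>n\<close> means that all eigenvalues, with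
  multiplicity and including complex ones, are real and distinct.\<close>

definition spectral_conditions ::
    "(real ^ 'n::finite \<Rightarrow> real ^ 'n) \<Rightarrow> real ^ 'n \<Rightarrow>
     ('m::finite \<Rightarrow> real) \<Rightarrow> ('m \<Rightarrow> real ^ 'n) \<Rightarrow> bool" where
  "spectral_conditions g p lam \<xi> \<longleftrightarrow>
     (let A = frechet_derivative g (at p) in
        card (eigenvalues A) = CARD('n) \<and> 0 \<notin> eigenvalues A \<and>
        inj lam \<and> range lam = {\<mu> \<in> eigenvalues A. \<mu> < 0} \<and>
        (\<forall>j. \<xi> j \<noteq> 0 \<and> A (\<xi> j) = lam j *\<^sub>R \<xi> j))"

definition non_resonant :: "('m::finite \<Rightarrow> real) \<Rightarrow> bool" where
  "non_resonant lam \<longleftrightarrow>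
     (\<forall>j. \<forall>\<gamma> :: 'm \<Rightarrow> nat. (\<Sum>i\<in>UNIV. \<gamma> i) \<ge> 2 \<longrightarrow> (\<Sum>i\<in>UNIV. real (\<gamma> i) * lam i) \<noteq> lam j)"

text \<open>The coefficients \<open>a\<close> are real, so \<open>P\<close> takes values in \<open>\<real>\<^sup>n\<close> exactly on real parameters (for complex
  ones the values are complex): the series converges on the complex polydisc, and \<open>P\<close> is its sum
  on the real points \<open>[-1, 1]\<^sup>m\<close> of the polydisc.\<close>

definition stable_parameterization ::
    "(real ^ 'n::finite \<Rightarrow> real ^ 'n) \<Rightarrow> real ^ 'n \<Rightarrow>
     ('m::finite \<Rightarrow> real) \<Rightarrow> ('m \<Rightarrow> real ^ 'n) \<Rightarrow>
     (('m \<Rightarrow> nat) \<Rightarrow> real ^ 'n) \<Rightarrow> (real ^ 'm \<Rightarrow> real ^ 'n) \<Rightarrow> bool" where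
  "stable_parameterization g p lam \<xi> a P \<longleftrightarrow>
     (\<forall>z\<in>complex_polydisc. \<forall>i. (\<lambda>\<gamma>. monomial z \<gamma> * complex_of_real (a \<gamma> $ i)) summable_on UNIV) \<and>
     (\<forall>\<theta>\<in>unit_cube. ((\<lambda>\<gamma>. monomial \<theta> \<gamma> *\<^sub>R a \<gamma>) has_sum P \<theta>) UNIV) \<and>
     P 0 = p \<and>
     (P has_derivative (\<lambda>v. \<Sum>j\<in>UNIV. v $ j *\<^sub>R \<xi> j)) (at 0) \<and>
     (\<forall>\<theta>\<in>unit_cube. \<forall>\<tau>\<ge>0. flows_to g \<tau> (P \<theta>) (P (\<chi> j. exp (lam j * \<tau>) * \<theta> $ j)))"

end

theory Submission
  imports Defs
begin

text \<open>
  On the stable manifold a trajectory is \<open>x(\<tau>) = P(exp(\<Lambda> (\<tau> - \<tau>\<^sub>0)) \<theta>)\<close>, and \<open>h\<close> agrees on the image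
  domain with a polynomial that vanishes on the horizon. Hence \<open>h(P(\<theta>))\<close> is a power series
  \<open>\<Sum> b\<^sub>\<gamma> \<theta>\<^sup>\<gamma>\<close> without constant term, and integrating it along the linear flow gives
  \<open>t\<^sub>m\<^sub>a\<^sub>x - t\<^sub>0 = \<Phi>(\<theta>) = \<Sum> b\<^sub>\<gamma> / (- \<gamma> \<cdot> \<lambda>) \<theta>\<^sup>\<gamma>\<close>, which is analytic in \<open>\<theta>\<close> and tends to \<open>0\<close> as \<open>\<theta> \<rightarrow> 0\<close>.

  It remains to see that \<open>\<theta>\<close> depends analytically on the initial point. By Gronwall's inequality
  for the flow of \<open>g\<close>, an estimate \<open>c \<bar>\<theta> - \<theta>'\<bar> \<le> \<bar>P(\<theta>) - P(\<theta>')\<bar>\<close> holds on the whole cube because it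
  holds near \<open>0\<close>; thus \<open>P\<close> is injective with injective derivative, and the analytic inverse function theorem provides
  an analytic left inverse. The same theorem makes \<open>T\<close> analytic. At an interior point of
  \<open>T\<^sup>-\<^sup>1(W)\<close> invariance of domain shows that \<open>\<theta>\<close> lies in the open cube. Asymptotic
  quasi-homogeneity enters only to keep the orbits on the stable manifold off the horizon in finite
  time, so that every nearby point of \<open>T\<^sup>-\<^sup>1(W)\<close> does have an image trajectory.
\<close>

text \<open>Everything stays real: convergence at the corner (1, ..., 1) of the cube already makes
  the coefficients of \<open>P\<close> absolutely summable, and one weighted norm then serves
  composition, inversion and integration alike. Dividing coefficients by
  \<open>- \<gamma> \<cdot> \<lambda>\<close> meets no small divisors, because all rates are
  negative and every exponent that occurs has degree at least 1. A local inverse of \<open>P\<close>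
  alone is not enough: a point of \<open>T\<^sup>-\<^sup>1(W)\<close> close to \<open>y0\<close>
  might come from a parameter far away from that of \<open>y0\<close>, and there the local inverse
  says nothing about \<open>\<Phi>\<close>. The estimate on the whole cube excludes this, and it
  also makes the parameter a continuous function of the point. A second obstacle is that
  \<open>g\<close> is tied to \<open>f\<close> only inside the image domain. An orbit of
  \<open>g\<close> can be compared with solutions of y' = f(y) only once it is known never to meet
  the horizon, where the extension of the field is not given by a formula in
  \<open>f\<close>.\<close>

section \<open>Absolutely convergent power series\<close>

text \<open>\<open>M\<close> bounds the norm of \<open>F\<close> in the Banach algebra of power series with weighted \<open>l\<^sup>1\<close> norm
  \<open>\<Sum> \<bar>c\<^sub>\<gamma>\<bar> r\<^bsup>\<bar>\<gamma>\<bar>\<^esup>\<close>, and all terms of \<open>F\<close> have degree at least \<open>d\<close>.\<close>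

definition power_series_bound :: "nat \<Rightarrow> real \<Rightarrow> (real ^ 'n::finite \<Rightarrow> real) \<Rightarrow> real \<Rightarrow> bool" where
  "power_series_bound d r F M \<longleftrightarrow> (\<exists>c :: ('n \<Rightarrow> nat) \<Rightarrow> real.
     (\<forall>\<gamma>. sum \<gamma> UNIV < d \<longrightarrow> c \<gamma> = 0) \<and>
     (\<lambda>\<gamma>. \<bar>c \<gamma>\<bar> * r ^ sum \<gamma> UNIV) summable_on UNIV \<and>
     (\<Sum>\<^sub>\<infinity>\<gamma>. \<bar>c \<gamma>\<bar> * r ^ sum \<gamma> UNIV) \<le> M \<and>
     (\<forall>z. (\<forall>i. \<bar>z $ i\<bar> \<le> r) \<longrightarrow> ((\<lambda>\<gamma>. c \<gamma> * monomial z \<gamma>) has_sum F z) UNIV))"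

lemma abs_monomial_le:
  fixes z :: "real ^ 'n::finite"
  assumes "\<And>i. \<bar>z $ i\<bar> \<le> r"
  shows "\<bar>monomial z \<gamma>\<bar> \<le> r ^ sum \<gamma> UNIV"
proof -
  have "\<bar>monomial z \<gamma>\<bar> = (\<Prod>i\<in>UNIV. \<bar>z $ i\<bar> ^ \<gamma> i)"
    by (simp add: monomial_def abs_prod power_abs)
  also have "\<dots> \<le> (\<Prod>i\<in>UNIV. r ^ \<gamma> i)"
    by (intro prod_mono conjI power_mono assms) auto
  also have "\<dots> = r ^ sum \<gamma> UNIV"
    by (simp add: power_sum)
  finally show ?thesis .
qed

lemma monomial_add:
  fixes z :: "real ^ 'n::finite"
  shows "monomial z (\<lambda>i. \<gamma> i + \<delta> i) = monomial z \<gamma> * monomial z \<delta>"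
  by (simp add: monomial_def power_add prod.distrib)

lemma monomial_zero [simp]:
  fixes z :: "real ^ 'n::finite"
  shows "monomial z (\<lambda>_. 0) = 1"
  by (simp add: monomial_def)

text \<open>Unordered real sums converge absolutely, so they may be regrouped along the fibres of
  any map \<open>e\<close>, whether these are finite or not.\<close>

lemma has_sum_fibres:
  fixes f :: "'i \<Rightarrow> real"
  assumes "(f has_sum S) I"
  shows "((\<lambda>\<gamma>. \<Sum>\<^sub>\<infinity>\<iota>\<in>{\<iota>\<in>I. e \<iota> = \<gamma>}. f \<iota>) has_sum S) UNIV"
proof (rule has_sum_SigmaD)
  have "bij_betw (\<lambda>\<iota>. (e \<iota>, \<iota>)) I (SIGMA \<gamma>:UNIV. {\<iota>\<in>I. e \<iota> = \<gamma>})"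
    by (rule bij_betw_byWitness[where f' = snd]) auto
  from has_sum_reindex_bij_betw[OF this, of "\<lambda>(\<gamma>, \<iota>). f \<iota>"] assms
  show "((\<lambda>(\<gamma>, \<iota>). f \<iota>) has_sum S) (SIGMA \<gamma>:UNIV. {\<iota>\<in>I. e \<iota> = \<gamma>})" by simp
  show "((\<lambda>\<iota>. case (\<gamma>, \<iota>) of (\<gamma>, \<iota>) \<Rightarrow> f \<iota>) has_sum (\<Sum>\<^sub>\<infinity>\<iota>\<in>{\<iota>\<in>I. e \<iota> = \<gamma>}. f \<iota>)) {\<iota>\<in>I. e \<iota> = \<gamma>}" for \<gamma>
  proof -
    have "f summable_on {\<iota>\<in>I. e \<iota> = \<gamma>}"
      by (rule summable_on_subset_banach[of f I]) (use assms in \<open>auto simp: has_sum_imp_summable\<close>)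
    then show ?thesis by simp
  qed
qed

text \<open>An arbitrary family of monomials is admitted here, with repetitions, and grouped by exponents;
  products and infinite sums of series are then handled without explicit convolutions.\<close>

lemma power_series_bound_family:
  fixes F :: "real ^ 'n::finite \<Rightarrow> real" and c :: "'i \<Rightarrow> real"
  assumes r: "r > 0"
    and d: "\<And>\<iota>. \<iota> \<in> I \<Longrightarrow> sum (e \<iota>) UNIV < d \<Longrightarrow> c \<iota> = 0"
    and sm: "(\<lambda>\<iota>. \<bar>c \<iota>\<bar> * r ^ sum (e \<iota>) UNIV) summable_on I"
    and M: "(\<Sum>\<^sub>\<infinity>\<iota>\<in>I. \<bar>c \<iota>\<bar> * r ^ sum (e \<iota>) UNIV) \<le> M"
    and F: "\<And>z. (\<And>i. \<bar>z $ i\<bar> \<le> r) \<Longrightarrow> ((\<lambda>\<iota>. c \<iota> * monomial z (e \<iota>)) has_sum F z) I"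
  shows "power_series_bound d r F M"
proof -
  define B where "B \<gamma> = {\<iota>\<in>I. e \<iota> = \<gamma>}" for \<gamma>
  define C where "C \<gamma> = (\<Sum>\<^sub>\<infinity>\<iota>\<in>B \<gamma>. c \<iota>)" for \<gamma>
  have "(\<lambda>\<iota>. \<bar>c \<iota>\<bar> * r ^ sum (e \<iota>) UNIV) summable_on B \<gamma>" for \<gamma>
    by (rule summable_on_subset_banach[OF sm]) (auto simp: B_def)
  moreover have "((\<lambda>\<iota>. \<bar>c \<iota>\<bar> * r ^ sum (e \<iota>) UNIV) summable_on B \<gamma>) = ((\<lambda>\<iota>. \<bar>c \<iota>\<bar> * r ^ sum \<gamma> UNIV) summable_on B \<gamma>)" for \<gamma>
    by (rule summable_on_cong) (auto simp: B_def)
  ultimately have "(\<lambda>\<iota>. \<bar>c \<iota>\<bar> * r ^ sum \<gamma> UNIV) summable_on B \<gamma>" for \<gamma>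
    by simp
  then have sB: "(\<lambda>\<iota>. \<bar>c \<iota>\<bar>) summable_on B \<gamma>" for \<gamma>
    using summable_on_cmult_left[of "\<lambda>\<iota>. \<bar>c \<iota>\<bar> * r ^ sum \<gamma> UNIV" "B \<gamma>" "inverse (r ^ sum \<gamma> UNIV)"] r
    by (simp add: mult.assoc)
  have aB: "(\<Sum>\<^sub>\<infinity>\<iota>\<in>B \<gamma>. \<bar>c \<iota>\<bar> * r ^ sum (e \<iota>) UNIV) = (\<Sum>\<^sub>\<infinity>\<iota>\<in>B \<gamma>. \<bar>c \<iota>\<bar>) * r ^ sum \<gamma> UNIV" for \<gamma>
  proof -
    have "(\<Sum>\<^sub>\<infinity>\<iota>\<in>B \<gamma>. \<bar>c \<iota>\<bar> * r ^ sum (e \<iota>) UNIV) = (\<Sum>\<^sub>\<infinity>\<iota>\<in>B \<gamma>. \<bar>c \<iota>\<bar> * r ^ sum \<gamma> UNIV)"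
      by (rule infsum_cong) (auto simp: B_def)
    then show ?thesis by (simp add: infsum_cmult_left')
  qed
  have hs: "((\<lambda>\<gamma>. (\<Sum>\<^sub>\<infinity>\<iota>\<in>B \<gamma>. \<bar>c \<iota>\<bar>) * r ^ sum \<gamma> UNIV) has_sum
      (\<Sum>\<^sub>\<infinity>\<iota>\<in>I. \<bar>c \<iota>\<bar> * r ^ sum (e \<iota>) UNIV)) UNIV"
    using has_sum_fibres[OF has_sum_infsum[OF sm], of e] by (simp add: aB flip: B_def)
  have le: "\<bar>C \<gamma>\<bar> * r ^ sum \<gamma> UNIV \<le> (\<Sum>\<^sub>\<infinity>\<iota>\<in>B \<gamma>. \<bar>c \<iota>\<bar>) * r ^ sum \<gamma> UNIV" for \<gamma>
    unfolding C_def using norm_infsum_bound[of c "B \<gamma>"] sB r by (intro mult_right_mono) auto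
  have sC: "(\<lambda>\<gamma>. \<bar>C \<gamma>\<bar> * r ^ sum \<gamma> UNIV) summable_on UNIV"
    by (rule summable_on_comparison_test[OF has_sum_imp_summable[OF hs]]) (use le r in auto)
  show ?thesis
    unfolding power_series_bound_def
  proof (intro exI[of _ C] conjI allI impI)
    show "C \<gamma> = 0" if "sum \<gamma> UNIV < d" for \<gamma>
      unfolding C_def by (rule infsum_0) (use d that in \<open>auto simp: B_def\<close>)
    show "(\<lambda>\<gamma>. \<bar>C \<gamma>\<bar> * r ^ sum \<gamma> UNIV) summable_on UNIV" by fact
    have "(\<Sum>\<^sub>\<infinity>\<gamma>. \<bar>C \<gamma>\<bar> * r ^ sum \<gamma> UNIV) \<le> (\<Sum>\<^sub>\<infinity>\<iota>\<in>I. \<bar>c \<iota>\<bar> * r ^ sum (e \<iota>) UNIV)"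
      by (rule has_sum_mono[OF has_sum_infsum[OF sC] hs le])
    with M show "(\<Sum>\<^sub>\<infinity>\<gamma>. \<bar>C \<gamma>\<bar> * r ^ sum \<gamma> UNIV) \<le> M" by simp
    fix z :: "real ^ 'n" assume z: "\<forall>i. \<bar>z $ i\<bar> \<le> r"
    have "(\<Sum>\<^sub>\<infinity>\<iota>\<in>B \<gamma>. c \<iota> * monomial z (e \<iota>)) = C \<gamma> * monomial z \<gamma>" for \<gamma>
    proof -
      have "(\<Sum>\<^sub>\<infinity>\<iota>\<in>B \<gamma>. c \<iota> * monomial z (e \<iota>)) = (\<Sum>\<^sub>\<infinity>\<iota>\<in>B \<gamma>. c \<iota> * monomial z \<gamma>)"
        by (rule infsum_cong) (auto simp: B_def)
      then show ?thesis by (simp add: infsum_cmult_left' C_def)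
    qed
    then show "((\<lambda>\<gamma>. C \<gamma> * monomial z \<gamma>) has_sum F z) UNIV"
      using has_sum_fibres[OF F, of z e] z by (simp flip: B_def)
  qed
qed

lemma power_series_bound_abs_le:
  assumes "power_series_bound d r F M" "\<And>i. \<bar>z $ i\<bar> \<le> r"
  shows "\<bar>F z\<bar> \<le> M"
proof -
  obtain c where c: "(\<lambda>\<gamma>. \<bar>c \<gamma>\<bar> * r ^ sum \<gamma> UNIV) summable_on UNIV"
     "(\<Sum>\<^sub>\<infinity>\<gamma>. \<bar>c \<gamma>\<bar> * r ^ sum \<gamma> UNIV) \<le> M" "((\<lambda>\<gamma>. c \<gamma> * monomial z \<gamma>) has_sum F z) UNIV"
    using assms unfolding power_series_bound_def by blast
  have le: "\<bar>c \<gamma> * monomial z \<gamma>\<bar> \<le> \<bar>c \<gamma>\<bar> * r ^ sum \<gamma> UNIV" for \<gamma>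
    using abs_monomial_le[OF assms(2)] by (simp add: abs_mult mult_left_mono)
  have s: "(\<lambda>\<gamma>. \<bar>c \<gamma> * monomial z \<gamma>\<bar>) summable_on UNIV"
    by (rule summable_on_comparison_test[OF c(1)]) (use le in auto)
  have "\<bar>F z\<bar> \<le> (\<Sum>\<^sub>\<infinity>\<gamma>. \<bar>c \<gamma> * monomial z \<gamma>\<bar>)"
    using norm_has_sum_bound[OF _ c(3)] s by simp
  also have "\<dots> \<le> (\<Sum>\<^sub>\<infinity>\<gamma>. \<bar>c \<gamma>\<bar> * r ^ sum \<gamma> UNIV)"
    by (rule infsum_mono[OF s c(1) le])
  finally show ?thesis using c(2) by simp
qed

lemma power_series_bound_mono:
  assumes "power_series_bound d r F M" "d' \<le> d" "0 \<le> r'" "r' \<le> r" "M \<le> M'"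
    and "\<And>z. (\<And>i. \<bar>z $ i\<bar> \<le> r') \<Longrightarrow> G z = F z"
  shows "power_series_bound d' r' G M'"
proof -
  obtain c where d: "\<And>\<gamma>. sum \<gamma> UNIV < d \<Longrightarrow> c \<gamma> = 0"
    and c: "(\<lambda>\<gamma>. \<bar>c \<gamma>\<bar> * r ^ sum \<gamma> UNIV) summable_on UNIV"
     "(\<Sum>\<^sub>\<infinity>\<gamma>. \<bar>c \<gamma>\<bar> * r ^ sum \<gamma> UNIV) \<le> M"
    and F: "\<And>z. (\<And>i. \<bar>z $ i\<bar> \<le> r) \<Longrightarrow> ((\<lambda>\<gamma>. c \<gamma> * monomial z \<gamma>) has_sum F z) UNIV"
    using assms(1) unfolding power_series_bound_def by blast
  have le: "\<bar>c \<gamma>\<bar> * r' ^ sum \<gamma> UNIV \<le> \<bar>c \<gamma>\<bar> * r ^ sum \<gamma> UNIV" for \<gamma>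
    using assms by (intro mult_left_mono power_mono) auto
  have s: "(\<lambda>\<gamma>. \<bar>c \<gamma>\<bar> * r' ^ sum \<gamma> UNIV) summable_on UNIV"
    by (rule summable_on_comparison_test[OF c(1)]) (use le assms(3) in auto)
  have "(\<Sum>\<^sub>\<infinity>\<gamma>. \<bar>c \<gamma>\<bar> * r' ^ sum \<gamma> UNIV) \<le> (\<Sum>\<^sub>\<infinity>\<gamma>. \<bar>c \<gamma>\<bar> * r ^ sum \<gamma> UNIV)"
    by (rule infsum_mono[OF s c(1) le])
  moreover have "((\<lambda>\<gamma>. c \<gamma> * monomial z \<gamma>) has_sum G z) UNIV" if "\<forall>i. \<bar>z $ i\<bar> \<le> r'" for z
    using F[of z] assms(4,6) that order_trans by metis
  ultimately show ?thesis unfolding power_series_bound_def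
    using s c(2) assms(2,5) d by (intro exI[of _ c]) auto
qed

lemma power_series_bound_shrink:
  assumes "power_series_bound d r F M" "0 \<le> t" "t \<le> 1" "r \<ge> 0"
  shows "power_series_bound d (t * r) F (t ^ d * M)"
proof -
  obtain c where d: "\<And>\<gamma>. sum \<gamma> UNIV < d \<Longrightarrow> c \<gamma> = 0"
    and c: "(\<lambda>\<gamma>. \<bar>c \<gamma>\<bar> * r ^ sum \<gamma> UNIV) summable_on UNIV"
     "(\<Sum>\<^sub>\<infinity>\<gamma>. \<bar>c \<gamma>\<bar> * r ^ sum \<gamma> UNIV) \<le> M"
    and F: "\<And>z. (\<And>i. \<bar>z $ i\<bar> \<le> r) \<Longrightarrow> ((\<lambda>\<gamma>. c \<gamma> * monomial z \<gamma>) has_sum F z) UNIV"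
    using assms(1) unfolding power_series_bound_def by blast
  have le: "\<bar>c \<gamma>\<bar> * (t * r) ^ sum \<gamma> UNIV \<le> t ^ d * (\<bar>c \<gamma>\<bar> * r ^ sum \<gamma> UNIV)" for \<gamma>
  proof (cases "sum \<gamma> UNIV < d")
    case False
    then have "t ^ sum \<gamma> UNIV \<le> t ^ d" using assms by (intro power_decreasing) auto
    then have "t ^ sum \<gamma> UNIV * (\<bar>c \<gamma>\<bar> * r ^ sum \<gamma> UNIV) \<le> t ^ d * (\<bar>c \<gamma>\<bar> * r ^ sum \<gamma> UNIV)"
      using assms by (intro mult_right_mono) auto
    then show ?thesis by (simp add: power_mult_distrib algebra_simps)
  qed (simp add: d)
  have s: "(\<lambda>\<gamma>. \<bar>c \<gamma>\<bar> * (t * r) ^ sum \<gamma> UNIV) summable_on UNIV"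
    by (rule summable_on_comparison_test[OF summable_on_cmult_right[OF c(1)]]) (use le assms in auto)
  have "(\<Sum>\<^sub>\<infinity>\<gamma>. \<bar>c \<gamma>\<bar> * (t * r) ^ sum \<gamma> UNIV) \<le> (\<Sum>\<^sub>\<infinity>\<gamma>. t ^ d * (\<bar>c \<gamma>\<bar> * r ^ sum \<gamma> UNIV))"
    by (rule infsum_mono[OF s summable_on_cmult_right[OF c(1)] le])
  also have "\<dots> \<le> t ^ d * M"
    using c(2) assms by (simp add: infsum_cmult_right' mult_left_mono)
  finally have "(\<Sum>\<^sub>\<infinity>\<gamma>. \<bar>c \<gamma>\<bar> * (t * r) ^ sum \<gamma> UNIV) \<le> t ^ d * M" .
  moreover have "((\<lambda>\<gamma>. c \<gamma> * monomial z \<gamma>) has_sum F z) UNIV" if "\<forall>i. \<bar>z $ i\<bar> \<le> t * r" for z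
    using F[of z] that assms mult_left_le_one_le[of r t] order_trans by metis
  ultimately show ?thesis unfolding power_series_bound_def
    using s d by (intro exI[of _ c]) auto
qed

section \<open>Algebra and composition of power series\<close>

lemma power_series_bound_const:
  "\<bar>a\<bar> \<le> M \<Longrightarrow> r > 0 \<Longrightarrow> power_series_bound 0 r (\<lambda>_ :: real ^ 'n::finite. a) M"
  by (rule power_series_bound_family[of r "{()}" "\<lambda>_ _. 0" _ "\<lambda>_. a"])
     (auto intro!: has_sum_finiteI)

lemma power_series_bound_component:
  assumes "r > 0"
  shows "power_series_bound 1 r (\<lambda>z :: real ^ 'n::finite. z $ i) r"
proof (rule power_series_bound_family[of r "{()}" "\<lambda>_ j. if j = i then 1 else 0" _ "\<lambda>_. 1"])
  have "(\<Prod>j\<in>UNIV. z $ j ^ (if j = i then 1 else 0)) = z $ i" for z :: "real ^ 'n"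
    by (subst prod.cong[OF refl, of UNIV _ "\<lambda>j. if j = i then z $ j else 1"]) auto
  then show "((\<lambda>\<iota>. 1 * monomial z (\<lambda>j. if j = i then 1 else 0)) has_sum z $ i) {()}" for z :: "real ^ 'n"
    by (intro has_sum_finiteI) (auto simp: monomial_def)
qed (use assms in auto)

text \<open>Completeness of the weighted space: the coefficients of all \<open>F k\<close> form a
  single absolutely summable family on \<open>K \<times> UNIV\<close>, which is then grouped by
  exponents.\<close>

lemma power_series_bound_infsum:
  fixes F :: "'k \<Rightarrow> real ^ 'n::finite \<Rightarrow> real"
  assumes r: "r > 0"
    and F: "\<And>k. k \<in> K \<Longrightarrow> power_series_bound d r (F k) (M k)"
    and M: "(M has_sum S) K"
    and G: "\<And>z. (\<And>i. \<bar>z $ i\<bar> \<le> r) \<Longrightarrow> ((\<lambda>k. F k z) has_sum G z) K"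
  shows "power_series_bound d r G S"
proof -
  have "\<exists>c. (\<forall>\<gamma>. sum \<gamma> UNIV < d \<longrightarrow> c \<gamma> = 0) \<and>
     (\<lambda>\<gamma>. \<bar>c \<gamma>\<bar> * r ^ sum \<gamma> UNIV) summable_on UNIV \<and>
     (\<Sum>\<^sub>\<infinity>\<gamma>. \<bar>c \<gamma>\<bar> * r ^ sum \<gamma> UNIV) \<le> M k \<and>
     (\<forall>z. (\<forall>i. \<bar>z $ i\<bar> \<le> r) \<longrightarrow> ((\<lambda>\<gamma>. c \<gamma> * monomial z \<gamma>) has_sum F k z) UNIV)" if "k \<in> K" for k
    using F[OF that] unfolding power_series_bound_def .
  then have "\<exists>c. \<forall>k\<in>K. (\<forall>\<gamma>. sum \<gamma> UNIV < d \<longrightarrow> c k \<gamma> = 0) \<and>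
     (\<lambda>\<gamma>. \<bar>c k \<gamma>\<bar> * r ^ sum \<gamma> UNIV) summable_on UNIV \<and>
     (\<Sum>\<^sub>\<infinity>\<gamma>. \<bar>c k \<gamma>\<bar> * r ^ sum \<gamma> UNIV) \<le> M k \<and>
     (\<forall>z. (\<forall>i. \<bar>z $ i\<bar> \<le> r) \<longrightarrow> ((\<lambda>\<gamma>. c k \<gamma> * monomial z \<gamma>) has_sum F k z) UNIV)"
    by (intro bchoice ballI)
  then obtain c where d: "\<And>k \<gamma>. k \<in> K \<Longrightarrow> sum \<gamma> UNIV < d \<Longrightarrow> c k \<gamma> = 0"
    and s: "\<And>k. k \<in> K \<Longrightarrow> (\<lambda>\<gamma>. \<bar>c k \<gamma>\<bar> * r ^ sum \<gamma> UNIV) summable_on UNIV"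
    and le: "\<And>k. k \<in> K \<Longrightarrow> (\<Sum>\<^sub>\<infinity>\<gamma>. \<bar>c k \<gamma>\<bar> * r ^ sum \<gamma> UNIV) \<le> M k"
    and hs: "\<And>k z. k \<in> K \<Longrightarrow> (\<And>i. \<bar>z $ i\<bar> \<le> r) \<Longrightarrow> ((\<lambda>\<gamma>. c k \<gamma> * monomial z \<gamma>) has_sum F k z) UNIV"
    by blast
  define L where "L k = (\<Sum>\<^sub>\<infinity>\<gamma>. \<bar>c k \<gamma>\<bar> * r ^ sum \<gamma> UNIV)" for k
  have L0: "L k \<ge> 0" for k unfolding L_def using r by (intro infsum_nonneg) auto
  have sL: "L summable_on K"
    by (rule summable_on_comparison_test[OF has_sum_imp_summable[OF M]]) (use le L0 in \<open>auto simp: L_def\<close>)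
  have sP: "(\<lambda>(k, \<gamma>). \<bar>c k \<gamma>\<bar> * r ^ sum \<gamma> UNIV) summable_on (K \<times> UNIV)"
    by (rule summable_on_SigmaI[where g = L]) (use s sL r in \<open>auto simp: L_def\<close>)
  have hP: "((\<lambda>(k, \<gamma>). \<bar>c k \<gamma>\<bar> * r ^ sum \<gamma> UNIV) has_sum (infsum L K)) (K \<times> UNIV)"
    by (rule has_sum_SigmaI[where g = L]) (use s sL sP in \<open>auto simp: L_def\<close>)
  show ?thesis
  proof (rule power_series_bound_family[of r "K \<times> UNIV" snd d "\<lambda>(k, \<gamma>). c k \<gamma>"])
    have "infsum L K \<le> S"
      by (rule has_sum_mono[OF has_sum_infsum[OF sL] M]) (use le in \<open>auto simp: L_def\<close>)
    with infsumI[OF hP] show "(\<Sum>\<^sub>\<infinity>\<iota>\<in>K \<times> UNIV. \<bar>case \<iota> of (k, \<gamma>) \<Rightarrow> c k \<gamma>\<bar> * r ^ sum (snd \<iota>) UNIV) \<le> S"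
      by (simp add: case_prod_unfold)
    show "(\<lambda>\<iota>. \<bar>case \<iota> of (k, \<gamma>) \<Rightarrow> c k \<gamma>\<bar> * r ^ sum (snd \<iota>) UNIV) summable_on K \<times> UNIV"
      using sP by (simp add: case_prod_unfold)
    fix z :: "real ^ 'n" assume z: "\<And>i. \<bar>z $ i\<bar> \<le> r"
    show "((\<lambda>\<iota>. (case \<iota> of (k, \<gamma>) \<Rightarrow> c k \<gamma>) * monomial z (snd \<iota>)) has_sum G z) (K \<times> UNIV)"
    proof (rule has_sum_SigmaI[where g = "\<lambda>k. F k z"])
      show "(\<lambda>\<iota>. (case \<iota> of (k, \<gamma>) \<Rightarrow> c k \<gamma>) * monomial z (snd \<iota>)) summable_on (K \<times> UNIV)"
      proof (rule abs_summable_summable, rule summable_on_comparison_test[OF sP])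
        show "norm ((case \<iota> of (k, \<gamma>) \<Rightarrow> c k \<gamma>) * monomial z (snd \<iota>)) \<le> (case \<iota> of (k, \<gamma>) \<Rightarrow> \<bar>c k \<gamma>\<bar> * r ^ sum \<gamma> UNIV)" for \<iota>
          using abs_monomial_le[OF z] by (auto simp: case_prod_unfold abs_mult mult_left_mono)
      qed auto
    qed (use hs G z in auto)
  qed (use r d in auto)
qed

lemma power_series_bound_sum:
  assumes "finite K" "r > 0" "\<And>k. k \<in> K \<Longrightarrow> power_series_bound d r (F k) (M k)"
  shows "power_series_bound d r (\<lambda>z. \<Sum>k\<in>K. F k z) (\<Sum>k\<in>K. M k)"
  by (rule power_series_bound_infsum[of r K d F M]) (use assms in auto)

lemma power_series_bound_add:
  assumes "r > 0" "power_series_bound d r F M" "power_series_bound d r G N"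
  shows "power_series_bound d r (\<lambda>z. F z + G z) (M + N)"
  using power_series_bound_sum[of "UNIV :: bool set" r d "\<lambda>b. if b then F else G" "\<lambda>b. if b then M else N"] assms
  by (simp add: UNIV_bool add.commute)

text \<open>Multiplying \<open>G\<close> by one term of \<open>F\<close> only shifts exponents, so
  each such product is a family indexed by the exponents of \<open>G\<close>. Summing these families
  over the terms of \<open>F\<close> gives the product, with the submultiplicative bound of a Banach
  algebra.\<close>

lemma power_series_bound_mult:
  fixes F G :: "real ^ 'n::finite \<Rightarrow> real"
  assumes r: "r > 0" and "power_series_bound d r F M" and "power_series_bound d' r G N"
  shows "power_series_bound (d + d') r (\<lambda>z. F z * G z) (M * N)"
proof -
  obtain c where c: "\<And>\<gamma>. sum \<gamma> UNIV < d \<Longrightarrow> c \<gamma> = 0"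
     "(\<lambda>\<gamma>. \<bar>c \<gamma>\<bar> * r ^ sum \<gamma> UNIV) summable_on UNIV"
     "(\<Sum>\<^sub>\<infinity>\<gamma>. \<bar>c \<gamma>\<bar> * r ^ sum \<gamma> UNIV) \<le> M"
     "\<And>z. (\<And>i. \<bar>z $ i\<bar> \<le> r) \<Longrightarrow> ((\<lambda>\<gamma>. c \<gamma> * monomial z \<gamma>) has_sum F z) UNIV"
    using assms(2) unfolding power_series_bound_def by blast
  obtain e where e: "\<And>\<gamma>. sum \<gamma> UNIV < d' \<Longrightarrow> e \<gamma> = 0"
     "(\<lambda>\<gamma>. \<bar>e \<gamma>\<bar> * r ^ sum \<gamma> UNIV) summable_on UNIV"
     "(\<Sum>\<^sub>\<infinity>\<gamma>. \<bar>e \<gamma>\<bar> * r ^ sum \<gamma> UNIV) \<le> N"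
     "\<And>z. (\<And>i. \<bar>z $ i\<bar> \<le> r) \<Longrightarrow> ((\<lambda>\<gamma>. e \<gamma> * monomial z \<gamma>) has_sum G z) UNIV"
    using assms(3) unfolding power_series_bound_def by blast
  have "power_series_bound (d + d') r (\<lambda>z. c \<gamma> * monomial z \<gamma> * G z) (\<bar>c \<gamma>\<bar> * r ^ sum \<gamma> UNIV * N)" for \<gamma>
  proof (rule power_series_bound_family[of r UNIV "\<lambda>\<delta> i. \<gamma> i + \<delta> i" _ "\<lambda>\<delta>. c \<gamma> * e \<delta>"])
    have eq: "\<bar>c \<gamma> * e \<delta>\<bar> * r ^ (\<Sum>i\<in>UNIV. \<gamma> i + \<delta> i) = \<bar>c \<gamma>\<bar> * r ^ sum \<gamma> UNIV * (\<bar>e \<delta>\<bar> * r ^ sum \<delta> UNIV)" for \<delta>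
      by (simp add: sum.distrib power_add abs_mult)
    show "(\<lambda>\<delta>. \<bar>c \<gamma> * e \<delta>\<bar> * r ^ (\<Sum>i\<in>UNIV. \<gamma> i + \<delta> i)) summable_on UNIV"
      unfolding eq by (rule summable_on_cmult_right) (rule e)
    show "(\<Sum>\<^sub>\<infinity>\<delta>. \<bar>c \<gamma> * e \<delta>\<bar> * r ^ (\<Sum>i\<in>UNIV. \<gamma> i + \<delta> i)) \<le> \<bar>c \<gamma>\<bar> * r ^ sum \<gamma> UNIV * N"
      unfolding eq infsum_cmult_right' using e(3) r by (intro mult_left_mono) auto
    show "((\<lambda>\<delta>. c \<gamma> * e \<delta> * monomial z (\<lambda>i. \<gamma> i + \<delta> i)) has_sum c \<gamma> * monomial z \<gamma> * G z) UNIV"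
      if "\<And>i. \<bar>z $ i\<bar> \<le> r" for z :: "real ^ 'n"
      using has_sum_cmult_right[OF e(4)[OF that], of "c \<gamma> * monomial z \<gamma>"] by (simp add: monomial_add mult_ac)
    show "c \<gamma> * e \<delta> = 0" if "(\<Sum>i\<in>UNIV. \<gamma> i + \<delta> i) < d + d'" for \<delta>
      using that c(1)[of \<gamma>] e(1)[of \<delta>] by (force simp: sum.distrib)
  qed (use r in auto)
  then have "power_series_bound (d + d') r (\<lambda>z. F z * G z) ((\<Sum>\<^sub>\<infinity>\<gamma>. \<bar>c \<gamma>\<bar> * r ^ sum \<gamma> UNIV) * N)"
    by (rule power_series_bound_infsum[OF r, of UNIV _ "\<lambda>\<gamma> z. c \<gamma> * monomial z \<gamma> * G z"
          "\<lambda>\<gamma>. \<bar>c \<gamma>\<bar> * r ^ sum \<gamma> UNIV * N"]) (use c in \<open>auto intro!: has_sum_cmult_left\<close>)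
  then show ?thesis
  proof (rule power_series_bound_mono)
    have "N \<ge> 0"
      using power_series_bound_abs_le[OF assms(3), of 0] r by simp
    then show "(\<Sum>\<^sub>\<infinity>\<gamma>. \<bar>c \<gamma>\<bar> * r ^ sum \<gamma> UNIV) * N \<le> M * N"
      using c(3) by (rule mult_right_mono[rotated])
  qed (use r in auto)
qed

lemmas power_series_bound_mult0 = power_series_bound_mult[where d = 0 and d' = 0, simplified]

lemma power_series_bound_cmult:
  assumes "r > 0" "power_series_bound d r F M"
  shows "power_series_bound d r (\<lambda>z. a * F z) (\<bar>a\<bar> * M)"
  using power_series_bound_mult[OF assms(1) power_series_bound_const[OF order_refl assms(1)] assms(2), of a]
  by simp

lemma power_series_bound_diff:
  assumes "r > 0" "power_series_bound d r F M" "power_series_bound d r G N"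
  shows "power_series_bound d r (\<lambda>z. F z - G z) (M + N)"
  using power_series_bound_add[OF assms(1,2) power_series_bound_cmult[OF assms(1,3), of "-1"]] by simp

lemma power_series_bound_power:
  assumes "r > 0" "power_series_bound 0 r F M"
  shows "power_series_bound 0 r (\<lambda>z. F z ^ n) (M ^ n)"
proof (induction n)
  case 0
  show ?case using power_series_bound_const[of 1 1 r] assms by simp
next
  case (Suc n)
  show ?case using power_series_bound_mult[OF assms Suc] by simp
qed

lemma power_series_bound_prod:
  assumes "r > 0" "finite A" "\<And>i. i \<in> A \<Longrightarrow> power_series_bound 0 r (u i) (M i)"
  shows "power_series_bound 0 r (\<lambda>z. \<Prod>i\<in>A. u i z) (\<Prod>i\<in>A. M i)"
  using assms(2,3)
proof (induction A)
  case empty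
  show ?case using power_series_bound_const[of 1 1 r] assms by simp
next
  case (insert a A)
  then show ?case using power_series_bound_mult[OF assms(1), of 0 "u a" "M a" 0] by simp
qed

lemma power_series_bound_monomial:
  fixes u :: "'m::finite \<Rightarrow> real ^ 'n::finite \<Rightarrow> real"
  assumes "r > 0" "\<And>i. power_series_bound 0 r (u i) \<rho>"
  shows "power_series_bound 0 r (\<lambda>z. monomial (\<chi> i. u i z) \<gamma>) (\<rho> ^ sum \<gamma> UNIV)"
  using power_series_bound_prod[OF assms(1) finite, of UNIV "\<lambda>i z. u i z ^ \<gamma> i" "\<lambda>i. \<rho> ^ \<gamma> i"]
    power_series_bound_power[OF assms]
  by (simp add: monomial_def power_sum)

text \<open>The norm of a monomial in the \<open>u i\<close> is at most \<rho> to its degree, so the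
  series of \<open>Q\<close> at radius \<rho> majorizes the substituted one. The constant terms of
  the \<open>u i\<close> may be nonzero; only their norms matter.\<close>

lemma power_series_bound_compose:
  fixes u :: "'m::finite \<Rightarrow> real ^ 'n::finite \<Rightarrow> real"
  assumes "r > 0" "power_series_bound d \<rho> Q M" "\<And>i. power_series_bound 0 r (u i) \<rho>"
  shows "power_series_bound 0 r (\<lambda>z. Q (\<chi> i. u i z)) M"
proof -
  obtain c where c: "(\<lambda>\<gamma>. \<bar>c \<gamma>\<bar> * \<rho> ^ sum \<gamma> UNIV) summable_on UNIV"
     "(\<Sum>\<^sub>\<infinity>\<gamma>. \<bar>c \<gamma>\<bar> * \<rho> ^ sum \<gamma> UNIV) \<le> M"
     "\<And>z. (\<And>i. \<bar>z $ i\<bar> \<le> \<rho>) \<Longrightarrow> ((\<lambda>\<gamma>. c \<gamma> * monomial z \<gamma>) has_sum Q z) UNIV"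
    using assms(2) unfolding power_series_bound_def by blast
  have "power_series_bound 0 r (\<lambda>z. c \<gamma> * monomial (\<chi> i. u i z) \<gamma>) (\<bar>c \<gamma>\<bar> * \<rho> ^ sum \<gamma> UNIV)" for \<gamma>
    by (intro power_series_bound_cmult power_series_bound_monomial assms)
  then have "power_series_bound 0 r (\<lambda>z. Q (\<chi> i. u i z)) (\<Sum>\<^sub>\<infinity>\<gamma>. \<bar>c \<gamma>\<bar> * \<rho> ^ sum \<gamma> UNIV)"
    by (rule power_series_bound_infsum[OF assms(1), of UNIV _ "\<lambda>\<gamma> z. c \<gamma> * monomial (\<chi> i. u i z) \<gamma>"])
       (use c power_series_bound_abs_le[OF assms(3)] in auto)
  then show ?thesis by (rule power_series_bound_mono) (use c assms in auto)
qed

text \<open>A Leibniz rule: the pattern \<open>n * \<rho> ^ (n - 1) * \<delta>\<close>, the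
  derivative of \<rho>^n times \<delta>, is stable under products because u1 u2 - v1 v2 = (u1 - v1)
  u2 + v1 (u2 - v2). The truncated exponent at n = 0 is harmless, as the factor n vanishes
  there.\<close>

lemma power_series_bound_prod_diff:
  assumes r: "r > 0"
    and "power_series_bound 0 r u1 (\<rho> ^ m)" "power_series_bound 0 r v2 (\<rho> ^ n)"
    and "power_series_bound 0 r u2 (\<rho> ^ n)" "power_series_bound 0 r v1 (\<rho> ^ m)"
    and "power_series_bound 0 r (\<lambda>z. u1 z - v1 z) (m * \<rho> ^ (m - 1) * \<delta>)"
    and "power_series_bound 0 r (\<lambda>z. u2 z - v2 z) (n * \<rho> ^ (n - 1) * \<delta>)"
  shows "power_series_bound 0 r (\<lambda>z. u1 z * u2 z - v1 z * v2 z) (real (m + n) * \<rho> ^ (m + n - 1) * \<delta>)"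
proof -
  have "power_series_bound 0 r (\<lambda>z. (u1 z - v1 z) * u2 z + v1 z * (u2 z - v2 z))
     (m * \<rho> ^ (m - 1) * \<delta> * \<rho> ^ n + \<rho> ^ m * (n * \<rho> ^ (n - 1) * \<delta>))"
    by (intro power_series_bound_add[OF r] power_series_bound_mult0[OF r] assms)
  moreover have "m * \<rho> ^ (m - 1) * \<delta> * \<rho> ^ n + \<rho> ^ m * (n * \<rho> ^ (n - 1) * \<delta>)
      = real (m + n) * \<rho> ^ (m + n - 1) * \<delta>"
    by (cases m; cases n) (auto simp: algebra_simps power_add)
  moreover have "(\<lambda>z. (u1 z - v1 z) * u2 z + v1 z * (u2 z - v2 z)) = (\<lambda>z. u1 z * u2 z - v1 z * v2 z)"
    by (auto simp: algebra_simps)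
  ultimately show ?thesis by simp
qed

lemma power_series_bound_monomial_diff:
  fixes u v :: "'m::finite \<Rightarrow> real ^ 'n::finite \<Rightarrow> real"
  assumes r: "r > 0" and u: "\<And>i. power_series_bound 0 r (u i) \<rho>"
    and v: "\<And>i. power_series_bound 0 r (v i) \<rho>"
    and uv: "\<And>i. power_series_bound 0 r (\<lambda>z. u i z - v i z) \<delta>"
  shows "power_series_bound 0 r (\<lambda>z. monomial (\<chi> i. u i z) \<gamma> - monomial (\<chi> i. v i z) \<gamma>)
    (real (sum \<gamma> UNIV) * \<rho> ^ (sum \<gamma> UNIV - 1) * \<delta>)"
proof -
  have pw: "power_series_bound 0 r (\<lambda>z. u i z ^ n - v i z ^ n) (real n * \<rho> ^ (n - 1) * \<delta>)" for i n
  proof (induction n)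
    case 0
    show ?case using power_series_bound_const[of 0 0 r] r by simp
  next
    case (Suc n)
    show ?case
      using power_series_bound_prod_diff[OF r, of "u i" \<rho> 1 "\<lambda>z. v i z ^ n" n "\<lambda>z. u i z ^ n" "v i" \<delta>] Suc u v uv
        power_series_bound_power[OF r u[of i], of n] power_series_bound_power[OF r v[of i], of n] by simp
  qed
  have "power_series_bound 0 r (\<lambda>z. (\<Prod>i\<in>A. u i z ^ \<gamma> i) - (\<Prod>i\<in>A. v i z ^ \<gamma> i))
      (real (sum \<gamma> A) * \<rho> ^ (sum \<gamma> A - 1) * \<delta>)" if "finite A" for A
    using that
  proof (induction A)
    case empty
    show ?case using power_series_bound_const[of 0 0 r] r by simp
  next
    case (insert a A)
    have "power_series_bound 0 r (\<lambda>z. \<Prod>i\<in>A. w i z ^ \<gamma> i) (\<rho> ^ sum \<gamma> A)"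
      if "\<And>i. power_series_bound 0 r (w i) \<rho>" for w
      unfolding power_sum
      by (intro power_series_bound_prod power_series_bound_power that r insert)
    from this[OF u] this[OF v] show ?case
      using power_series_bound_prod_diff[OF r, of "\<lambda>z. u a z ^ \<gamma> a" \<rho> "\<gamma> a" "\<lambda>z. \<Prod>i\<in>A. v i z ^ \<gamma> i" "sum \<gamma> A"
         "\<lambda>z. \<Prod>i\<in>A. u i z ^ \<gamma> i" "\<lambda>z. v a z ^ \<gamma> a" \<delta>] insert pw[of a "\<gamma> a"]
        power_series_bound_power[OF r u[of a]] power_series_bound_power[OF r v[of a]] by simp
  qed
  from this[OF finite[of UNIV]] show ?thesis by (simp add: monomial_def)
qed

text \<open>The left side equals 2 at n = 0 and does not increase, since (n + 3) / 2 is at most n +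
  2. It is applied to terms of degree n + 2.\<close>

lemma mult_power_le_two:
  assumes "0 \<le> (t::real)" "t \<le> 1/2"
  shows "real (n + 2) * t ^ n \<le> 2"
proof (induction n)
  case (Suc n)
  have "real (Suc n + 2) * t \<le> real (n + 2)"
    using mult_left_mono[OF assms(2), of "real (Suc n + 2)"] by (simp add: field_simps)
  then have "real (Suc n + 2) * t * t ^ n \<le> real (n + 2) * t ^ n"
    using assms by (intro mult_right_mono) auto
  with Suc show ?case by (simp add: mult.assoc)
qed simp

text \<open>A term of degree j at least 2 has Lipschitz factor j (t \<rho>)^(j - 1) on the polydisc
  of radius t \<rho>, which is at most (2 t / \<rho>) \<rho>^j. The factor t that survives makes the
  Lipschitz constant of \<open>Q\<close> as small as desired on small polydiscs.\<close>

lemma power_series_bound_lipschitz_compose: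
  fixes u v :: "'m::finite \<Rightarrow> real ^ 'n::finite \<Rightarrow> real"
  assumes r: "r > 0" and Q: "power_series_bound 2 \<rho> Q M" and \<rho>: "\<rho> > 0"
    and t: "0 \<le> t" "t \<le> 1/2"
    and u: "\<And>i. power_series_bound 0 r (u i) (t * \<rho>)"
    and v: "\<And>i. power_series_bound 0 r (v i) (t * \<rho>)"
    and uv: "\<And>i. power_series_bound 0 r (\<lambda>z. u i z - v i z) \<delta>"
  shows "power_series_bound 0 r (\<lambda>z. Q (\<chi> i. u i z) - Q (\<chi> i. v i z)) (2 * t / \<rho> * M * \<delta>)"
proof -
  have \<delta>: "\<delta> \<ge> 0" using power_series_bound_abs_le[OF uv[of undefined], of 0] r by simp
  obtain c where d: "\<And>\<gamma>. sum \<gamma> UNIV < 2 \<Longrightarrow> c \<gamma> = 0"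
    and c: "(\<lambda>\<gamma>. \<bar>c \<gamma>\<bar> * \<rho> ^ sum \<gamma> UNIV) summable_on UNIV"
     "(\<Sum>\<^sub>\<infinity>\<gamma>. \<bar>c \<gamma>\<bar> * \<rho> ^ sum \<gamma> UNIV) \<le> M"
     "\<And>z. (\<And>i. \<bar>z $ i\<bar> \<le> \<rho>) \<Longrightarrow> ((\<lambda>\<gamma>. c \<gamma> * monomial z \<gamma>) has_sum Q z) UNIV"
    using Q unfolding power_series_bound_def by blast
  define B where "B \<gamma> = \<bar>c \<gamma>\<bar> * (real (sum \<gamma> UNIV) * (t * \<rho>) ^ (sum \<gamma> UNIV - 1) * \<delta>)" for \<gamma>
  have le: "B \<gamma> \<le> 2 * t / \<rho> * \<delta> * (\<bar>c \<gamma>\<bar> * \<rho> ^ sum \<gamma> UNIV)" for \<gamma>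
  proof (cases "sum \<gamma> UNIV < 2")
    case False
    then obtain n where n: "sum \<gamma> UNIV = n + 2" by (metis add.commute le_Suc_ex not_less)
    have "real (n + 2) * t ^ n * (\<rho> ^ (n + 1) * t) \<le> 2 * (\<rho> ^ (n + 1) * t)"
      using mult_power_le_two[OF t] t \<rho> by (intro mult_right_mono) auto
    then have "real (n + 2) * (t * \<rho>) ^ (n + 1) \<le> 2 * t / \<rho> * \<rho> ^ (n + 2)"
      using \<rho> by (simp add: power_mult_distrib algebra_simps)
    then have "(real (n + 2) * (t * \<rho>) ^ (n + 1)) * (\<bar>c \<gamma>\<bar> * \<delta>) \<le> (2 * t / \<rho> * \<rho> ^ (n + 2)) * (\<bar>c \<gamma>\<bar> * \<delta>)"
      using \<delta> by (intro mult_right_mono) auto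
    then show ?thesis unfolding B_def n using \<rho> by (simp add: algebra_simps)
  qed (simp add: d B_def)
  have "B \<gamma> \<ge> 0" for \<gamma> using t \<rho> \<delta> by (simp add: B_def del: of_nat_sum)
  then have sB: "B summable_on UNIV"
    by (intro summable_on_comparison_test[OF summable_on_cmult_right[OF c(1)] le]) auto
  have "infsum B UNIV \<le> (\<Sum>\<^sub>\<infinity>\<gamma>. 2 * t / \<rho> * \<delta> * (\<bar>c \<gamma>\<bar> * \<rho> ^ sum \<gamma> UNIV))"
    by (rule infsum_mono[OF sB summable_on_cmult_right[OF c(1)] le])
  also have "\<dots> \<le> 2 * t / \<rho> * \<delta> * M"
    unfolding infsum_cmult_right' using c(2) t \<rho> \<delta> by (intro mult_left_mono) auto
  finally have le: "infsum B UNIV \<le> 2 * t / \<rho> * M * \<delta>" by (simp add: algebra_simps)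
  have p1: "power_series_bound 0 r (\<lambda>z. c \<gamma> * (monomial (\<chi> i. u i z) \<gamma> - monomial (\<chi> i. v i z) \<gamma>)) (B \<gamma>)" for \<gamma>
    unfolding B_def by (intro power_series_bound_cmult power_series_bound_monomial_diff r u v uv)
  have t1: "t * \<rho> \<le> \<rho>" using t \<rho> by simp
  have "\<bar>u i z\<bar> \<le> \<rho>" "\<bar>v i z\<bar> \<le> \<rho>" if "\<And>i. \<bar>z $ i\<bar> \<le> r" for z i
    using power_series_bound_abs_le[OF u that, of i] power_series_bound_abs_le[OF v that, of i] t1
    by simp_all
  then have p2: "((\<lambda>\<gamma>. c \<gamma> * (monomial (\<chi> i. u i z) \<gamma> - monomial (\<chi> i. v i z) \<gamma>)) has_sum
     Q (\<chi> i. u i z) - Q (\<chi> i. v i z)) UNIV" if "\<And>i. \<bar>z $ i\<bar> \<le> r" for z :: "real ^ 'n"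
    using has_sum_add[OF c(3)[of "\<chi> i. u i z"] has_sum_uminusI[OF c(3)[of "\<chi> i. v i z"]]] that
    by (simp add: algebra_simps)
  have "power_series_bound 0 r (\<lambda>z. Q (\<chi> i. u i z) - Q (\<chi> i. v i z)) (infsum B UNIV)"
    by (rule power_series_bound_infsum[OF r, of UNIV _ "\<lambda>\<gamma> z. c \<gamma> * (monomial (\<chi> i. u i z) \<gamma> - monomial (\<chi> i. v i z) \<gamma>)" B])
       (use p1 p2 sB in auto)
  then show ?thesis by (rule power_series_bound_mono) (use le r in auto)
qed

text \<open>The pointwise version: the coordinates of \<open>x\<close> and \<open>y\<close> are
  regarded as constant power series.\<close>

lemma power_series_bound_lipschitz:
  fixes Q :: "real ^ 'm::finite \<Rightarrow> real"
  assumes "power_series_bound 2 \<rho> Q M" "\<rho> > 0" "0 \<le> t" "t \<le> 1/2"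
    and "\<And>i. \<bar>x $ i\<bar> \<le> t * \<rho>" "\<And>i. \<bar>y $ i\<bar> \<le> t * \<rho>" "\<And>i. \<bar>x $ i - y $ i\<bar> \<le> \<delta>"
  shows "\<bar>Q x - Q y\<bar> \<le> 2 * t / \<rho> * M * \<delta>"
proof -
  have "power_series_bound 0 1 (\<lambda>z :: real ^ 'm. Q (\<chi> i. x $ i) - Q (\<chi> i. y $ i)) (2 * t / \<rho> * M * \<delta>)"
    by (rule power_series_bound_lipschitz_compose[OF _ assms(1)])
       (use assms in \<open>auto intro!: power_series_bound_const\<close>)
  from power_series_bound_abs_le[OF this, of 0] show ?thesis by simp
qed

text \<open>First-order Taylor expansion with an exact remainder. Deleting the finitely many
  coefficients of degree 0 and 1 cannot increase the norm, so the remainder keeps the bound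
  \<open>M\<close>.\<close>

lemma power_series_bound_split:
  fixes F :: "real ^ 'n::finite \<Rightarrow> real"
  assumes F: "power_series_bound 0 r F M" and r: "r > 0"
  obtains l N where "power_series_bound 2 r N M"
    "\<And>z. (\<And>i. \<bar>z $ i\<bar> \<le> r) \<Longrightarrow> F z = F 0 + (\<Sum>j\<in>UNIV. l j * z $ j) + N z"
proof -
  obtain c where c: "(\<lambda>\<gamma>. \<bar>c \<gamma>\<bar> * r ^ sum \<gamma> UNIV) summable_on UNIV"
     "(\<Sum>\<^sub>\<infinity>\<gamma>. \<bar>c \<gamma>\<bar> * r ^ sum \<gamma> UNIV) \<le> M"
     "\<And>z. (\<And>i. \<bar>z $ i\<bar> \<le> r) \<Longrightarrow> ((\<lambda>\<gamma>. c \<gamma> * monomial z \<gamma>) has_sum F z) UNIV"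
    using F unfolding power_series_bound_def by blast
  define e :: "'n \<Rightarrow> 'n \<Rightarrow> nat" where "e j = (\<lambda>i. if i = j then 1 else 0)" for j
  define S where "S = insert (\<lambda>_. 0) (range e)"
  have finS: "finite S" by (simp add: S_def)
  have inj: "inj e" unfolding inj_def e_def by (metis one_neq_zero)
  have S: "\<gamma> \<in> S" if "sum \<gamma> UNIV < 2" for \<gamma> :: "'n \<Rightarrow> nat"
  proof (cases "sum \<gamma> UNIV = 0")
    case True
    then show ?thesis by (auto simp: S_def fun_eq_iff)
  next
    case False
    with that have "sum \<gamma> UNIV = 1" by linarith
    then obtain j where "\<gamma> j = 1" "\<And>i. j \<noteq> i \<Longrightarrow> \<gamma> i = 0"
      using sum_eq_1_iff[OF finite, of \<gamma> UNIV] by blast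
    then have "\<gamma> = e j" by (auto simp: e_def fun_eq_iff)
    then show ?thesis by (auto simp: S_def)
  qed
  have sum0: "sum (e j) UNIV = 1" for j by (simp add: e_def)
  have mon: "monomial z (e j) = z $ j" for z :: "real ^ 'n" and j
  proof -
    have "monomial z (e j) = (\<Prod>i\<in>UNIV. if i = j then z $ i else 1)"
      unfolding monomial_def e_def by (rule prod.cong) auto
    then show ?thesis by simp
  qed
  have sumS: "(\<Sum>\<gamma>\<in>S. f \<gamma>) = f (\<lambda>_. 0) + (\<Sum>j\<in>UNIV. f (e j))" for f :: "_ \<Rightarrow> real"
  proof -
    have "(\<lambda>_. 0) \<notin> range e"
    proof
      assume "(\<lambda>_. 0) \<in> range e"
      then obtain j where "(\<lambda>_. 0) = e j" by auto
      with sum0[of j] show False by (metis sum.neutral_const zero_neq_one)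
    qed
    then show ?thesis by (simp add: S_def sum.reindex[OF inj])
  qed
  define c' where "c' \<gamma> = (if \<gamma> \<in> S then 0 else c \<gamma>)" for \<gamma>
  define N where "N z = F z - (\<Sum>\<gamma>\<in>S. c \<gamma> * monomial z \<gamma>)" for z
  have N: "((\<lambda>\<gamma>. c' \<gamma> * monomial z \<gamma>) has_sum N z) UNIV" if "\<And>i. \<bar>z $ i\<bar> \<le> r" for z
  proof -
    have "((\<lambda>\<gamma>. c \<gamma> * monomial z \<gamma>) has_sum (\<Sum>\<gamma>\<in>S. c \<gamma> * monomial z \<gamma>)) S"
      using finS by simp
    then have "((\<lambda>\<gamma>. if \<gamma> \<in> S then c \<gamma> * monomial z \<gamma> else 0) has_sum (\<Sum>\<gamma>\<in>S. c \<gamma> * monomial z \<gamma>)) UNIV"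
      by (subst has_sum_cong_neutral[of S UNIV]) auto
    from has_sum_add[OF c(3)[OF that] has_sum_uminusI[OF this]]
    have "((\<lambda>\<gamma>. c \<gamma> * monomial z \<gamma> + - (if \<gamma> \<in> S then c \<gamma> * monomial z \<gamma> else 0)) has_sum N z) UNIV"
      by (simp add: N_def)
    moreover have "(\<lambda>\<gamma>. c \<gamma> * monomial z \<gamma> + - (if \<gamma> \<in> S then c \<gamma> * monomial z \<gamma> else 0)) = (\<lambda>\<gamma>. c' \<gamma> * monomial z \<gamma>)"
      by (auto simp: c'_def)
    ultimately show ?thesis by simp
  qed
  have le: "\<bar>c' \<gamma>\<bar> * r ^ sum \<gamma> UNIV \<le> \<bar>c \<gamma>\<bar> * r ^ sum \<gamma> UNIV" for \<gamma>
    using r by (auto simp: c'_def)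
  have s: "(\<lambda>\<gamma>. \<bar>c' \<gamma>\<bar> * r ^ sum \<gamma> UNIV) summable_on UNIV"
    by (rule summable_on_comparison_test[OF c(1) le]) (use r in auto)
  have "power_series_bound 2 r N M"
    unfolding power_series_bound_def
    using s infsum_mono[OF s c(1) le] c(2) N S by (intro exI[of _ c']) (auto simp: c'_def)
  moreover have "F z = F 0 + (\<Sum>j\<in>UNIV. c (e j) * z $ j) + N z" if "\<And>i. \<bar>z $ i\<bar> \<le> r" for z
  proof -
    have "((\<lambda>\<gamma>. c \<gamma> * monomial 0 \<gamma>) has_sum c (\<lambda>_. 0)) UNIV"
    proof (rule has_sum_finite_neutralI[of "{\<lambda>_. 0}"])
      show "c \<gamma> * monomial 0 \<gamma> = 0" if "\<gamma> \<in> UNIV - {\<lambda>_. 0}" for \<gamma> :: "'n \<Rightarrow> nat"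
        using that by (auto simp: monomial_def fun_eq_iff)
    qed auto
    moreover have "((\<lambda>\<gamma>. c \<gamma> * monomial 0 \<gamma>) has_sum F 0) UNIV"
      using c(3)[of 0] r by simp
    ultimately have "F 0 = c (\<lambda>_. 0)" using has_sum_unique by blast
    then show ?thesis by (simp add: N_def sumS mon)
  qed
  ultimately show thesis by (rule that)
qed

lemma power_series_bound_vanish:
  assumes "power_series_bound 0 r F M" "F 0 = 0" "r > 0"
  shows "power_series_bound 1 r F M"
proof -
  obtain c where c: "(\<lambda>\<gamma>. \<bar>c \<gamma>\<bar> * r ^ sum \<gamma> UNIV) summable_on UNIV"
     "(\<Sum>\<^sub>\<infinity>\<gamma>. \<bar>c \<gamma>\<bar> * r ^ sum \<gamma> UNIV) \<le> M"
     "\<And>z. (\<And>i. \<bar>z $ i\<bar> \<le> r) \<Longrightarrow> ((\<lambda>\<gamma>. c \<gamma> * monomial z \<gamma>) has_sum F z) UNIV"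
    using assms(1) unfolding power_series_bound_def by blast
  have "((\<lambda>\<gamma>. c \<gamma> * monomial 0 \<gamma>) has_sum c (\<lambda>_. 0)) UNIV"
  proof (rule has_sum_finite_neutralI[of "{\<lambda>_. 0}"])
    show "c \<gamma> * monomial 0 \<gamma> = 0" if "\<gamma> \<in> UNIV - {\<lambda>_. 0}" for \<gamma>
      using that by (auto simp: monomial_def fun_eq_iff)
  qed auto
  moreover have "((\<lambda>\<gamma>. c \<gamma> * monomial 0 \<gamma>) has_sum 0) UNIV"
    using c(3)[of 0] assms by simp
  ultimately have "c (\<lambda>_. 0) = 0" using has_sum_unique by blast
  then have "c \<gamma> = 0" if "sum \<gamma> UNIV < 1" for \<gamma>
    using that by (metis less_one sum_eq_0_iff finite UNIV_I ext)
  then show ?thesis unfolding power_series_bound_def using c by (intro exI[of _ c]) auto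
qed

section \<open>Real analytic functions\<close>

lemma norm_le_card_mult:
  assumes "\<And>i. \<bar>z $ i\<bar> \<le> r"
  shows "norm (z :: real ^ 'n::finite) \<le> real CARD('n) * r"
proof -
  have "norm z \<le> (\<Sum>i\<in>UNIV. \<bar>z $ i\<bar>)" by (rule norm_le_l1_cart)
  also have "\<dots> \<le> (\<Sum>i\<in>(UNIV :: 'n set). r)" by (intro sum_mono assms)
  finally show ?thesis by simp
qed

lemma real_analytic_at_iff_power_series_bound:
  fixes F :: "real ^ 'n::finite \<Rightarrow> real"
  shows "real_analytic_at F y0 \<longleftrightarrow> (\<exists>r>0. \<exists>M. power_series_bound 0 r (\<lambda>z. F (y0 + z)) M)"
proof
  assume "real_analytic_at F y0"
  then obtain r c where r: "r > 0" and hs: "\<And>y. (\<And>i. \<bar>y $ i - y0 $ i\<bar> < r) \<Longrightarrow>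
      ((\<lambda>\<gamma>. c \<gamma> * monomial (y - y0) \<gamma>) has_sum F y) UNIV"
    unfolding real_analytic_at_def by blast
  \<comment> \<open>At the diagonal point with all offsets r / 2 every monomial becomes (r /
    2)^degree. Unordered summability of reals is absolute, so this single point gives the finite
    weighted norm.\<close>
  have "((\<lambda>\<gamma>. c \<gamma> * monomial (\<chi> i. r / 2) \<gamma>) has_sum F (y0 + (\<chi> i. r / 2))) UNIV"
    using hs[of "y0 + (\<chi> i. r / 2)"] r by simp
  then have "(\<lambda>\<gamma>. c \<gamma> * monomial (\<chi> i. r / 2) \<gamma>) summable_on UNIV"
    by (rule has_sum_imp_summable)
  moreover have "norm (c \<gamma> * monomial (\<chi> i. r / 2) \<gamma>) = \<bar>c \<gamma>\<bar> * (r / 2) ^ sum \<gamma> UNIV" for \<gamma>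
    using r by (simp add: monomial_def abs_mult power_sum abs_prod power_abs del: power_divide)
  ultimately have "(\<lambda>\<gamma>. \<bar>c \<gamma>\<bar> * (r / 2) ^ sum \<gamma> UNIV) summable_on UNIV"
    by (simp only: summable_on_iff_abs_summable_on_real[of "\<lambda>\<gamma>. c \<gamma> * monomial (\<chi> i. r / 2) \<gamma>"])
  moreover have "((\<lambda>\<gamma>. c \<gamma> * monomial z \<gamma>) has_sum F (y0 + z)) UNIV" if "\<forall>i. \<bar>z $ i\<bar> \<le> r / 2" for z
  proof -
    have "\<bar>z $ i\<bar> < r" for i
      using that[rule_format, of i] r by linarith
    then show ?thesis using hs[of "y0 + z"] by simp
  qed
  ultimately have "power_series_bound 0 (r / 2) (\<lambda>z. F (y0 + z)) (\<Sum>\<^sub>\<infinity>\<gamma>. \<bar>c \<gamma>\<bar> * (r / 2) ^ sum \<gamma> UNIV)"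
    unfolding power_series_bound_def by (intro exI[of _ c]) auto
  then show "\<exists>r>0. \<exists>M. power_series_bound 0 r (\<lambda>z. F (y0 + z)) M"
    using r half_gt_zero by blast
next
  assume "\<exists>r>0. \<exists>M. power_series_bound 0 r (\<lambda>z. F (y0 + z)) M"
  then obtain r c where "r > 0" and hs: "\<And>z. (\<And>i. \<bar>z $ i\<bar> \<le> r) \<Longrightarrow>
      ((\<lambda>\<gamma>. c \<gamma> * monomial z \<gamma>) has_sum F (y0 + z)) UNIV"
    unfolding power_series_bound_def by blast
  moreover have "((\<lambda>\<gamma>. c \<gamma> * monomial (y - y0) \<gamma>) has_sum F y) UNIV" if "\<forall>i. \<bar>y $ i - y0 $ i\<bar> < r" for y
    using hs[of "y - y0"] that by (simp add: less_imp_le)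
  ultimately show "real_analytic_at F y0"
    unfolding real_analytic_at_def by blast
qed

text \<open>One bound \<open>M\<close> serves all smaller radii, which lets two functions be
  expanded on a common polydisc.\<close>

lemma real_analytic_at_E:
  assumes "real_analytic_at F y0" "R > 0"
  obtains r M where "r > 0" "r \<le> R" "\<And>s. 0 < s \<Longrightarrow> s \<le> r \<Longrightarrow> power_series_bound 0 s (\<lambda>z. F (y0 + z)) M"
proof -
  obtain r M where "r > 0" "power_series_bound 0 r (\<lambda>z. F (y0 + z)) M"
    using assms real_analytic_at_iff_power_series_bound by blast
  from this(2) have "power_series_bound 0 s (\<lambda>z. F (y0 + z)) M" if "0 < s" "s \<le> min r R" for s
    by (rule power_series_bound_mono) (use that in auto)
  then show ?thesis using assms \<open>r > 0\<close> by (intro that[of "min r R" M]) auto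
qed

text \<open>The difference has no constant term, hence its norm shrinks at least linearly with the
  radius.\<close>

lemma real_analytic_at_small_E:
  assumes "real_analytic_at F y0" "\<epsilon> > 0"
  obtains r where "r > 0" "\<And>s. 0 < s \<Longrightarrow> s \<le> r \<Longrightarrow> power_series_bound 0 s (\<lambda>z. F (y0 + z) - F y0) \<epsilon>"
proof -
  obtain r M where r: "r > 0" and M: "power_series_bound 0 r (\<lambda>z. F (y0 + z)) M"
    using assms real_analytic_at_iff_power_series_bound by blast
  have M0: "M \<ge> 0" using power_series_bound_abs_le[OF M, of 0] r by simp
  define N where "N = M + \<bar>F y0\<bar>"
  have "power_series_bound 0 r (\<lambda>z. F (y0 + z) - F y0) N"
    unfolding N_def by (intro power_series_bound_diff power_series_bound_const M r) simp
  then have N: "power_series_bound 1 r (\<lambda>z. F (y0 + z) - F y0) N"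
    by (rule power_series_bound_vanish) (use r in auto)
  \<comment> \<open>The summand 1 in the denominator keeps the quotient meaningful when
    \<open>N = 0\<close>.\<close>
  define t where "t = min 1 (\<epsilon> / (N + 1))"
  have N0: "N \<ge> 0" using M0 by (simp add: N_def)
  have t: "0 < t" "t \<le> 1" "t \<le> \<epsilon> / (N + 1)" using assms N0 by (auto simp: t_def)
  have "t * N \<le> \<epsilon> / (N + 1) * (N + 1)"
    using t N0 assms by (intro mult_mono) auto
  then have tN: "t * N \<le> \<epsilon>" using N0 by simp
  have "power_series_bound 1 (t * r) (\<lambda>z. F (y0 + z) - F y0) (t ^ 1 * N)"
    using power_series_bound_shrink[OF N] t r by simp
  then have "power_series_bound 0 s (\<lambda>z. F (y0 + z) - F y0) \<epsilon>" if "0 < s" "s \<le> t * r" for s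
    by (rule power_series_bound_mono) (use that tN in auto)
  then show ?thesis
    using t r by (intro that[of "t * r"]) auto
qed

lemma real_analytic_at_cong:
  assumes "real_analytic_at F y0" "\<forall>\<^sub>F y in nhds y0. F y = G y"
  shows "real_analytic_at G y0"
proof -
  obtain e where e: "e > 0" "\<And>y. dist y y0 < e \<Longrightarrow> F y = G y"
    using assms(2) unfolding eventually_nhds_metric by blast
  obtain r M where r: "r > 0" and M: "\<And>s. 0 < s \<Longrightarrow> s \<le> r \<Longrightarrow> power_series_bound 0 s (\<lambda>z. F (y0 + z)) M"
    by (rule real_analytic_at_E[OF assms(1) zero_less_one]) blast
  define s where "s = min r (e / (2 * real CARD('a)))"
  have s: "s > 0" "s \<le> r" "s \<le> e / (2 * real CARD('a))" using r e by (auto simp: s_def)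
  have "power_series_bound 0 s (\<lambda>z. G (y0 + z)) M"
  proof (rule power_series_bound_mono[OF M[OF s(1,2)]])
    fix z :: "real ^ 'a" assume "\<And>i. \<bar>z $ i\<bar> \<le> s"
    from norm_le_card_mult[of z, OF this] have "norm z \<le> real CARD('a) * s" by simp
    also have "\<dots> \<le> real CARD('a) * (e / (2 * real CARD('a)))" by (intro mult_left_mono s) auto
    also have "\<dots> < e" using e by simp
    finally show "G (y0 + z) = F (y0 + z)" using e(2)[of "y0 + z"] by (simp add: dist_norm)
  qed (use s in auto)
  then show ?thesis using s(1) real_analytic_at_iff_power_series_bound by blast
qed

section \<open>Closure properties of real analytic functions\<close>

lemma real_analytic_at_const [simp]: "real_analytic_at (\<lambda>_. a) y0"
  unfolding real_analytic_at_iff_power_series_bound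
  by (rule exI[of _ 1], rule conjI[OF zero_less_one], rule exI[of _ "\<bar>a\<bar>"], rule power_series_bound_const) auto

lemma real_analytic_at_component [simp]: "real_analytic_at (\<lambda>y. y $ i) y0"
proof -
  have "power_series_bound 0 1 (\<lambda>z. (y0 + z) $ i) (\<bar>y0 $ i\<bar> + 1)"
    unfolding vector_add_component
    by (intro power_series_bound_add power_series_bound_const power_series_bound_mono[OF power_series_bound_component]) auto
  then show ?thesis unfolding real_analytic_at_iff_power_series_bound using zero_less_one by blast
qed

lemma real_analytic_at_add:
  assumes "real_analytic_at F y0" "real_analytic_at G y0"
  shows "real_analytic_at (\<lambda>y. F y + G y) y0"
proof -
  obtain r M where 1: "r > 0" "\<And>s. 0 < s \<Longrightarrow> s \<le> r \<Longrightarrow> power_series_bound 0 s (\<lambda>z. F (y0 + z)) M"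
    by (rule real_analytic_at_E[OF assms(1) zero_less_one]) blast
  obtain s N where 2: "s > 0" "s \<le> r" "\<And>t. 0 < t \<Longrightarrow> t \<le> s \<Longrightarrow> power_series_bound 0 t (\<lambda>z. G (y0 + z)) N"
    by (rule real_analytic_at_E[OF assms(2) 1(1)]) blast
  have "power_series_bound 0 s (\<lambda>z. F (y0 + z) + G (y0 + z)) (M + N)"
    by (intro power_series_bound_add 1 2 order_refl)
  then show ?thesis unfolding real_analytic_at_iff_power_series_bound using 2(1) by blast
qed

lemma real_analytic_at_mult:
  assumes "real_analytic_at F y0" "real_analytic_at G y0"
  shows "real_analytic_at (\<lambda>y. F y * G y) y0"
proof -
  obtain r M where 1: "r > 0" "\<And>s. 0 < s \<Longrightarrow> s \<le> r \<Longrightarrow> power_series_bound 0 s (\<lambda>z. F (y0 + z)) M"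
    by (rule real_analytic_at_E[OF assms(1) zero_less_one]) blast
  obtain s N where 2: "s > 0" "s \<le> r" "\<And>t. 0 < t \<Longrightarrow> t \<le> s \<Longrightarrow> power_series_bound 0 t (\<lambda>z. G (y0 + z)) N"
    by (rule real_analytic_at_E[OF assms(2) 1(1)]) blast
  have "power_series_bound 0 s (\<lambda>z. F (y0 + z) * G (y0 + z)) (M * N)"
    by (intro power_series_bound_mult0 1 2 order_refl)
  then show ?thesis unfolding real_analytic_at_iff_power_series_bound using 2(1) by blast
qed

lemma real_analytic_at_diff:
  assumes "real_analytic_at F y0" "real_analytic_at G y0"
  shows "real_analytic_at (\<lambda>y. F y - G y) y0"
proof -
  have "real_analytic_at (\<lambda>y. F y + (-1) * G y) y0"
    by (intro real_analytic_at_add real_analytic_at_mult real_analytic_at_const assms)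
  then show ?thesis by simp
qed

lemma real_analytic_at_power:
  assumes "real_analytic_at F y0"
  shows "real_analytic_at (\<lambda>y. F y ^ n) y0"
proof (induction n)
  case 0
  show ?case by simp
next
  case (Suc n)
  show ?case unfolding power_Suc by (rule real_analytic_at_mult[OF assms Suc])
qed

lemma real_analytic_at_sum:
  assumes "\<And>i. i \<in> A \<Longrightarrow> real_analytic_at (F i) y0"
  shows "real_analytic_at (\<lambda>y. \<Sum>i\<in>A. F i y) y0"
  using assms by (induction A rule: infinite_finite_induct) (auto intro!: real_analytic_at_add)

lemma real_analytic_at_compose:
  fixes u :: "'m::finite \<Rightarrow> real ^ 'n::finite \<Rightarrow> real"
  assumes Q: "real_analytic_at Q (\<chi> i. u i y0)" and u: "\<And>i. real_analytic_at (u i) y0"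
  shows "real_analytic_at (\<lambda>y. Q (\<chi> i. u i y)) y0"
proof -
  obtain \<rho> M where \<rho>: "\<rho> > 0" and M: "power_series_bound 0 \<rho> (\<lambda>z. Q ((\<chi> i. u i y0) + z)) M"
    using Q real_analytic_at_iff_power_series_bound by blast
  have "\<forall>i. \<exists>r>0. \<forall>s. 0 < s \<longrightarrow> s \<le> r \<longrightarrow> power_series_bound 0 s (\<lambda>z. u i (y0 + z) - u i y0) \<rho>"
    using real_analytic_at_small_E[OF u \<rho>] by metis
  then obtain r where r: "\<And>i. r i > 0"
    "\<And>i s. 0 < s \<Longrightarrow> s \<le> r i \<Longrightarrow> power_series_bound 0 s (\<lambda>z. u i (y0 + z) - u i y0) \<rho>"
    by metis
  define s where "s = Min (range r)"
  have s: "s > 0" "\<And>i. s \<le> r i" using r by (auto simp: s_def)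
  have "power_series_bound 0 s (\<lambda>z. Q ((\<chi> i. u i y0) + (\<chi> i. u i (y0 + z) - u i y0))) M"
    by (rule power_series_bound_compose[OF s(1) M]) (use r s in auto)
  moreover have "(\<chi> i. u i y0) + (\<chi> i. u i (y0 + z) - u i y0) = (\<chi> i. u i (y0 + z))" for z
    by (simp add: vec_eq_iff)
  ultimately have "power_series_bound 0 s (\<lambda>z. Q (\<chi> i. u i (y0 + z))) M" by simp
  then show ?thesis unfolding real_analytic_at_iff_power_series_bound using s(1) by blast
qed

text \<open>Re-expansion at an interior point is composition with the affine series
  \<open>\<theta> $ i + z $ i\<close>. Their norms are at most
  \<open>\<bar>\<theta> $ i\<bar> + s\<close>, and \<open>s\<close> is the distance that the largest
  coordinate of \<theta> leaves to the boundary of the polydisc.\<close>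

lemma power_series_bound_imp_real_analytic_at:
  assumes F: "power_series_bound d r F M" and r: "r > 0" and \<theta>: "\<And>i. \<bar>\<theta> $ i\<bar> < r"
  shows "real_analytic_at F \<theta>"
proof -
  define s where "s = r - Max (range (\<lambda>i. \<bar>\<theta> $ i\<bar>))"
  have "Max (range (\<lambda>i. \<bar>\<theta> $ i\<bar>)) < r" using \<theta> by (subst Max_less_iff) auto
  then have s: "s > 0" by (simp add: s_def)
  have le: "\<bar>\<theta> $ i\<bar> + s \<le> r" for i
  proof -
    have "\<bar>\<theta> $ i\<bar> \<le> Max (range (\<lambda>i. \<bar>\<theta> $ i\<bar>))" by (rule Max_ge) auto
    then show ?thesis unfolding s_def by linarith
  qed
  have "power_series_bound 0 s (\<lambda>z. F (\<chi> i. \<theta> $ i + z $ i)) M"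
  proof (rule power_series_bound_compose[OF s F])
    fix i
    have "power_series_bound 0 s (\<lambda>z. \<theta> $ i + z $ i) (\<bar>\<theta> $ i\<bar> + s)"
      by (intro power_series_bound_add power_series_bound_const power_series_bound_mono[OF power_series_bound_component])
         (use s in auto)
    then show "power_series_bound 0 s (\<lambda>z. \<theta> $ i + z $ i) r"
      by (rule power_series_bound_mono) (use s le in auto)
  qed
  moreover have "(\<chi> i. \<theta> $ i + z $ i) = \<theta> + z" for z by (simp add: vec_eq_iff)
  ultimately show ?thesis
    unfolding real_analytic_at_iff_power_series_bound using s by auto
qed

text \<open>Neumann series: near \<open>y0\<close> the normalized function \<open>u / u y0\<close>
  differs from 1 by a series of norm at most 1/2.\<close>

lemma real_analytic_at_inverse:
  fixes u :: "real ^ 'n::finite \<Rightarrow> real"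
  assumes u: "real_analytic_at u y0" and nz: "u y0 \<noteq> 0"
  shows "real_analytic_at (\<lambda>y. inverse (u y)) y0"
proof -
  define \<epsilon> where "\<epsilon> = \<bar>u y0\<bar> / 2"
  have \<epsilon>: "\<epsilon> > 0" using nz by (simp add: \<epsilon>_def)
  obtain r where r: "r > 0" "power_series_bound 0 r (\<lambda>z. u (y0 + z) - u y0) \<epsilon>"
    using real_analytic_at_small_E[OF u \<epsilon>] by blast
  have "power_series_bound 0 r (\<lambda>z. (1 - u (y0 + z) / u y0)) (1/2)"
  proof -
    have "power_series_bound 0 r (\<lambda>z. (- 1 / u y0) * (u (y0 + z) - u y0)) (\<bar>- 1 / u y0\<bar> * \<epsilon>)"
      by (intro power_series_bound_cmult r)
    moreover have "\<bar>- 1 / u y0\<bar> * \<epsilon> = 1/2" using nz by (simp add: \<epsilon>_def)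
    moreover have "(\<lambda>z. (- 1 / u y0) * (u (y0 + z) - u y0)) = (\<lambda>z. (1 - u (y0 + z) / u y0))"
      using nz by (auto simp: field_simps)
    ultimately show ?thesis by (simp only:)
  qed
  note 1 = this
  have "power_series_bound 0 r (\<lambda>z. inverse (u (y0 + z) / u y0)) 2"
  proof (rule power_series_bound_infsum[OF r(1), of UNIV])
    show "power_series_bound 0 r (\<lambda>z. (1 - u (y0 + z) / u y0) ^ n) ((1/2) ^ n)" for n
      by (rule power_series_bound_power[OF r(1) 1])
    show "((\<lambda>n. (1 / 2 :: real) ^ n) has_sum 2) UNIV"
      using geometric_sums[of "1/2 :: real"] by (intro sums_nonneg_imp_has_sum) auto
    fix z :: "real ^ 'n" assume z: "\<And>i. \<bar>z $ i\<bar> \<le> r"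
    define w where "w = u (y0 + z) / u y0"
    have w: "norm (1 - w) < 1"
      using power_series_bound_abs_le[OF 1 z] by (simp add: w_def)
    have "(\<lambda>n. (1 - w) ^ n) sums (inverse w)"
      using geometric_sums[OF w] by (simp add: inverse_eq_divide)
    moreover have "summable (\<lambda>n. norm ((1 - w) ^ n))"
      unfolding norm_power using w by (intro summable_geometric) simp
    ultimately show "((\<lambda>n. (1 - u (y0 + z) / u y0) ^ n) has_sum inverse (u (y0 + z) / u y0)) UNIV"
      unfolding w_def by (intro norm_summable_imp_has_sum)
  qed
  then have "real_analytic_at (\<lambda>y. inverse (u y / u y0)) y0"
    unfolding real_analytic_at_iff_power_series_bound using r(1) by blast
  from real_analytic_at_mult[OF real_analytic_at_const[of "inverse (u y0)"] this] show ?thesis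
    using nz by (simp add: field_simps)
qed

lemma real_analytic_at_locally_lipschitz:
  fixes F :: "real ^ 'n::finite \<Rightarrow> real"
  assumes "real_analytic_at F y0"
  obtains e C where "e > 0" "C \<ge> 0"
    "\<And>x y. norm (x - y0) \<le> e \<Longrightarrow> norm (y - y0) \<le> e \<Longrightarrow> \<bar>F x - F y\<bar> \<le> C * norm (x - y)"
proof -
  obtain r M where r: "r > 0" and M: "power_series_bound 0 r (\<lambda>z. F (y0 + z)) M"
    using assms real_analytic_at_iff_power_series_bound by blast
  have M0: "M \<ge> 0" using power_series_bound_abs_le[OF M, of 0] r by simp
  obtain l N where N: "power_series_bound 2 r N M"
    and F0: "\<And>z. (\<And>i. \<bar>z $ i\<bar> \<le> r) \<Longrightarrow> F (y0 + z) = F (y0 + 0) + (\<Sum>j\<in>UNIV. l j * z $ j) + N z"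
    by (rule power_series_bound_split[OF M r]) blast
  have F: "F (y0 + z) = F y0 + (\<Sum>j\<in>UNIV. l j * z $ j) + N z" if "\<And>i. \<bar>z $ i\<bar> \<le> r" for z
    using F0[OF that] by simp
  define C where "C = (\<Sum>j\<in>UNIV. \<bar>l j\<bar>) + M / r"
  have "\<bar>F x - F y\<bar> \<le> C * norm (x - y)" if "norm (x - y0) \<le> r / 2" "norm (y - y0) \<le> r / 2" for x y
  proof -
    have h: "\<bar>(x - y0) $ i\<bar> \<le> r / 2" "\<bar>(y - y0) $ i\<bar> \<le> r / 2" for i
      using that component_le_norm_cart order_trans by blast+
    have h': "\<bar>(x - y0) $ i\<bar> \<le> r" "\<bar>(y - y0) $ i\<bar> \<le> r" for i
      using h[of i] r by linarith+
    have d: "\<bar>(x - y0) $ i - (y - y0) $ i\<bar> \<le> norm (x - y)" for i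
      using component_le_norm_cart[of "x - y" i] by simp
    have "\<bar>N (x - y0) - N (y - y0)\<bar> \<le> 2 * (1/2) / r * M * norm (x - y)"
      by (rule power_series_bound_lipschitz[OF N r]) (use h d in auto)
    moreover have "\<bar>(\<Sum>j\<in>UNIV. l j * (x - y0) $ j) - (\<Sum>j\<in>UNIV. l j * (y - y0) $ j)\<bar> \<le> (\<Sum>j\<in>UNIV. \<bar>l j\<bar>) * norm (x - y)"
    proof -
      have "\<bar>(\<Sum>j\<in>UNIV. l j * (x - y0) $ j) - (\<Sum>j\<in>UNIV. l j * (y - y0) $ j)\<bar> = \<bar>\<Sum>j\<in>UNIV. l j * (x - y) $ j\<bar>"
        by (simp add: algebra_simps flip: sum_subtractf)
      also have "\<dots> \<le> (\<Sum>j\<in>UNIV. \<bar>l j * (x - y) $ j\<bar>)" by (rule sum_abs)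
      also have "\<dots> \<le> (\<Sum>j\<in>UNIV. \<bar>l j\<bar> * norm (x - y))"
        unfolding abs_mult by (intro sum_mono mult_left_mono component_le_norm_cart) auto
      finally show ?thesis by (simp add: sum_distrib_right)
    qed
    moreover have "F x - F y = ((\<Sum>j\<in>UNIV. l j * (x - y0) $ j) - (\<Sum>j\<in>UNIV. l j * (y - y0) $ j)) + (N (x - y0) - N (y - y0))"
      using F[of "x - y0", OF h'(1)] F[of "y - y0", OF h'(2)] by simp
    ultimately show ?thesis unfolding C_def by (simp add: ring_distribs)
  qed
  moreover have "C \<ge> 0" unfolding C_def using M0 r by (simp add: sum_nonneg)
  ultimately show ?thesis using r by (intro that[of "r / 2" C]) auto
qed

lemma real_analytic_at_expansion:
  fixes F :: "real ^ 'n::finite \<Rightarrow> real"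
  assumes "real_analytic_at F y0"
  obtains r M l N where "r > 0" "power_series_bound 2 r N M"
    "\<And>z. (\<And>i. \<bar>z $ i\<bar> \<le> r) \<Longrightarrow> F (y0 + z) = F y0 + (\<Sum>j\<in>UNIV. l j * z $ j) + N z"
    "(F has_derivative (\<lambda>h. \<Sum>j\<in>UNIV. l j * h $ j)) (at y0)"
proof -
  obtain r M where r: "r > 0" and M: "power_series_bound 0 r (\<lambda>z. F (y0 + z)) M"
    using assms real_analytic_at_iff_power_series_bound by blast
  have M0: "M \<ge> 0" using power_series_bound_abs_le[OF M, of 0] r by simp
  obtain l N where N: "power_series_bound 2 r N M"
    and F0: "\<And>z. (\<And>i. \<bar>z $ i\<bar> \<le> r) \<Longrightarrow> F (y0 + z) = F (y0 + 0) + (\<Sum>j\<in>UNIV. l j * z $ j) + N z"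
    by (rule power_series_bound_split[OF M r]) blast
  have F: "F (y0 + z) = F y0 + (\<Sum>j\<in>UNIV. l j * z $ j) + N z" if "\<And>i. \<bar>z $ i\<bar> \<le> r" for z
    using F0[OF that] by simp
  have N0: "N 0 = 0" using F[of 0] r by simp
  have est: "\<bar>N h\<bar> \<le> 2 / r ^ 2 * M * norm h ^ 2" if "norm h \<le> r / 2" for h
  proof -
    \<comment> \<open>The shrinking factor t = norm h / r depends on the point; this turns the
      Lipschitz bound into a quadratic one, from which differentiability follows.\<close>
    have "\<bar>N h - N 0\<bar> \<le> 2 * (norm h / r) / r * M * norm h"
      by (rule power_series_bound_lipschitz[OF N r]) (use that r in \<open>auto simp: component_le_norm_cart divide_le_eq\<close>)
    then show ?thesis by (simp add: N0 power2_eq_square algebra_simps)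
  qed
  have "(F has_derivative (\<lambda>h. \<Sum>j\<in>UNIV. l j * h $ j)) (at y0)"
    unfolding has_derivative_at
  proof
    show "bounded_linear (\<lambda>h. \<Sum>j\<in>UNIV. l j * h $ j)"
      by (intro bounded_linear_sum bounded_linear_mult_const bounded_linear_const_mult bounded_linear_vec_nth)
    show "(\<lambda>h. norm (F (y0 + h) - F y0 - (\<Sum>j\<in>UNIV. l j * h $ j)) / norm h) \<midarrow>0\<rightarrow> 0"
    proof (rule real_tendsto_sandwich[where f = "\<lambda>_. 0"])
      show "\<forall>\<^sub>F h in at 0. norm (F (y0 + h) - F y0 - (\<Sum>j\<in>UNIV. l j * h $ j)) / norm h \<le> 2 / r ^ 2 * M * norm h"
        unfolding eventually_at
      proof (intro exI[of _ "r / 2"] conjI ballI impI)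
        fix h :: "real ^ 'n" assume h: "h \<noteq> 0 \<and> dist h 0 < r / 2"
        then have "norm h \<le> r / 2" by simp
        moreover have "\<bar>h $ i\<bar> \<le> r" for i using component_le_norm_cart[of h i] h r by simp
        then have "F (y0 + h) - F y0 - (\<Sum>j\<in>UNIV. l j * h $ j) = N h" using F by simp
        ultimately show "norm (F (y0 + h) - F y0 - (\<Sum>j\<in>UNIV. l j * h $ j)) / norm h \<le> 2 / r ^ 2 * M * norm h"
          using est[of h] h by (simp add: divide_le_eq power2_eq_square mult.assoc)
      qed (use r in auto)
      show "(\<lambda>h. 2 / r ^ 2 * M * norm h) \<midarrow>0\<rightarrow> 0"
        using r by (auto intro!: tendsto_eq_intros)
    qed auto
  qed
  with r N F show thesis by (rule that)
qed

lemma real_analytic_at_differentiable: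
  fixes F :: "real ^ 'n::finite \<Rightarrow> real"
  assumes "real_analytic_at F y0"
  shows "F differentiable (at y0)"
  using real_analytic_at_expansion[OF assms] differentiableI by metis

lemma real_analytic_at_isCont:
  fixes F :: "real ^ 'n::finite \<Rightarrow> real"
  assumes "real_analytic_at F y0"
  shows "isCont F y0"
  using real_analytic_at_differentiable[OF assms] differentiable_imp_continuous_within by blast

section \<open>The analytic inverse function theorem\<close>

text \<open>The iteration \<open>U \<mapsto> z - N(U)\<close> is a contraction for the weighted \<open>l\<^sup>1\<close> norm, as \<open>N\<close> has no terms of
  degree less than \<open>2\<close>.\<close>

lemma near_identity_inverse:
  fixes N :: "'m::finite \<Rightarrow> real ^ 'm \<Rightarrow> real"
  assumes "\<rho>0 > 0" and N: "\<And>i. power_series_bound 2 \<rho>0 (N i) M"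
  obtains \<rho> r U where "0 < \<rho>" "\<rho> \<le> \<rho>0" "r > 0" "\<And>i. power_series_bound 0 r (U i) \<rho>"
    "\<And>z i. (\<And>i. \<bar>z $ i\<bar> \<le> r) \<Longrightarrow> U i z + N i (\<chi> j. U j z) = z $ i"
    "\<And>x y. (\<And>i. \<bar>x $ i\<bar> \<le> \<rho>) \<Longrightarrow> (\<And>i. \<bar>y $ i\<bar> \<le> \<rho>) \<Longrightarrow>
       (\<And>i. x $ i + N i x = y $ i + N i y) \<Longrightarrow> x = y"
proof -
  have M0: "M \<ge> 0" using power_series_bound_abs_le[OF N, of 0] assms(1) abs_ge_zero order_trans by force
  \<comment> \<open>Chosen so that \<open>N\<close> has Lipschitz constant at most 1/2 on the
    polydisc of radius t \<rho>0.\<close>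
  define t where "t = min (1/2) (\<rho>0 / (4 * (M + 1)))"
  have "0 < t" using M0 assms(1) by (auto simp: t_def)
  moreover have "t \<le> 1/2" unfolding t_def by (rule min.cobounded1)
  moreover have "t \<le> \<rho>0 / (4 * (M + 1))" unfolding t_def by (rule min.cobounded2)
  ultimately have t: "0 < t" "t \<le> 1/2" "t \<le> \<rho>0 / (4 * (M + 1))" by simp_all
  have L: "2 * t / \<rho>0 * M \<le> 1/2"
  proof -
    have "t * (4 * (M + 1)) \<le> \<rho>0" using t(3) M0 by (simp add: pos_le_divide_eq)
    then have "4 * (t * M) \<le> \<rho>0" using t(1) by (simp add: algebra_simps)
    then show ?thesis using assms(1) by (simp add: divide_le_eq)
  qed
  define \<rho> where "\<rho> = t * \<rho>0"
  define r where "r = \<rho> / 2"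
  have \<rho>: "\<rho> > 0" and r: "r > 0" and r2: "2 * r = \<rho>" using t assms(1) by (auto simp: \<rho>_def r_def)
  have \<rho>le: "\<rho> < \<rho>0"
  proof -
    have "t * \<rho>0 \<le> 1/2 * \<rho>0" using t assms(1) by (intro mult_right_mono) auto
    then show ?thesis using assms(1) by (simp add: \<rho>_def)
  qed
  have N0: "N i 0 = 0" for i
    using power_series_bound_abs_le[OF power_series_bound_shrink[OF N, of 0 i], of 0] assms(1) by simp
  define V where "V = rec_nat (\<lambda>i z. 0) (\<lambda>_ v i z. z $ i - N i (\<chi> j. v j z))"
  have V0: "V 0 = (\<lambda>i z. 0)" and VS: "V (Suc k) = (\<lambda>i z. z $ i - N i (\<chi> j. V k j z))" for k
    by (simp_all add: V_def)
  \<comment> \<open>The increments halve at each step, so the iterates have norm at most r (2 - 2 /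
    2^k). This stays below 2 r = \<rho> = t \<rho>0, where the contraction estimate applies
    again.\<close>
  have V: "(\<forall>i. power_series_bound 0 r (V k i) (r * (2 - 2 / 2 ^ k))) \<and>
    (\<forall>i. power_series_bound 0 r (\<lambda>z. V (Suc k) i z - V k i z) (r / 2 ^ k))" for k
  proof (induction k)
    case 0
    have "(\<lambda>z. z $ i - N i (\<chi> j. 0)) = (\<lambda>z. z $ i)" for i
      using N0 by (simp flip: zero_vec_def)
    moreover have "power_series_bound 0 r (\<lambda>z :: real ^ 'm. z $ i) r" for i
      by (rule power_series_bound_mono[OF power_series_bound_component]) (use r in auto)
    ultimately show ?case
      using r by (auto simp: V0 VS power_series_bound_const)
  next
    case (Suc k)
    have a: "power_series_bound 0 r (V (Suc k) i) (r * (2 - 2 / 2 ^ Suc k))" for i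
    proof -
      have "power_series_bound 0 r (\<lambda>z. V k i z + (V (Suc k) i z - V k i z)) (r * (2 - 2 / 2 ^ k) + r / 2 ^ k)"
        using Suc r by (intro power_series_bound_add) auto
      then show ?thesis by (simp add: field_simps)
    qed
    have le: "r * (2 - 2 / 2 ^ n) \<le> t * \<rho>0" for n
      using r unfolding \<rho>_def[symmetric] r2[symmetric] by (simp add: algebra_simps)
    have "power_series_bound 0 r (\<lambda>z. V (Suc (Suc k)) i z - V (Suc k) i z) (r / 2 ^ Suc k)" for i
    proof -
      have "power_series_bound 0 r (\<lambda>z. N i (\<chi> j. V k j z) - N i (\<chi> j. V (Suc k) j z)) (2 * t / \<rho>0 * M * (r / 2 ^ k))"
      proof (rule power_series_bound_lipschitz_compose[OF r N assms(1)])
        show "power_series_bound 0 r (V k j) (t * \<rho>0)" for j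
          by (rule power_series_bound_mono[OF conjunct1[OF Suc, rule_format]]) (use le r in auto)
        show "power_series_bound 0 r (V (Suc k) j) (t * \<rho>0)" for j
          by (rule power_series_bound_mono[OF a]) (use le[of "Suc k"] r in auto)
        show "power_series_bound 0 r (\<lambda>z. V k j z - V (Suc k) j z) (r / 2 ^ k)" for j
          using power_series_bound_cmult[OF r, of 0 "\<lambda>z. V (Suc k) j z - V k j z" "r / 2 ^ k" "-1"] Suc
          by simp
      qed (use t in auto)
      moreover have "2 * t / \<rho>0 * M * (r / 2 ^ k) \<le> 1/2 * (r / 2 ^ k)"
        using L r by (intro mult_right_mono) auto
      ultimately have "power_series_bound 0 r (\<lambda>z. N i (\<chi> j. V k j z) - N i (\<chi> j. V (Suc k) j z)) (r / 2 ^ Suc k)"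
        using r by (elim power_series_bound_mono) auto
      moreover have "(\<lambda>z. V (Suc (Suc k)) i z - V (Suc k) i z) = (\<lambda>z. N i (\<chi> j. V k j z) - N i (\<chi> j. V (Suc k) j z))"
        by (simp add: VS)
      ultimately show ?thesis by simp
    qed
    with a show ?case by blast
  qed
  \<comment> \<open>The fixed point is written as a telescoping series, not as a limit, so that the
    theorem on infinite sums makes it a power series at once.\<close>
  define U where "U i z = (\<Sum>k. V (Suc k) i z - V k i z)" for i z
  have geo: "((\<lambda>k. r / 2 ^ k) has_sum \<rho>) UNIV"
  proof (rule sums_nonneg_imp_has_sum)
    show "(\<lambda>k. r / 2 ^ k) sums \<rho>"
      using sums_mult[OF geometric_sums[of "1/2 :: real"], of r] r2 by (simp add: power_divide mult.commute)
  qed (use r in auto)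
  have conv: "(\<lambda>k. V (Suc k) i z - V k i z) sums U i z \<and> ((\<lambda>k. V (Suc k) i z - V k i z) has_sum U i z) UNIV"
    if z: "\<And>i. \<bar>z $ i\<bar> \<le> r" for i z
  proof -
    have bd: "norm (norm (V (Suc k) i z - V k i z)) \<le> r / 2 ^ k" for k
      unfolding real_norm_def abs_idempotent
      by (rule power_series_bound_abs_le[OF conjunct2[OF V, rule_format] z])
    have "summable (\<lambda>k. r / 2 ^ k)"
      by (rule summable_on_imp_summable[OF has_sum_imp_summable[OF geo]])
    then have *: "summable (\<lambda>k. norm (V (Suc k) i z - V k i z))"
      by (rule summable_comparison_test') (rule bd)
    have **: "(\<lambda>k. V (Suc k) i z - V k i z) sums U i z"
      unfolding U_def by (rule summable_sums[OF summable_norm_cancel[OF *]])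
    from ** norm_summable_imp_has_sum[OF * **] show ?thesis ..
  qed
  have U: "power_series_bound 0 r (U i) \<rho>" for i
    by (rule power_series_bound_infsum[OF r _ geo, of 0 "\<lambda>k z. V (Suc k) i z - V k i z"])
       (use V conv in blast)+
  have lim: "(\<lambda>k. V k i z) \<longlonglongrightarrow> U i z" if z: "\<And>i. \<bar>z $ i\<bar> \<le> r" for i z
  proof -
    have "(\<lambda>n. \<Sum>k<n. V (Suc k) i z - V k i z) \<longlonglongrightarrow> U i z"
      using conv[OF z] by (simp add: sums_def)
    then show ?thesis by (simp add: sum_lessThan_telescope[of "\<lambda>k. V k i z"] V0)
  qed
  have fp: "U i z + N i (\<chi> j. U j z) = z $ i" if z: "\<And>i. \<bar>z $ i\<bar> \<le> r" for i z
  proof -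
    have "\<bar>(\<chi> j. U j z) $ j\<bar> < \<rho>0" for j
      using power_series_bound_abs_le[OF U z, of j] \<rho>le by simp
    then have "isCont (N i) (\<chi> j. U j z)"
      by (intro real_analytic_at_isCont power_series_bound_imp_real_analytic_at[OF N assms(1)])
    then have "(\<lambda>k. N i (\<chi> j. V k j z)) \<longlonglongrightarrow> N i (\<chi> j. U j z)"
      by (rule isCont_tendsto_compose) (intro tendsto_vec_lambda lim z)
    then have "(\<lambda>k. V (Suc k) i z) \<longlonglongrightarrow> z $ i - N i (\<chi> j. U j z)"
      unfolding VS by (intro tendsto_intros)
    moreover have "(\<lambda>k. V (Suc k) i z) \<longlonglongrightarrow> U i z" using lim[OF z] by (rule LIMSEQ_Suc)
    ultimately have "U i z = z $ i - N i (\<chi> j. U j z)" using LIMSEQ_unique by blast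
    then show ?thesis by simp
  qed
  have uniq: "x = y" if x: "\<And>i. \<bar>x $ i\<bar> \<le> \<rho>" and y: "\<And>i. \<bar>y $ i\<bar> \<le> \<rho>"
    and eq: "\<And>i. x $ i + N i x = y $ i + N i y" for x y
  proof -
    define \<delta> where "\<delta> = Max (range (\<lambda>i. \<bar>x $ i - y $ i\<bar>))"
    have \<delta>: "\<bar>x $ i - y $ i\<bar> \<le> \<delta>" for i unfolding \<delta>_def by (rule Max_ge) auto
    then have \<delta>0: "\<delta> \<ge> 0" using abs_ge_zero order_trans by blast
    have "\<bar>x $ i - y $ i\<bar> \<le> \<delta> / 2" for i
    proof -
      have "\<bar>N i x - N i y\<bar> \<le> 2 * t / \<rho>0 * M * \<delta>"
        by (rule power_series_bound_lipschitz[OF N assms(1)]) (use t x y \<delta> in \<open>auto simp: \<rho>_def\<close>)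
      also have "\<dots> \<le> 1/2 * \<delta>" using L \<delta>0 by (rule mult_right_mono)
      finally show ?thesis using eq[of i] by linarith
    qed
    then have "\<delta> \<le> \<delta> / 2" unfolding \<delta>_def by (subst Max_le_iff) auto
    then have "\<delta> \<le> 0" by simp
    then have "\<bar>x $ i - y $ i\<bar> \<le> 0" for i using \<delta>[of i] by linarith
    then show "x = y" by (simp add: vec_eq_iff)
  qed
  show thesis by (rule that[OF \<rho> less_imp_le[OF \<rho>le] r U fp uniq])
qed

lemma linear_component_sum:
  fixes B :: "real ^ 'n::finite \<Rightarrow> real ^ 'm::finite"
  assumes "linear B"
  shows "B v $ i = (\<Sum>j\<in>UNIV. matrix B $ i $ j * v $ j)"
proof -
  have "B v = matrix B *v v" by (simp add: assms)
  then show ?thesis by (simp add: matrix_vector_mult_def)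
qed

lemma real_analytic_at_linear:
  fixes B :: "real ^ 'n::finite \<Rightarrow> real ^ 'm::finite" and F :: "real ^ 'k::finite \<Rightarrow> real ^ 'n"
  assumes "linear B" "\<And>j. real_analytic_at (\<lambda>x. F x $ j) x0"
  shows "real_analytic_at (\<lambda>x. B (F x) $ i) x0"
  unfolding linear_component_sum[OF assms(1)]
  by (intro real_analytic_at_sum real_analytic_at_mult real_analytic_at_const assms)

lemma real_analytic_at_compose_vec:
  fixes u :: "real ^ 'n::finite \<Rightarrow> real ^ 'm::finite"
  assumes "real_analytic_at Q (u y0)" "\<And>i. real_analytic_at (\<lambda>y. u y $ i) y0"
  shows "real_analytic_at (\<lambda>y. Q (u y)) y0"
  using real_analytic_at_compose[of Q "\<lambda>i y. u y $ i" y0] assms by simp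

lemma has_derivative_vecI:
  fixes F :: "'a::real_normed_vector \<Rightarrow> real ^ 'm::finite"
  assumes "\<And>i. ((\<lambda>x. F x $ i) has_derivative (\<lambda>h. F' h $ i)) (at a within S)"
  shows "(F has_derivative F') (at a within S)"
  by (subst has_derivative_componentwise_within) (use assms in \<open>auto simp: Basis_vec_def inner_axis\<close>)

lemma real_analytic_components_differentiable:
  fixes F :: "real ^ 'n::finite \<Rightarrow> real ^ 'm::finite"
  assumes "\<And>i. real_analytic_at (\<lambda>x. F x $ i) x0"
  shows "F differentiable (at x0)"
proof -
  have "\<exists>l. \<forall>i. ((\<lambda>x. F x $ i) has_derivative l i) (at x0)"
    using real_analytic_at_differentiable[OF assms] unfolding differentiable_def by metis
  then obtain l where "\<And>i. ((\<lambda>x. F x $ i) has_derivative l i) (at x0)" by blast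
  then have "(F has_derivative (\<lambda>h. \<chi> i. l i h)) (at x0)"
    by (intro has_derivative_vecI) simp
  then show ?thesis by (rule differentiableI)
qed

text \<open>Centring at \<open>x0\<close> and composing with the inverse \<open>B\<close> of the
  derivative reduces the claim to a map of the form identity plus terms of degree at least 2.
  Injectivity of \<open>B\<close> is what transfers the right inverse property back to
  \<open>F\<close>.\<close>

theorem analytic_inverse_function:
  fixes F :: "real ^ 'm::finite \<Rightarrow> real ^ 'm"
  assumes F: "\<And>i. real_analytic_at (\<lambda>x. F x $ i) x0"
    and F': "(F has_derivative F') (at x0)" and inj: "inj F'"
  obtains L where "\<And>i. real_analytic_at (\<lambda>y. L y $ i) (F x0)" "L (F x0) = x0"
    "\<forall>\<^sub>F x in nhds x0. L (F x) = x" "\<forall>\<^sub>F y in nhds (F x0). F (L y) = y"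
proof -
  have linF': "linear F'" using F' has_derivative_linear by blast
  obtain B where B: "linear B" "B \<circ> F' = id"
    using linear_injective_left_inverse[OF linF' inj] by blast
  have "surj B" using B(2) by (metis comp_apply id_apply surjI)
  then have injB: "inj B" using linear_surjective_imp_injective B(1) by blast
  define H where "H x = B (F (x0 + x) - F x0)" for x
  have H0: "H 0 = 0" using B(1) by (simp add: H_def linear_0)
  have F0: "real_analytic_at (\<lambda>x. F (x0 + x) $ i) 0" for i
    by (rule real_analytic_at_compose_vec[of "\<lambda>x. F x $ i" "\<lambda>x. x0 + x"])
       (use F in \<open>auto intro!: real_analytic_at_add\<close>)
  have anH: "real_analytic_at (\<lambda>x. H x $ i) 0" for i
    unfolding H_def by (rule real_analytic_at_linear[OF B(1)]) (auto intro!: real_analytic_at_diff F0)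
  have derH: "(H has_derivative id) (at 0)"
  proof -
    have sh: "((\<lambda>x. x0 + x) has_derivative (\<lambda>x. x)) (at 0)"
      by (auto intro!: derivative_eq_intros)
    have "(F has_derivative F') (at (x0 + 0))" using F' by simp
    then have "((\<lambda>x. F (x0 + x)) has_derivative F') (at 0)"
      using has_derivative_compose[of "\<lambda>x. x0 + x" "\<lambda>x. x" 0 UNIV F F'] sh by simp
    then have "((\<lambda>x. F (x0 + x) - F x0) has_derivative F') (at 0)"
      by (auto intro!: derivative_eq_intros)
    moreover have "(B has_derivative B) (at (F (x0 + 0) - F x0))"
      using B(1) linear_conv_bounded_linear bounded_linear_imp_has_derivative by blast
    ultimately have "((\<lambda>x. B (F (x0 + x) - F x0)) has_derivative (\<lambda>x. B (F' x))) (at 0)"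
      by (rule has_derivative_compose)
    moreover have "(\<lambda>x. B (F' x)) = id" using B(2) by (auto simp: fun_eq_iff)
    ultimately show ?thesis by (simp add: H_def[abs_def])
  qed
  have "\<forall>i. \<exists>r M N. r > 0 \<and> power_series_bound 2 r N M \<and> (\<forall>z. (\<forall>i. \<bar>z $ i\<bar> \<le> r) \<longrightarrow> H z $ i = z $ i + N z)"
  proof
    fix i
    obtain r M l N where *: "r > 0" "power_series_bound 2 r N M"
      "\<And>z. (\<And>i. \<bar>z $ i\<bar> \<le> r) \<Longrightarrow> H (0 + z) $ i = H 0 $ i + (\<Sum>j\<in>UNIV. l j * z $ j) + N z"
      "((\<lambda>z. H z $ i) has_derivative (\<lambda>h. \<Sum>j\<in>UNIV. l j * h $ j)) (at 0)"
      by (rule real_analytic_at_expansion[OF anH[of i]]) blast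
    have "((\<lambda>z. H z $ i) has_derivative (\<lambda>h. id h $ i)) (at 0)"
      using bounded_linear.has_derivative[OF bounded_linear_vec_nth derH] by simp
    \<comment> \<open>Uniqueness of the derivative identifies the linear part of the expansion as
      the identity, so that only the remainder of degree at least 2 is left as
      \<open>N\<close>.\<close>
    from has_derivative_unique[OF *(4) this] have "(\<Sum>j\<in>UNIV. l j * h $ j) = h $ i" for h
      by (metis id_apply)
    then show "\<exists>r M N. r > 0 \<and> power_series_bound 2 r N M \<and> (\<forall>z. (\<forall>i. \<bar>z $ i\<bar> \<le> r) \<longrightarrow> H z $ i = z $ i + N z)"
      using * by (intro exI[of _ r] exI[of _ M] exI[of _ N]) (simp add: H0)
  qed
  then obtain R M N where R: "\<And>i. R i > 0" and N: "\<And>i. power_series_bound 2 (R i) (N i) (M i)"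
    and HN: "\<And>i z. (\<And>i'. \<bar>z $ i'\<bar> \<le> R i) \<Longrightarrow> H z $ i = z $ i + N i z"
    by metis
  define \<rho>0 where "\<rho>0 = Min (range R)"
  have \<rho>0: "\<rho>0 > 0" "\<And>i. \<rho>0 \<le> R i" using R by (auto simp: \<rho>0_def)
  have "power_series_bound 2 \<rho>0 (N i) (Max (range M))" for i
    by (rule power_series_bound_mono[OF N]) (use \<rho>0 in auto)
  note N' = this
  obtain \<rho> r U where \<rho>: "0 < \<rho>" "\<rho> \<le> \<rho>0" and r: "r > 0" and U: "\<And>i. power_series_bound 0 r (U i) \<rho>"
    and sol: "\<And>z i. (\<And>i. \<bar>z $ i\<bar> \<le> r) \<Longrightarrow> U i z + N i (\<chi> j. U j z) = z $ i"
    and uniq: "\<And>x y. (\<And>i. \<bar>x $ i\<bar> \<le> \<rho>) \<Longrightarrow> (\<And>i. \<bar>y $ i\<bar> \<le> \<rho>) \<Longrightarrow>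
       (\<And>i. x $ i + N i x = y $ i + N i y) \<Longrightarrow> x = y"
    by (rule near_identity_inverse[where N = N, OF \<rho>0(1) N']) blast
  define u where "u z = (\<chi> i. U i z)" for z
  have u: "\<bar>u z $ i\<bar> \<le> \<rho>" if "\<And>i. \<bar>z $ i\<bar> \<le> r" for z i
    using power_series_bound_abs_le[OF U that] by (simp add: u_def)
  have HN': "H z $ i = z $ i + N i z" if "\<And>i. \<bar>z $ i\<bar> \<le> \<rho>" for z i
  proof (rule HN)
    show "\<bar>z $ j\<bar> \<le> R i" for j using that[of j] \<rho>(2) \<rho>0(2)[of i] by linarith
  qed
  have Hu: "H (u z) = z" if "\<And>i. \<bar>z $ i\<bar> \<le> r" for z
    using HN'[of "u z", OF u[OF that]] sol[OF that] by (simp add: vec_eq_iff u_def)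
  have uH: "u (H x) = x" if "\<And>i. \<bar>x $ i\<bar> \<le> \<rho>" "\<And>i. \<bar>H x $ i\<bar> \<le> r" for x
  proof (rule uniq)
    show "u (H x) $ i + N i (u (H x)) = x $ i + N i x" for i
      using HN'[of "u (H x)" i, OF u] HN'[of x i] Hu[of "H x"] that by simp
  qed (use u that in auto)
  have u0: "u 0 = 0" using uH[of 0] H0 r \<rho> by simp
  define L where "L y = x0 + u (B (y - F x0))" for y
  have LF: "L (F x0) = x0" using B(1) u0 by (simp add: L_def linear_0)
  have "real_analytic_at (\<lambda>y. L y $ i) (F x0)" for i
  proof -
    have "real_analytic_at (\<lambda>y. U i (B (y - F x0))) (F x0)"
    proof (rule real_analytic_at_compose_vec)
      show "real_analytic_at (U i) (B (F x0 - F x0))"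
        by (rule power_series_bound_imp_real_analytic_at[OF U r]) (use B(1) r in \<open>simp add: linear_0\<close>)
      show "real_analytic_at (\<lambda>y. B (y - F x0) $ j) (F x0)" for j
        by (rule real_analytic_at_linear[OF B(1)]) (auto intro!: real_analytic_at_diff)
    qed
    then show ?thesis unfolding L_def u_def by (auto intro!: real_analytic_at_add)
  qed
  moreover have small: "\<forall>\<^sub>F y in nhds y1. \<forall>i. \<bar>G y $ i\<bar> \<le> s"
    if "continuous (at y1) G" "G y1 = 0" "s > 0" for G :: "real ^ 'm \<Rightarrow> real ^ 'm" and y1 s
  proof -
    have "(G \<longlongrightarrow> G y1) (nhds y1)"
      using that(1) unfolding continuous_at tendsto_at_iff_tendsto_nhds .
    then have "\<forall>\<^sub>F y in nhds y1. dist (G y) (G y1) < s"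
      using that(3) unfolding tendsto_iff by blast
    then show ?thesis
    proof (rule eventually_mono)
      fix y assume "dist (G y) (G y1) < s"
      then have "norm (G y) \<le> s" using that(2) by (simp add: dist_norm)
      then show "\<forall>i. \<bar>G y $ i\<bar> \<le> s" using component_le_norm_cart order_trans by blast
    qed
  qed
  have contB: "continuous (at y1) B" for y1
    using B(1) linear_continuous_at linear_conv_bounded_linear by blast
  have "\<forall>\<^sub>F y in nhds (F x0). \<forall>i. \<bar>B (y - F x0) $ i\<bar> \<le> r"
    by (rule small) (use B(1) r contB in \<open>auto simp: linear_0 intro!: continuous_intros continuous_at_compose[of _ "\<lambda>y. y - F x0" B, unfolded o_def]\<close>)
  then have "\<forall>\<^sub>F y in nhds (F x0). F (L y) = y"
  proof (rule eventually_mono)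
    fix y assume "\<forall>i. \<bar>B (y - F x0) $ i\<bar> \<le> r"
    then have "H (u (B (y - F x0))) = B (y - F x0)" using Hu by blast
    then have "F (x0 + u (B (y - F x0))) - F x0 = y - F x0"
      unfolding H_def using injB by (simp add: inj_eq)
    then show "F (L y) = y" by (simp add: L_def)
  qed
  moreover have "\<forall>\<^sub>F x in nhds x0. L (F x) = x"
  proof -
    have contF: "continuous (at x0) F"
      using F' has_derivative_continuous by blast
    have "\<forall>\<^sub>F x in nhds x0. \<forall>i. \<bar>(x - x0) $ i\<bar> \<le> \<rho>"
      by (rule small) (use \<rho> in \<open>auto intro!: continuous_intros\<close>)
    moreover have "\<forall>\<^sub>F x in nhds x0. \<forall>i. \<bar>B (F x - F x0) $ i\<bar> \<le> r"
      by (rule small) (use B(1) r contF contB in \<open>auto simp: linear_0 intro!: continuous_intros continuous_at_compose[of _ "\<lambda>y. F y - F x0" B, unfolded o_def]\<close>)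
    ultimately show ?thesis
    proof eventually_elim
      case (elim x)
      then have "u (H (x - x0)) = x - x0" by (intro uH) (auto simp: H_def)
      then show ?case by (simp add: L_def H_def)
    qed
  qed
  ultimately show thesis using LF by (intro that)
qed

text \<open>A linear left inverse \<open>B\<close> of the derivative projects the target to the
  dimension of the source, and the square case applies to \<open>B\<close> composed with
  \<open>F\<close>. Off the image of \<open>F\<close> the resulting map is no inverse of
  \<open>F\<close> in general.\<close>

corollary analytic_left_inverse:
  fixes F :: "real ^ 'm::finite \<Rightarrow> real ^ 'n::finite"
  assumes F: "\<And>i. real_analytic_at (\<lambda>x. F x $ i) x0"
    and F': "(F has_derivative F') (at x0)" and inj: "inj F'"
  obtains L where "\<And>i. real_analytic_at (\<lambda>y. L y $ i) (F x0)" "L (F x0) = x0"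
    "\<forall>\<^sub>F x in nhds x0. L (F x) = x"
proof -
  have linF': "linear F'" using F' has_derivative_linear by blast
  obtain B where B: "linear B" "B \<circ> F' = id"
    using linear_injective_left_inverse[OF linF' inj] by blast
  have "(B has_derivative B) (at (F x0))"
    using B(1) linear_conv_bounded_linear bounded_linear_imp_has_derivative by blast
  from has_derivative_compose[OF F' this]
  have "((\<lambda>x. B (F x)) has_derivative id) (at x0)" using B(2) by (simp add: o_def id_def)
  note d = this
  obtain L where L: "\<And>i. real_analytic_at (\<lambda>y. L y $ i) (B (F x0))" "L (B (F x0)) = x0"
    "\<forall>\<^sub>F x in nhds x0. L (B (F x)) = x"
    by (rule analytic_inverse_function[OF real_analytic_at_linear[OF B(1) F] d inj_on_id]) blast
  have "real_analytic_at (\<lambda>y. L (B y) $ i) (F x0)" for i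
    by (rule real_analytic_at_compose_vec[where Q = "\<lambda>y. L y $ i" and u = B, OF L(1)]) (intro real_analytic_at_linear[OF B(1)] real_analytic_at_component)
  then show thesis by (rule that[of "\<lambda>y. L (B y)"]) (use L in auto)
qed

section \<open>Polynomial vector fields and the linear flow\<close>

text \<open>The bound on the values is carried through the induction because the Lipschitz constant
  of a product depends on it.\<close>

lemma real_polynomial_function_lipschitz:
  fixes q :: "'a::real_normed_vector \<Rightarrow> real"
  assumes "real_polynomial_function q" "bounded S"
  shows "\<exists>L\<ge>0. \<exists>B\<ge>0. (\<forall>x\<in>S. \<bar>q x\<bar> \<le> B) \<and> (\<forall>x\<in>S. \<forall>y\<in>S. \<bar>q x - q y\<bar> \<le> L * norm (x - y))"
  using assms(1)
proof induction
  case (linear q)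
  obtain K where K: "K > 0" "\<And>x. norm (q x) \<le> norm x * K"
    using bounded_linear.pos_bounded[OF linear] by blast
  obtain B where B: "B > 0" "\<And>x. x \<in> S \<Longrightarrow> norm x \<le> B"
    using assms(2) bounded_pos by blast
  have "\<bar>q x\<bar> \<le> B * K" if "x \<in> S" for x
    using K(2)[of x] mult_right_mono[OF B(2)[OF that], of K] K(1) unfolding real_norm_def by linarith
  moreover have "\<bar>q x - q y\<bar> \<le> K * norm (x - y)" for x y
    using K(2)[of "x - y"] linear_diff[OF bounded_linear.linear[OF linear], of x y] by (simp add: mult.commute)
  ultimately show ?case using K(1) B(1)
    by (intro exI[of _ K] exI[of _ "B * K"] conjI) auto
next
  case (const c)
  show ?case by (intro exI[of _ 0] exI[of _ "\<bar>c\<bar>"] conjI) auto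
next
  case (add p q)
  obtain L B where 1: "L \<ge> 0" "B \<ge> 0" "\<And>x. x \<in> S \<Longrightarrow> \<bar>p x\<bar> \<le> B"
    "\<And>x y. x \<in> S \<Longrightarrow> y \<in> S \<Longrightarrow> \<bar>p x - p y\<bar> \<le> L * norm (x - y)" using add.IH(1) by blast
  obtain L' B' where 2: "L' \<ge> 0" "B' \<ge> 0" "\<And>x. x \<in> S \<Longrightarrow> \<bar>q x\<bar> \<le> B'"
    "\<And>x y. x \<in> S \<Longrightarrow> y \<in> S \<Longrightarrow> \<bar>q x - q y\<bar> \<le> L' * norm (x - y)" using add.IH(2) by blast
  have "\<bar>p x + q x\<bar> \<le> B + B'" if "x \<in> S" for x
    using 1(3)[OF that] 2(3)[OF that] by linarith
  moreover have "\<bar>(p x + q x) - (p y + q y)\<bar> \<le> (L + L') * norm (x - y)" if "x \<in> S" "y \<in> S" for x y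
    using 1(4)[OF that] 2(4)[OF that] unfolding ring_distribs by linarith
  ultimately show ?case using 1(1,2) 2(1,2)
    by (intro exI[of _ "L + L'"] exI[of _ "B + B'"] conjI) auto
next
  case (mult p q)
  obtain L B where 1: "L \<ge> 0" "B \<ge> 0" "\<And>x. x \<in> S \<Longrightarrow> \<bar>p x\<bar> \<le> B"
    "\<And>x y. x \<in> S \<Longrightarrow> y \<in> S \<Longrightarrow> \<bar>p x - p y\<bar> \<le> L * norm (x - y)" using mult.IH(1) by blast
  obtain L' B' where 2: "L' \<ge> 0" "B' \<ge> 0" "\<And>x. x \<in> S \<Longrightarrow> \<bar>q x\<bar> \<le> B'"
    "\<And>x y. x \<in> S \<Longrightarrow> y \<in> S \<Longrightarrow> \<bar>q x - q y\<bar> \<le> L' * norm (x - y)" using mult.IH(2) by blast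
  have "\<bar>p x * q x\<bar> \<le> B * B'" if "x \<in> S" for x
    unfolding abs_mult using 1(2) 1(3)[OF that] 2(3)[OF that] by (intro mult_mono) auto
  moreover have "\<bar>p x * q x - p y * q y\<bar> \<le> (L * B' + B * L') * norm (x - y)" if "x \<in> S" "y \<in> S" for x y
  proof -
    have "\<bar>p x * q x - p y * q y\<bar> = \<bar>(p x - p y) * q x + p y * (q x - q y)\<bar>" by (simp add: algebra_simps)
    also have "\<dots> \<le> \<bar>p x - p y\<bar> * \<bar>q x\<bar> + \<bar>p y\<bar> * \<bar>q x - q y\<bar>"
      by (metis abs_mult abs_triangle_ineq)
    also have "\<dots> \<le> (L * norm (x - y)) * B' + B * (L' * norm (x - y))"
      using 1 2 that by (intro add_mono mult_mono) auto
    finally show ?thesis by (simp add: algebra_simps)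
  qed
  ultimately show ?case using 1(1,2) 2(1,2)
    by (intro exI[of _ "L * B' + B * L'"] exI[of _ "B * B'"] conjI) auto
qed

lemma polynomial_function_lipschitz:
  fixes g :: "'a::euclidean_space \<Rightarrow> 'b::euclidean_space"
  assumes "polynomial_function g" "bounded S"
  obtains L where "L \<ge> 0" "\<And>x y. x \<in> S \<Longrightarrow> y \<in> S \<Longrightarrow> norm (g x - g y) \<le> L * norm (x - y)"
proof -
  have "\<forall>b\<in>Basis. \<exists>L\<ge>0. \<forall>x\<in>S. \<forall>y\<in>S. \<bar>g x \<bullet> b - g y \<bullet> b\<bar> \<le> L * norm (x - y)"
    using real_polynomial_function_lipschitz[OF _ assms(2)] assms(1)
    unfolding polynomial_function_iff_Basis_inner by blast
  then obtain L where L: "\<And>b. b \<in> Basis \<Longrightarrow> L b \<ge> 0"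
    "\<And>b x y. b \<in> Basis \<Longrightarrow> x \<in> S \<Longrightarrow> y \<in> S \<Longrightarrow> \<bar>g x \<bullet> b - g y \<bullet> b\<bar> \<le> L b * norm (x - y)"
    by metis
  have "norm (g x - g y) \<le> sum L Basis * norm (x - y)" if "x \<in> S" "y \<in> S" for x y
  proof -
    have "norm (g x - g y) \<le> (\<Sum>b\<in>Basis. \<bar>(g x - g y) \<bullet> b\<bar>)" by (rule norm_le_l1)
    also have "\<dots> \<le> (\<Sum>b\<in>Basis. L b * norm (x - y))"
      using L(2) that by (intro sum_mono) (simp add: inner_diff_left)
    finally show ?thesis by (simp add: sum_distrib_right)
  qed
  then show ?thesis using L(1) by (intro that[of "sum L Basis"]) (auto simp: sum_nonneg)
qed

text \<open>The function exp (- 2 L s) |X - Y|^2 does not increase. Squaring avoids differentiating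
  the norm at 0, and the Lipschitz condition is asked only along the two solutions, at equal
  times.\<close>

lemma ode_gronwall:
  fixes X Y :: "real \<Rightarrow> 'a::real_inner"
  assumes ab: "a \<le> b"
    and X: "\<And>s. s \<in> {a..b} \<Longrightarrow> (X has_vector_derivative g (X s)) (at s within {a..b})"
    and Y: "\<And>s. s \<in> {a..b} \<Longrightarrow> (Y has_vector_derivative g (Y s)) (at s within {a..b})"
    and L: "\<And>s. s \<in> {a..b} \<Longrightarrow> norm (g (X s) - g (Y s)) \<le> L * norm (X s - Y s)"
  shows "norm (X b - Y b) \<le> exp (L * (b - a)) * norm (X a - Y a)"
proof (cases "a = b")
  case False
  with ab have ab: "a < b" by simp
  define D where "D s = X s - Y s" for s
  define v where "v s = exp (- 2 * L * s) * (D s \<bullet> D s)" for s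
  have D: "(D has_vector_derivative g (X s) - g (Y s)) (at s within {a..b})" if "s \<in> {a..b}" for s
    unfolding D_def[abs_def] by (intro has_vector_derivative_diff X Y that)
  have v: "(v has_real_derivative exp (- 2 * L * s) * (2 * (D s \<bullet> (g (X s) - g (Y s))) - 2 * L * (D s \<bullet> D s))) (at s within {a..b})"
    if "s \<in> {a..b}" for s
  proof -
    have "((\<lambda>s. D s \<bullet> D s) has_vector_derivative (D s \<bullet> (g (X s) - g (Y s)) + (g (X s) - g (Y s)) \<bullet> D s)) (at s within {a..b})"
      by (rule bounded_bilinear.has_vector_derivative[OF bounded_bilinear_inner D[OF that] D[OF that]])
    then have "((\<lambda>s. D s \<bullet> D s) has_real_derivative 2 * (D s \<bullet> (g (X s) - g (Y s)))) (at s within {a..b})"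
      by (simp add: has_real_derivative_iff_has_vector_derivative inner_commute)
    then show ?thesis unfolding v_def[abs_def]
      by (auto intro!: derivative_eq_intros simp: algebra_simps)
  qed
  have "v b \<le> v a"
  proof (rule DERIV_nonpos_imp_decreasing_open[OF less_imp_le[OF ab]])
    show "continuous_on {a..b} v"
      by (rule DERIV_continuous_on[OF v])
    fix s assume s: "a < s" "s < b"
    have "D s \<bullet> (g (X s) - g (Y s)) \<le> norm (D s) * norm (g (X s) - g (Y s))" by (rule norm_cauchy_schwarz)
    also have "\<dots> \<le> norm (D s) * (L * norm (D s))"
      using L[of s] s by (intro mult_left_mono) (auto simp: D_def)
    also have "\<dots> = L * (D s \<bullet> D s)" by (simp add: power2_norm_eq_inner[symmetric] power2_eq_square)
    finally have "exp (- 2 * L * s) * (2 * (D s \<bullet> (g (X s) - g (Y s))) - 2 * L * (D s \<bullet> D s)) \<le> 0"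
      by (intro mult_nonneg_nonpos) auto
    moreover have "at s within {a..b} = at s" using s by (intro at_within_interior) auto
    ultimately show "\<exists>y. (v has_real_derivative y) (at s) \<and> y \<le> 0"
      using v[of s] s by auto
  qed
  then have "exp (- 2 * L * b) * (D b \<bullet> D b) \<le> exp (- 2 * L * a) * (D a \<bullet> D a)" by (simp add: v_def)
  then have "exp (2 * L * b) * (exp (- 2 * L * b) * (D b \<bullet> D b)) \<le> exp (2 * L * b) * (exp (- 2 * L * a) * (D a \<bullet> D a))"
    by (rule mult_left_mono) simp
  then have "norm (D b) ^ 2 \<le> exp (2 * (L * (b - a))) * norm (D a) ^ 2"
    unfolding power2_norm_eq_inner mult.assoc[symmetric] exp_add[symmetric] by (simp add: algebra_simps)
  also have "\<dots> = (exp (L * (b - a)) * norm (D a)) ^ 2"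
    by (simp add: power_mult_distrib exp_double)
  finally show ?thesis unfolding D_def by (rule power2_le_imp_le) simp
qed simp

lemma solution_bounded:
  fixes X :: "real \<Rightarrow> 'a::euclidean_space"
  assumes "\<And>s. s \<in> {a..b} \<Longrightarrow> (X has_vector_derivative X' s) (at s within {a..b})"
  shows "bounded (X ` {a..b})"
  by (intro compact_imp_bounded compact_continuous_image compact_Icc)
     (use assms has_vector_derivative_continuous continuous_on_eq_continuous_within in blast)

text \<open>A polynomial field need not be globally Lipschitz, but both solutions stay in a bounded
  set on a compact interval.\<close>

lemma polynomial_ode_unique:
  fixes X Y :: "real \<Rightarrow> 'a::euclidean_space"
  assumes g: "polynomial_function g" and ab: "a \<le> b"
    and X: "\<And>s. s \<in> {a..b} \<Longrightarrow> (X has_vector_derivative g (X s)) (at s within {a..b})"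
    and Y: "\<And>s. s \<in> {a..b} \<Longrightarrow> (Y has_vector_derivative g (Y s)) (at s within {a..b})"
    and eq: "X a = Y a"
  shows "X b = Y b"
proof -
  have "bounded (X ` {a..b} \<union> Y ` {a..b})"
    using solution_bounded[OF X] solution_bounded[OF Y] by simp
  from polynomial_function_lipschitz[OF g this]
  obtain L where L: "L \<ge> 0" "\<And>x y. x \<in> X ` {a..b} \<union> Y ` {a..b} \<Longrightarrow> y \<in> X ` {a..b} \<union> Y ` {a..b} \<Longrightarrow> norm (g x - g y) \<le> L * norm (x - y)"
    by blast
  have "norm (X b - Y b) \<le> exp (L * (b - a)) * norm (X a - Y a)"
    by (rule ode_gronwall[OF ab X Y L(2)]) auto
  then show ?thesis using eq by simp
qed

section \<open>The linear flow on the parameter cube\<close>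

definition diag_flow :: "('m::finite \<Rightarrow> real) \<Rightarrow> real \<Rightarrow> real ^ 'm \<Rightarrow> real ^ 'm" where
  "diag_flow lam s \<theta> = (\<chi> j. exp (lam j * s) * \<theta> $ j)"

lemma diag_flow_zero [simp]: "diag_flow lam 0 \<theta> = \<theta>"
  by (simp add: diag_flow_def)

lemma abs_diag_flow_le:
  assumes "\<And>j. lam j < 0" "s \<ge> 0"
  shows "\<bar>diag_flow lam s \<theta> $ j\<bar> \<le> \<bar>\<theta> $ j\<bar>"
proof -
  have "exp (lam j * s) \<le> 1" using assms(1)[of j] assms(2) by (simp add: mult_nonpos_nonneg)
  then show ?thesis by (simp add: diag_flow_def abs_mult mult_left_le_one_le)
qed

lemma diag_flow_in_unit_cube:
  assumes "\<And>j. lam j < 0" "s \<ge> 0" "\<theta> \<in> unit_cube"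
  shows "diag_flow lam s \<theta> \<in> unit_cube"
proof -
  have "\<bar>\<theta> $ j\<bar> \<le> 1" for j using assms(3) by (simp add: unit_cube_def)
  then have "\<bar>diag_flow lam s \<theta> $ j\<bar> \<le> 1" for j
    by (rule order_trans[OF abs_diag_flow_le[where lam = lam, OF assms(1,2)]])
  then show ?thesis by (simp add: unit_cube_def)
qed

lemma diag_flow_tendsto_0:
  assumes "\<And>j. lam j < 0"
  shows "((\<lambda>s. diag_flow lam s \<theta>) \<longlongrightarrow> 0) at_top"
proof (rule vec_tendstoI)
  fix j
  have "((\<lambda>s. exp (lam j * s)) \<longlongrightarrow> 0) at_top"
    by (rule filterlim_compose[OF exp_at_bot])
       (rule filterlim_tendsto_neg_mult_at_bot[OF tendsto_const assms filterlim_ident])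
  then show "((\<lambda>s. diag_flow lam s \<theta> $ j) \<longlongrightarrow> 0 $ j) at_top"
    using tendsto_mult_right[of _ 0 at_top "\<theta> $ j"] by (simp add: diag_flow_def tendsto_mult_left_zero)
qed

text \<open>Monomials are eigenfunctions of the linear flow; this is why integrating a series along
  it only divides each coefficient by a number.\<close>

lemma monomial_diag_flow:
  "monomial (diag_flow lam s \<theta>) \<gamma> = exp ((\<Sum>i\<in>UNIV. real (\<gamma> i) * lam i) * s) * monomial \<theta> \<gamma>"
proof -
  have "exp ((\<Sum>i\<in>UNIV. real (\<gamma> i) * lam i) * s) = exp (\<Sum>i\<in>UNIV. real (\<gamma> i) * (lam i * s))"
    unfolding sum_distrib_right mult.assoc ..
  also have "\<dots> = (\<Prod>i\<in>UNIV. exp (lam i * s) ^ \<gamma> i)"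
    unfolding exp_sum[OF finite] exp_of_nat_mult ..
  finally have "exp ((\<Sum>i\<in>UNIV. real (\<gamma> i) * lam i) * s) = (\<Prod>i\<in>UNIV. exp (lam i * s) ^ \<gamma> i)" .
  then show ?thesis
    unfolding monomial_def diag_flow_def vec_lambda_beta power_mult_distrib prod.distrib by (rule ssubst) (rule refl)
qed

text \<open>The flow relation provides, for each final time separately, some solution with the right
  end point. Uniqueness glues these solutions into the one curve
  \<open>P (diag_flow lam s \<theta>)\<close>.\<close>

lemma stable_parameterization_solution:
  assumes g: "polynomial_function g" and param: "stable_parameterization g p lam \<xi> a P"
    and \<theta>: "\<theta> \<in> unit_cube" and s: "s \<ge> 0"
  shows "((\<lambda>s. P (diag_flow lam s \<theta>)) has_vector_derivative g (P (diag_flow lam s \<theta>))) (at s within {0..})"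
proof -
  have fl: "flows_to g \<tau> (P \<theta>) (P (diag_flow lam \<tau> \<theta>))" if "\<tau> \<ge> 0" for \<tau>
    using param \<theta> that unfolding stable_parameterization_def diag_flow_def by blast
  \<comment> \<open>Running one unit past \<open>s\<close> makes the interval a neighbourhood of
    \<open>s\<close> in the half line, so the derivative at \<open>s\<close> is not merely a left
    one.\<close>
  have "s + 1 \<ge> 0" using s by simp
  from fl[OF this] obtain u where u: "u 0 = P \<theta>"
    "\<And>\<sigma>. \<sigma> \<in> {0..s + 1} \<Longrightarrow> (u has_vector_derivative g (u \<sigma>)) (at \<sigma> within {0..s + 1})"
    unfolding flows_to_def by blast
  have eq: "u \<sigma> = P (diag_flow lam \<sigma> \<theta>)" if \<sigma>: "\<sigma> \<in> {0..s + 1}" for \<sigma>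
  proof -
    obtain v where v: "v 0 = P \<theta>" "v \<sigma> = P (diag_flow lam \<sigma> \<theta>)"
      "\<And>t. t \<in> {0..\<sigma>} \<Longrightarrow> (v has_vector_derivative g (v t)) (at t within {0..\<sigma>})"
      using fl[of \<sigma>] \<sigma> unfolding flows_to_def by auto
    have "u \<sigma> = v \<sigma>"
    proof (rule polynomial_ode_unique[OF g _ _ v(3)])
      show "(u has_vector_derivative g (u t)) (at t within {0..\<sigma>})" if "t \<in> {0..\<sigma>}" for t
        by (rule has_vector_derivative_within_subset[OF u(2)]) (use that \<sigma> in auto)
    qed (use \<sigma> u v in auto)
    then show ?thesis using v by simp
  qed
  have "((\<lambda>s. P (diag_flow lam s \<theta>)) has_vector_derivative g (u s)) (at s within {0..s + 1})"
    by (rule has_vector_derivative_transform[OF _ _ u(2)]) (use eq s in auto)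
  moreover have "at s within {0..s + 1} = at s within {0..}"
    by (rule at_within_nhd[of s "{..<s + 1}"]) auto
  ultimately show ?thesis using eq[of s] s by simp
qed

text \<open>At the corner (1, ..., 1) all monomials are 1, so convergence there is absolute
  summability of the coefficients, that is, a finite norm at radius exactly 1.\<close>

lemma stable_parameterization_power_series:
  assumes "stable_parameterization g p lam \<xi> a P"
  obtains M where "\<And>i. power_series_bound 0 1 (\<lambda>\<theta>. P \<theta> $ i) (M i)"
proof -
  have hs: "((\<lambda>\<gamma>. monomial \<theta> \<gamma> *\<^sub>R a \<gamma>) has_sum P \<theta>) UNIV" if "\<theta> \<in> unit_cube" for \<theta>
    using assms that unfolding stable_parameterization_def by blast
  have hsi: "((\<lambda>\<gamma>. a \<gamma> $ i * monomial \<theta> \<gamma>) has_sum P \<theta> $ i) UNIV" if "\<theta> \<in> unit_cube" for \<theta> i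
    using has_sum_bounded_linear[OF bounded_linear_vec_nth hs[OF that], of i] by (simp add: mult.commute)
  have "(\<lambda>\<gamma>. a \<gamma> $ i * monomial (\<chi> j. 1) \<gamma>) summable_on UNIV" for i
    by (rule has_sum_imp_summable[OF hsi]) (simp add: unit_cube_def)
  moreover have "a \<gamma> $ i * monomial (\<chi> j. 1) \<gamma> = a \<gamma> $ i" for \<gamma> i
    by (simp add: monomial_def)
  ultimately have "(\<lambda>\<gamma>. a \<gamma> $ i) summable_on UNIV" for i by simp
  from iffD1[OF summable_on_iff_abs_summable_on_real this]
  have "(\<lambda>\<gamma>. \<bar>a \<gamma> $ i\<bar>) summable_on UNIV" for i by simp
  then have "power_series_bound 0 1 (\<lambda>\<theta>. P \<theta> $ i) (\<Sum>\<^sub>\<infinity>\<gamma>. \<bar>a \<gamma> $ i\<bar>)" for i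
    unfolding power_series_bound_def
    using hsi by (intro exI[of _ "\<lambda>\<gamma>. a \<gamma> $ i"]) (auto simp: unit_cube_def)
  then show thesis by (rule that)
qed

text \<open>Applying \<open>A - lam k\<close> kills the term of \<open>k\<close> and multiplies the
  others by nonzero numbers.\<close>

lemma independent_eigenvectors:
  fixes A :: "'a::real_vector \<Rightarrow> 'a"
  assumes A: "linear A" and inj: "inj lam" and nz: "\<And>j. \<xi> j \<noteq> 0" and eig: "\<And>j. A (\<xi> j) = lam j *\<^sub>R \<xi> j"
    and "finite J" "(\<Sum>j\<in>J. v j *\<^sub>R \<xi> j) = 0" "j \<in> J"
  shows "v j = 0"
  using assms(5-)
proof (induction J arbitrary: v j)
  case (insert k J)
  have "A (\<Sum>j\<in>insert k J. v j *\<^sub>R \<xi> j) - lam k *\<^sub>R (\<Sum>j\<in>insert k J. v j *\<^sub>R \<xi> j)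
      = (\<Sum>j\<in>insert k J. (v j * (lam j - lam k)) *\<^sub>R \<xi> j)"
    by (simp only: linear_sum[OF A] linear_scale[OF A] eig scaleR_sum_right sum_subtractf[symmetric])
       (simp add: algebra_simps)
  then have "(\<Sum>j\<in>insert k J. (v j * (lam j - lam k)) *\<^sub>R \<xi> j) = 0"
    unfolding insert.prems(1) by (simp add: linear_0[OF A])
  then have "(\<Sum>j\<in>J. (v j * (lam j - lam k)) *\<^sub>R \<xi> j) = 0" using insert.hyps by simp
  then have "v i * (lam i - lam k) = 0" if "i \<in> J" for i
    by (rule insert.IH[OF _ that])
  then have J: "v i = 0" if "i \<in> J" for i
    using that insert.hyps(2) inj by (metis injD mult_eq_0_iff right_minus_eq)
  then have "v k *\<^sub>R \<xi> k = 0" using insert.prems(1) insert.hyps by simp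
  then have "v k = 0" using nz by simp
  then show ?case using J insert.prems(2) by blast
qed simp

text \<open>\<open>\<Phi>\<close> is a primitive: its derivative along the flow is - F. Its
  coefficients are those of \<open>F\<close> divided by
  \<open>\<mu> \<gamma> = - \<gamma> \<cdot> \<lambda>\<close>, and \<open>\<mu> \<gamma>\<close> is
  at least the slowest decay rate \<open>\<mu>0\<close> as soon as \<gamma> has degree at least 1.
  So the division costs at most a constant factor in the norm.\<close>

lemma diag_flow_integral:
  fixes F :: "real ^ 'm::finite \<Rightarrow> real"
  assumes F: "power_series_bound 1 1 F M" and lam: "\<And>j. lam j < 0"
  obtains \<Phi> M' where "power_series_bound 1 1 \<Phi> M'"
    "\<And>\<theta> a b. \<theta> \<in> unit_cube \<Longrightarrow> a \<le> b \<Longrightarrow>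
       ((\<lambda>s. F (diag_flow lam (s - a) \<theta>)) has_integral (\<Phi> \<theta> - \<Phi> (diag_flow lam (b - a) \<theta>))) {a..b}"
proof -
  obtain c where d: "\<And>\<gamma>. sum \<gamma> UNIV < 1 \<Longrightarrow> c \<gamma> = 0"
    and c: "(\<lambda>\<gamma>. \<bar>c \<gamma>\<bar>) summable_on UNIV"
     "\<And>z. (\<And>i. \<bar>z $ i\<bar> \<le> 1) \<Longrightarrow> ((\<lambda>\<gamma>. c \<gamma> * monomial z \<gamma>) has_sum F z) UNIV"
    using F unfolding power_series_bound_def power_one mult_1_right by blast
  define \<mu> where "\<mu> \<gamma> = - (\<Sum>i\<in>UNIV. real (\<gamma> i) * lam i)" for \<gamma>
  define \<mu>0 where "\<mu>0 = Min (range (\<lambda>j. - lam j))"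
  have \<mu>0: "\<mu>0 > 0" "\<And>j. \<mu>0 \<le> - lam j" using lam by (auto simp: \<mu>0_def)
  have \<mu>: "\<mu>0 \<le> \<mu> \<gamma>" if "sum \<gamma> UNIV \<ge> 1" for \<gamma>
  proof -
    have "\<mu>0 * 1 \<le> \<mu>0 * real (sum \<gamma> UNIV)" using \<mu>0(1) that by (intro mult_left_mono) linarith+
    also have "\<dots> = (\<Sum>i\<in>UNIV. real (\<gamma> i) * \<mu>0)" by (simp add: sum_distrib_left mult.commute)
    also have "\<dots> \<le> (\<Sum>i\<in>UNIV. real (\<gamma> i) * (- lam i))" by (intro sum_mono mult_left_mono \<mu>0) auto
    finally show ?thesis by (simp add: \<mu>_def sum_negf)
  qed
  have c0: "c \<gamma> = 0 \<or> \<mu>0 \<le> \<mu> \<gamma>" for \<gamma>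
    using d[of \<gamma>] \<mu>[of \<gamma>] by linarith
  define e where "e \<gamma> = c \<gamma> / \<mu> \<gamma>" for \<gamma>
  have e: "\<bar>e \<gamma>\<bar> \<le> inverse \<mu>0 * \<bar>c \<gamma>\<bar>" for \<gamma>
  proof (cases "c \<gamma> = 0")
    case False
    then have le: "\<mu>0 \<le> \<mu> \<gamma>" using c0 by blast
    then have "inverse (\<mu> \<gamma>) * \<bar>c \<gamma>\<bar> \<le> inverse \<mu>0 * \<bar>c \<gamma>\<bar>"
      using \<mu>0(1) by (intro mult_right_mono le_imp_inverse_le) auto
    then show ?thesis using le \<mu>0(1) by (simp add: e_def abs_div divide_inverse abs_mult mult.commute)
  qed (simp add: e_def)
  have se: "(\<lambda>\<gamma>. \<bar>e \<gamma>\<bar>) summable_on UNIV"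
    by (rule summable_on_comparison_test[OF summable_on_cmult_right[OF c(1)] e]) auto
  define \<Phi> where "\<Phi> z = (\<Sum>\<^sub>\<infinity>\<gamma>. e \<gamma> * monomial z \<gamma>)" for z
  have \<Phi>: "((\<lambda>\<gamma>. e \<gamma> * monomial z \<gamma>) has_sum \<Phi> z) UNIV" if "\<And>i. \<bar>z $ i\<bar> \<le> 1" for z
  proof -
    have "norm (e \<gamma> * monomial z \<gamma>) \<le> \<bar>e \<gamma>\<bar>" for \<gamma>
      using abs_monomial_le[of z 1 \<gamma>] that mult_left_mono[of _ 1 "\<bar>e \<gamma>\<bar>"] by (simp add: abs_mult)
    then have "(\<lambda>\<gamma>. norm (e \<gamma> * monomial z \<gamma>)) summable_on UNIV"
      by (intro summable_on_comparison_test[OF se]) auto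
    from has_sum_infsum[OF abs_summable_summable[OF this]] show ?thesis unfolding \<Phi>_def .
  qed
  have "power_series_bound 1 1 \<Phi> (\<Sum>\<^sub>\<infinity>\<gamma>. \<bar>e \<gamma>\<bar>)"
    unfolding power_series_bound_def
    using d se \<Phi> by (intro exI[of _ e]) (auto simp: e_def)
  moreover have "((\<lambda>s. F (diag_flow lam (s - a) \<theta>)) has_integral (\<Phi> \<theta> - \<Phi> (diag_flow lam (b - a) \<theta>))) {a..b}"
    if \<theta>: "\<theta> \<in> unit_cube" and ab: "a \<le> b" for \<theta> a b
  proof -
    have fl: "\<bar>diag_flow lam (s - a) \<theta> $ i\<bar> \<le> 1" if "s \<ge> a" for s i
      using diag_flow_in_unit_cube[OF lam _ \<theta>, of "s - a"] that by (simp add: unit_cube_def)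
    define G where "G X s = (\<Sum>\<gamma>\<in>X. c \<gamma> * monomial (diag_flow lam (s - a) \<theta>) \<gamma>)" for X s
    \<comment> \<open>The sums over finite sets of exponents converge uniformly in \<open>s\<close>,
      with majorant \<open>\<bar>c \<gamma>\<bar>\<close>, which permits integration term by
      term.\<close>
    have ul: "uniform_limit {a..b} G (\<lambda>s. F (diag_flow lam (s - a) \<theta>)) (finite_subsets_at_top UNIV)"
      unfolding G_def[abs_def]
    proof (rule Weierstrass_m_test_general'[OF _ _ c(1)])
      show "norm (c \<gamma> * monomial (diag_flow lam (s - a) \<theta>) \<gamma>) \<le> \<bar>c \<gamma>\<bar>" if "s \<in> {a..b}" for \<gamma> s
        using abs_monomial_le[of "diag_flow lam (s - a) \<theta>" 1 \<gamma>] fl[of s] that mult_left_mono[of _ 1 "\<bar>c \<gamma>\<bar>"]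
        by (simp add: abs_mult)
      show "((\<lambda>\<gamma>. c \<gamma> * monomial (diag_flow lam (s - a) \<theta>) \<gamma>) has_sum F (diag_flow lam (s - a) \<theta>)) UNIV"
        if "s \<in> {a..b}" for s
        using fl that by (intro c(2)) auto
    qed
    have cont: "continuous_on {a..b} (G X)" for X
      unfolding G_def[abs_def] monomial_diag_flow by (intro continuous_intros)
    obtain I J where I: "\<And>X. (G X has_integral I X) {a..b}"
      and J: "((\<lambda>s. F (diag_flow lam (s - a) \<theta>)) has_integral J) {a..b}"
      and IJ: "(I \<longlongrightarrow> J) (finite_subsets_at_top UNIV)"
      by (rule uniform_limit_integral[OF ul cont]) auto
    define E where "E \<gamma> = e \<gamma> * monomial \<theta> \<gamma> - e \<gamma> * monomial (diag_flow lam (b - a) \<theta>) \<gamma>" for \<gamma>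
    have tm: "((\<lambda>s. c \<gamma> * monomial (diag_flow lam (s - a) \<theta>) \<gamma>) has_integral E \<gamma>) {a..b}" for \<gamma>
    proof (cases "c \<gamma> = 0")
      case True
      then show ?thesis by (simp add: E_def e_def)
    next
      case False
      then have \<mu>pos: "\<mu> \<gamma> > 0" using c0[of \<gamma>] \<mu>0(1) by auto
      have m: "monomial (diag_flow lam s \<theta>) \<gamma> = exp (- \<mu> \<gamma> * s) * monomial \<theta> \<gamma>" for s
        by (simp add: monomial_diag_flow \<mu>_def)
      have "((\<lambda>s. c \<gamma> * (exp (- \<mu> \<gamma> * (s - a)) * monomial \<theta> \<gamma>)) has_integral
          (- e \<gamma> * exp (- \<mu> \<gamma> * (b - a)) * monomial \<theta> \<gamma>) - (- e \<gamma> * exp (- \<mu> \<gamma> * (a - a)) * monomial \<theta> \<gamma>)) {a..b}"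
      proof (rule fundamental_theorem_of_calculus[OF ab])
        show "((\<lambda>s. - e \<gamma> * exp (- \<mu> \<gamma> * (s - a)) * monomial \<theta> \<gamma>) has_vector_derivative
            c \<gamma> * (exp (- \<mu> \<gamma> * (s - a)) * monomial \<theta> \<gamma>)) (at s within {a..b})" for s
          unfolding has_real_derivative_iff_has_vector_derivative[symmetric] e_def
          using \<mu>pos by (auto intro!: derivative_eq_intros)
      qed
      then show ?thesis unfolding m E_def by (simp add: algebra_simps)
    qed
    have "I X = (\<Sum>\<gamma>\<in>X. E \<gamma>)" if "finite X" for X
      by (rule has_integral_unique[OF I]) (unfold G_def, rule has_integral_sum[OF that tm])
    then have "\<forall>\<^sub>F X in finite_subsets_at_top UNIV. sum E X = I X"
      by (intro eventually_finite_subsets_at_top_weakI) simp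
    with IJ have "(E has_sum J) UNIV"
      unfolding has_sum_def using Lim_transform_eventually[OF IJ] eventually_mono by (simp add: tendsto_cong)
    moreover have "(E has_sum (\<Phi> \<theta> - \<Phi> (diag_flow lam (b - a) \<theta>))) UNIV"
      using has_sum_add[OF \<Phi>[of \<theta>] has_sum_uminusI[OF \<Phi>[of "diag_flow lam (b - a) \<theta>"]]] \<theta> fl[OF ab]
      unfolding E_def[abs_def] by (simp add: unit_cube_def)
    ultimately have "J = \<Phi> \<theta> - \<Phi> (diag_flow lam (b - a) \<theta>)" by (rule has_sum_unique)
    with J show ?thesis by simp
  qed
  ultimately show thesis by (rule that)
qed

text \<open>Since the flow tends to 0 and \<open>\<Phi>\<close> is continuous with value 0 there,
  the boundary term at infinity disappears. Nonnegativity makes the partial integrals monotone, so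
  their limit is the integral over the half line.\<close>

lemma improper_diag_flow_integral:
  fixes F :: "real ^ 'm::finite \<Rightarrow> real"
  assumes F: "power_series_bound 1 1 F M" and lam: "\<And>j. lam j < 0"
  obtains \<Phi> M' where "power_series_bound 1 1 \<Phi> M'"
    "\<And>\<theta> a. \<theta> \<in> unit_cube \<Longrightarrow> (\<And>s. s \<ge> a \<Longrightarrow> F (diag_flow lam (s - a) \<theta>) \<ge> 0) \<Longrightarrow>
       ((\<lambda>s. F (diag_flow lam (s - a) \<theta>)) has_integral \<Phi> \<theta>) {a..}"
proof -
  obtain \<Phi> M' where \<Phi>: "power_series_bound 1 1 \<Phi> M'" and int:
    "\<And>\<theta> a b. \<theta> \<in> unit_cube \<Longrightarrow> a \<le> b \<Longrightarrow>
       ((\<lambda>s. F (diag_flow lam (s - a) \<theta>)) has_integral (\<Phi> \<theta> - \<Phi> (diag_flow lam (b - a) \<theta>))) {a..b}"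
    by (rule diag_flow_integral[where lam = lam, OF F lam]) blast
  have \<Phi>0: "\<Phi> 0 = 0"
    using power_series_bound_abs_le[OF power_series_bound_shrink[OF \<Phi>, of 0], of 0] by simp
  have cont: "isCont \<Phi> 0"
    by (intro real_analytic_at_isCont power_series_bound_imp_real_analytic_at[OF \<Phi>]) auto
  have "((\<lambda>s. F (diag_flow lam (s - a) \<theta>)) has_integral \<Phi> \<theta>) {a..}"
    if \<theta>: "\<theta> \<in> unit_cube" and nn: "\<And>s. s \<ge> a \<Longrightarrow> F (diag_flow lam (s - a) \<theta>) \<ge> 0" for \<theta> a
  proof (rule has_integral_to_inf)
    show "(\<lambda>s. F (diag_flow lam (s - a) \<theta>)) integrable_on {a..b}" for b
      using int[OF \<theta>, of a b] by (cases "a \<le> b") (auto simp: has_integral_integrable)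
    have "((\<lambda>b. diag_flow lam (b - a) \<theta>) \<longlongrightarrow> 0) at_top"
      by (rule filterlim_compose[OF diag_flow_tendsto_0[where lam = lam, OF lam]])
         (use filterlim_tendsto_add_at_top[OF tendsto_const[of "- a"] filterlim_ident] in simp)
    then have "((\<lambda>b. \<Phi> \<theta> - \<Phi> (diag_flow lam (b - a) \<theta>)) \<longlongrightarrow> \<Phi> \<theta> - \<Phi> 0) at_top"
      by (intro tendsto_diff tendsto_const isCont_tendsto_compose[OF cont])
    moreover have "\<forall>\<^sub>F b in at_top. \<Phi> \<theta> - \<Phi> (diag_flow lam (b - a) \<theta>) = integral {a..b} (\<lambda>s. F (diag_flow lam (s - a) \<theta>))"
      using eventually_ge_at_top[of a] by eventually_elim (rule integral_unique[symmetric, OF int[OF \<theta>]])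
    ultimately show "((\<lambda>b. integral {a..b} (\<lambda>s. F (diag_flow lam (s - a) \<theta>))) \<longlongrightarrow> \<Phi> \<theta>) at_top"
      using Lim_transform_eventually \<Phi>0 by fastforce
  qed (use nn in auto)
  with \<Phi> show thesis by (rule that)
qed

section \<open>Quantitative injectivity of the parameterization\<close>

lemma bounded_if_power_series_bound:
  fixes P :: "real ^ 'm::finite \<Rightarrow> real ^ 'n::finite"
  assumes "\<And>i. power_series_bound 0 1 (\<lambda>\<theta>. P \<theta> $ i) (M i)"
  shows "bounded (P ` unit_cube)"
proof -
  have "norm (P \<theta>) \<le> (\<Sum>i\<in>UNIV. M i)" if "\<theta> \<in> unit_cube" for \<theta>
  proof -
    have "\<bar>P \<theta> $ i\<bar> \<le> M i" for i
      by (rule power_series_bound_abs_le[OF assms]) (use that in \<open>simp add: unit_cube_def\<close>)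
    then have "(\<Sum>i\<in>UNIV. \<bar>P \<theta> $ i\<bar>) \<le> (\<Sum>i\<in>UNIV. M i)" by (intro sum_mono)
    with norm_le_l1_cart[of "P \<theta>"] show ?thesis by linarith
  qed
  then show ?thesis by (intro boundedI[of _ "\<Sum>i\<in>UNIV. M i"]) auto
qed

text \<open>The local left inverse is analytic, hence Lipschitz near the image point; its Lipschitz
  constant is the constant \<open>C\<close> sought.\<close>

lemma locally_injective_analytic:
  fixes P :: "real ^ 'm::finite \<Rightarrow> real ^ 'n::finite"
  assumes P: "\<And>i. real_analytic_at (\<lambda>\<theta>. P \<theta> $ i) \<theta>0"
    and P': "(P has_derivative P') (at \<theta>0)" and inj: "inj P'"
  obtains e C where "e > 0" "C > 0"
    "\<And>\<theta> \<theta>'. norm (\<theta> - \<theta>0) < e \<Longrightarrow> norm (\<theta>' - \<theta>0) < e \<Longrightarrow> norm (\<theta> - \<theta>') \<le> C * norm (P \<theta> - P \<theta>')"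
proof -
  obtain L where L: "\<And>i. real_analytic_at (\<lambda>y. L y $ i) (P \<theta>0)" "\<forall>\<^sub>F \<theta> in nhds \<theta>0. L (P \<theta>) = \<theta>"
    by (rule analytic_left_inverse[OF P P' inj]) blast
  have "\<forall>i. \<exists>e C. e > 0 \<and> C \<ge> 0 \<and>
     (\<forall>x y. norm (x - P \<theta>0) \<le> e \<longrightarrow> norm (y - P \<theta>0) \<le> e \<longrightarrow> \<bar>L x $ i - L y $ i\<bar> \<le> C * norm (x - y))"
    by (intro allI) (rule real_analytic_at_locally_lipschitz[OF L(1)], blast)
  then obtain e C where e: "\<And>i. e i > 0" and C: "\<And>i. C i \<ge> 0"
    and lip: "\<And>i x y. norm (x - P \<theta>0) \<le> e i \<Longrightarrow> norm (y - P \<theta>0) \<le> e i \<Longrightarrow> \<bar>L x $ i - L y $ i\<bar> \<le> C i * norm (x - y)"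
    by metis
  define \<epsilon> where "\<epsilon> = Min (range e)"
  have \<epsilon>: "\<epsilon> > 0" "\<And>i. \<epsilon> \<le> e i" using e by (auto simp: \<epsilon>_def)
  have "(P \<longlongrightarrow> P \<theta>0) (nhds \<theta>0)"
    using has_derivative_continuous[OF P'] unfolding continuous_at tendsto_at_iff_tendsto_nhds .
  then have "\<forall>\<^sub>F \<theta> in nhds \<theta>0. dist (P \<theta>) (P \<theta>0) < \<epsilon>"
    using \<epsilon>(1) unfolding tendsto_iff by blast
  with L(2) have "\<forall>\<^sub>F \<theta> in nhds \<theta>0. L (P \<theta>) = \<theta> \<and> dist (P \<theta>) (P \<theta>0) < \<epsilon>"
    by eventually_elim simp
  then obtain d where d: "d > 0" "\<And>\<theta>. dist \<theta> \<theta>0 < d \<Longrightarrow> L (P \<theta>) = \<theta> \<and> dist (P \<theta>) (P \<theta>0) < \<epsilon>"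
    unfolding eventually_nhds_metric by blast
  define D where "D = (\<Sum>i\<in>UNIV. C i) + 1"
  have "norm (\<theta> - \<theta>') \<le> D * norm (P \<theta> - P \<theta>')" if "norm (\<theta> - \<theta>0) < d" "norm (\<theta>' - \<theta>0) < d" for \<theta> \<theta>'
  proof -
    have h: "L (P \<theta>) = \<theta>" "L (P \<theta>') = \<theta>'" "norm (P \<theta> - P \<theta>0) < \<epsilon>" "norm (P \<theta>' - P \<theta>0) < \<epsilon>"
      using d(2)[of \<theta>] d(2)[of \<theta>'] that by (auto simp: dist_norm)
    have "\<bar>(\<theta> - \<theta>') $ i\<bar> \<le> C i * norm (P \<theta> - P \<theta>')" for i
    proof -
      have "norm (P \<theta> - P \<theta>0) \<le> e i" "norm (P \<theta>' - P \<theta>0) \<le> e i" using h(3,4) \<epsilon>(2)[of i] by linarith+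
      from lip[OF this] show ?thesis by (simp add: h)
    qed
    then have "(\<Sum>i\<in>UNIV. \<bar>(\<theta> - \<theta>') $ i\<bar>) \<le> (\<Sum>i\<in>UNIV. C i * norm (P \<theta> - P \<theta>'))" by (intro sum_mono)
    then have "norm (\<theta> - \<theta>') \<le> (\<Sum>i\<in>UNIV. C i) * norm (P \<theta> - P \<theta>')"
      using norm_le_l1_cart[of "\<theta> - \<theta>'"] by (simp add: sum_distrib_right)
    also have "\<dots> \<le> D * norm (P \<theta> - P \<theta>')" unfolding D_def by (intro mult_right_mono) auto
    finally show ?thesis .
  qed
  moreover have "D > 0" unfolding D_def using C by (simp add: sum_nonneg add_nonneg_pos)
  ultimately show thesis using d(1) by (intro that)
qed

lemma norm_diag_flow_ge:
  assumes "\<And>j. \<nu> \<le> lam j" "s \<ge> 0"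
  shows "exp (\<nu> * s) * norm \<theta> \<le> norm (diag_flow lam s \<theta>)"
proof -
  have "norm (exp (\<nu> * s) *\<^sub>R \<theta>) \<le> norm (diag_flow lam s \<theta>)"
  proof (rule norm_le_componentwise_cart)
    fix j
    have "exp (\<nu> * s) * \<bar>\<theta> $ j\<bar> \<le> exp (lam j * s) * \<bar>\<theta> $ j\<bar>"
      using assms by (intro mult_right_mono) (auto intro: mult_right_mono)
    then show "norm ((exp (\<nu> * s) *\<^sub>R \<theta>) $ j) \<le> norm (diag_flow lam s \<theta> $ j)"
      by (simp add: diag_flow_def abs_mult)
  qed
  then show ?thesis by simp
qed

lemma diag_flow_diff: "diag_flow lam s \<theta> - diag_flow lam s \<theta>' = diag_flow lam s (\<theta> - \<theta>')"
  by (simp add: diag_flow_def vec_eq_iff algebra_simps)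

text \<open>Near the fixed point the inverse function theorem applies; the flow contracts the whole cube
  into that neighbourhood in finite time, and Gronwall's inequality carries the estimate back.\<close>

lemma stable_parameterization_expanding:
  fixes P :: "real ^ 'm::finite \<Rightarrow> real ^ 'n::finite"
  assumes g: "polynomial_function g" and param: "stable_parameterization g p lam \<xi> a P"
    and lam: "\<And>j. lam j < 0" and inj: "inj (\<lambda>v. \<Sum>j\<in>UNIV. v $ j *\<^sub>R \<xi> j)"
  obtains c where "c > 0"
    "\<And>\<theta> \<theta>'. \<theta> \<in> unit_cube \<Longrightarrow> \<theta>' \<in> unit_cube \<Longrightarrow> c * norm (\<theta> - \<theta>') \<le> norm (P \<theta> - P \<theta>')"
proof -
  obtain M where M: "\<And>i. power_series_bound 0 1 (\<lambda>\<theta>. P \<theta> $ i) (M i)"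
    by (rule stable_parameterization_power_series[OF param]) blast
  have an: "real_analytic_at (\<lambda>\<theta>. P \<theta> $ i) 0" for i
    by (rule power_series_bound_imp_real_analytic_at[OF M]) auto
  have der: "(P has_derivative (\<lambda>v. \<Sum>j\<in>UNIV. v $ j *\<^sub>R \<xi> j)) (at 0)"
    using param by (simp add: stable_parameterization_def)
  obtain e C where e: "e > 0" and C: "C > 0"
    and near: "\<And>\<theta> \<theta>'. norm (\<theta> - 0) < e \<Longrightarrow> norm (\<theta>' - 0) < e \<Longrightarrow> norm (\<theta> - \<theta>') \<le> C * norm (P \<theta> - P \<theta>')"
    by (rule locally_injective_analytic[OF an der inj]) blast
  obtain L where L: "L \<ge> 0" "\<And>x y. x \<in> P ` unit_cube \<Longrightarrow> y \<in> P ` unit_cube \<Longrightarrow> norm (g x - g y) \<le> L * norm (x - y)"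
    by (rule polynomial_function_lipschitz[OF g bounded_if_power_series_bound[OF M]]) blast
  \<comment> \<open>The vector of ones dominates every point of the cube coordinatewise, so one time
    \<open>T\<close> brings the whole cube into the ball of radius \<open>e\<close>.\<close>
  have "((\<lambda>s. norm (diag_flow lam s (\<chi> j. 1))) \<longlongrightarrow> 0) at_top"
    by (rule tendsto_norm_zero[OF diag_flow_tendsto_0[where lam = lam, OF lam]])
  then have "\<forall>\<^sub>F s in at_top. norm (diag_flow lam s (\<chi> j. 1)) < e"
    using e by (simp add: order_tendstoD)
  then have "\<forall>\<^sub>F s in at_top. norm (diag_flow lam s (\<chi> j. 1)) < e \<and> s \<ge> 0"
    using eventually_ge_at_top[of 0] by eventually_elim simp
  then obtain T where T: "norm (diag_flow lam T (\<chi> j. 1)) < e" "T \<ge> 0"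
    using eventually_happens'[OF trivial_limit_at_top_linorder] by blast
  have small: "norm (diag_flow lam T \<theta> - 0) < e" if "\<theta> \<in> unit_cube" for \<theta>
  proof -
    have "norm (diag_flow lam T \<theta>) \<le> norm (diag_flow lam T (\<chi> j. 1))"
      by (rule norm_le_componentwise_cart) (use that in \<open>simp add: diag_flow_def unit_cube_def abs_mult\<close>)
    with T show ?thesis by simp
  qed
  define \<nu> where "\<nu> = Min (range lam)"
  have \<nu>: "\<nu> \<le> lam j" for j by (simp add: \<nu>_def)
  \<comment> \<open>The three factors: the least contraction of distances by the linear flow up to
    time \<open>T\<close>, the constant of the local estimate, and the Gronwall growth over
    [0, T].\<close>
  define c where "c = exp (\<nu> * T) * inverse C * exp (- L * T)"
  have "c * norm (\<theta> - \<theta>') \<le> norm (P \<theta> - P \<theta>')" if \<theta>: "\<theta> \<in> unit_cube" and \<theta>': "\<theta>' \<in> unit_cube" for \<theta> \<theta>'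
  proof -
    have sol: "((\<lambda>s. P (diag_flow lam s \<eta>)) has_vector_derivative g (P (diag_flow lam s \<eta>))) (at s within {0..T})"
      if "\<eta> \<in> unit_cube" "s \<in> {0..T}" for \<eta> s
      by (rule has_vector_derivative_within_subset[OF stable_parameterization_solution[OF g param that(1)]])
         (use that in auto)
    have cube: "P (diag_flow lam s \<eta>) \<in> P ` unit_cube" if "\<eta> \<in> unit_cube" "s \<in> {0..T}" for \<eta> s
      using diag_flow_in_unit_cube[where lam = lam, OF lam] that by auto
    have "norm (P (diag_flow lam T \<theta>) - P (diag_flow lam T \<theta>'))
        \<le> exp (L * (T - 0)) * norm (P (diag_flow lam 0 \<theta>) - P (diag_flow lam 0 \<theta>'))"
      by (rule ode_gronwall[where g = g and X = "\<lambda>s. P (diag_flow lam s \<theta>)" and Y = "\<lambda>s. P (diag_flow lam s \<theta>')"])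
         (use T(2) sol[OF \<theta>] sol[OF \<theta>'] L(2)[OF cube[OF \<theta>] cube[OF \<theta>']] in auto)
    then have 1: "norm (P (diag_flow lam T \<theta>) - P (diag_flow lam T \<theta>')) \<le> exp (L * T) * norm (P \<theta> - P \<theta>')"
      by simp
    have "exp (\<nu> * T) * norm (\<theta> - \<theta>') \<le> norm (diag_flow lam T \<theta> - diag_flow lam T \<theta>')"
      unfolding diag_flow_diff by (rule norm_diag_flow_ge[where lam = lam, OF \<nu> T(2)])
    also have "\<dots> \<le> C * norm (P (diag_flow lam T \<theta>) - P (diag_flow lam T \<theta>'))"
      by (rule near[OF small[OF \<theta>] small[OF \<theta>']])
    also have "\<dots> \<le> C * (exp (L * T) * norm (P \<theta> - P \<theta>'))" using 1 C by (intro mult_left_mono) auto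
    finally have "(inverse C * exp (- L * T)) * (exp (\<nu> * T) * norm (\<theta> - \<theta>'))
        \<le> (inverse C * exp (- L * T)) * (C * (exp (L * T) * norm (P \<theta> - P \<theta>')))"
      using C by (intro mult_left_mono) auto
    also have "\<dots> = norm (P \<theta> - P \<theta>')" using C by (simp add: exp_minus field_simps)
    finally show ?thesis unfolding c_def by (simp add: mult_ac)
  qed
  moreover have "c > 0" using C by (simp add: c_def)
  ultimately show thesis by (intro that)
qed

text \<open>In the direction of a kernel vector \<open>P\<close> would move by o(t), against the
  lower bound proportional to t; the error level c / 2 already gives the contradiction.\<close>

lemma expanding_imp_derivative_injective:
  fixes P :: "'a::real_normed_vector \<Rightarrow> 'b::real_normed_vector"
  assumes P': "(P has_derivative P') (at \<theta>0)" and c: "c > 0"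
    and ev: "\<forall>\<^sub>F \<theta> in nhds \<theta>0. c * norm (\<theta> - \<theta>0) \<le> norm (P \<theta> - P \<theta>0)"
  shows "inj P'"
proof -
  have lin: "linear P'" using P' has_derivative_linear by blast
  have "v = 0" if v: "P' v = 0" for v
  proof (rule ccontr)
    assume nz: "v \<noteq> 0"
    from P' have "\<forall>e>0. \<exists>d>0. \<forall>y. norm (y - \<theta>0) < d \<longrightarrow> norm (P y - P \<theta>0 - P' (y - \<theta>0)) \<le> e * norm (y - \<theta>0)"
      unfolding has_derivative_at_alt by blast
    then obtain d where d: "d > 0" "\<And>y. norm (y - \<theta>0) < d \<Longrightarrow> norm (P y - P \<theta>0 - P' (y - \<theta>0)) \<le> c / 2 * norm (y - \<theta>0)"
      using c half_gt_zero by blast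
    obtain d' where d': "d' > 0" "\<And>\<theta>. dist \<theta> \<theta>0 < d' \<Longrightarrow> c * norm (\<theta> - \<theta>0) \<le> norm (P \<theta> - P \<theta>0)"
      using ev unfolding eventually_nhds_metric by blast
    define t where "t = min d d' / (2 * norm v)"
    have t: "t > 0" using d d' nz by (simp add: t_def)
    define y where "y = \<theta>0 + t *\<^sub>R v"
    have y: "norm (y - \<theta>0) = min d d' / 2" using t nz d d' by (simp add: y_def t_def)
    have "P' (y - \<theta>0) = 0" using v linear_scale[OF lin] by (simp add: y_def)
    moreover have lt: "norm (y - \<theta>0) < d" "norm (y - \<theta>0) < d'"
      using y d(1) d'(1) by (auto simp: min_def split: if_splits)
    ultimately have "norm (P y - P \<theta>0) \<le> c / 2 * norm (y - \<theta>0)" using d(2)[of y] by simp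
    moreover have "c * norm (y - \<theta>0) \<le> norm (P y - P \<theta>0)"
      using d'(2)[of y] lt by (simp add: dist_norm)
    moreover have "c * norm (y - \<theta>0) > 0" unfolding y using c d(1) d'(1) by simp
    ultimately show False by linarith
  qed
  then show ?thesis using linear_injective_0[OF lin] by blast
qed

section \<open>The three charts\<close>

text \<open>A polynomial defining function of the horizon: for admissible data it is positive
  exactly on the image domain and 0 on the horizon. Unlike \<open>pfun\<close> it involves no
  roots.\<close>

fun weight :: "'n::finite compactification \<Rightarrow> real ^ 'n \<Rightarrow> real" where
  "weight (Directional d) x = x $ d"
| "weight (Poincare \<beta> c) x = 1 - (\<Sum>i\<in>UNIV. (x $ i) ^ (2 * \<beta> i))"
| "weight (Parabolic \<beta> c) x = 1 - (\<Sum>i\<in>UNIV. (x $ i) ^ (2 * \<beta> i))"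

text \<open>The scaling factor \<open>\<kappa>\<close> of a point of the image domain satisfies \<open>weight = \<kappa> ^ (- weight_exp)\<close>.
  In the directional chart \<open>\<kappa> = 1 / s\<close>.\<close>

fun weight_exp :: "'n::finite compactification \<Rightarrow> nat" where
  "weight_exp (Directional d) = 1"
| "weight_exp (Poincare \<beta> c) = 2 * c"
| "weight_exp (Parabolic \<beta> c) = 1"

definition scaling :: "'n::finite compactification \<Rightarrow> real ^ 'n \<Rightarrow> real" where
  "scaling K x = weight K x powr (- 1 / real (weight_exp K))"

text \<open>The base point on the quasi-homogeneous curve through the original point y, which is its
  rescaling by \<kappa>. The directional chart uses the slice on which coordinate \<open>d\<close>
  is 1.\<close>

fun chart_point :: "'n::finite compactification \<Rightarrow> real ^ 'n \<Rightarrow> real ^ 'n" where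
  "chart_point (Directional d) x = (\<chi> i. if i = d then 1 else x $ i)"
| "chart_point (Poincare \<beta> c) x = x"
| "chart_point (Parabolic \<beta> c) x = x"

definition tinv :: "('n::finite \<Rightarrow> nat) \<Rightarrow> 'n compactification \<Rightarrow> real ^ 'n \<Rightarrow> real ^ 'n" where
  "tinv \<alpha> K x = qscale \<alpha> (scaling K x) (chart_point K x)"

text \<open>The factor by which \<open>h\<close> deviates from \<kappa>^(- k); only the parabolic
  time change has one.\<close>

fun time_factor :: "'n::finite compactification \<Rightarrow> real ^ 'n \<Rightarrow> real" where
  "time_factor (Directional d) x = 1"
| "time_factor (Poincare \<beta> c) x = 1"
| "time_factor (Parabolic \<beta> c) x = 1 - (2 * real c - 1) / (2 * real c) * weight (Parabolic \<beta> c) x"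

text \<open>The logarithmic derivative of \<kappa> along the desingularized field.\<close>

fun radial_rate :: "('n::finite \<Rightarrow> nat) \<Rightarrow> 'n compactification \<Rightarrow> real ^ 'n \<Rightarrow> real ^ 'n \<Rightarrow> real" where
  "radial_rate \<alpha> (Directional d) x F = F $ d / real (\<alpha> d)"
| "radial_rate \<alpha> (Poincare \<beta> c) x F = (\<Sum>j\<in>UNIV. (x $ j) ^ (2 * \<beta> j - 1) / real (\<alpha> j) * F $ j)"
| "radial_rate \<alpha> (Parabolic \<beta> c) x F = (\<Sum>j\<in>UNIV. (x $ j) ^ (2 * \<beta> j - 1) / real (\<alpha> j) * F $ j)"

text \<open>\<open>hfun\<close> with the real power replaced by a natural one. In the Poincare case
  this is where divisibility of \<open>k\<close> by \<open>2 * c\<close> enters: the quotient is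
  then an exact exponent.\<close>

fun hpoly :: "nat \<Rightarrow> 'n::finite compactification \<Rightarrow> real ^ 'n \<Rightarrow> real" where
  "hpoly k (Directional d) x = (x $ d) ^ k"
| "hpoly k (Poincare \<beta> c) x = weight (Poincare \<beta> c) x ^ (k div (2 * c))"
| "hpoly k (Parabolic \<beta> c) x = time_factor (Parabolic \<beta> c) x * weight (Parabolic \<beta> c) x ^ k"

section \<open>Weight, scaling factor and time change\<close>

lemma pfun_power:
  assumes "c \<ge> 1"
  shows "pfun \<beta> c x ^ (2 * c) = (\<Sum>i\<in>UNIV. (x $ i) ^ (2 * \<beta> i))"
proof -
  have "(\<Sum>i\<in>UNIV. (x $ i) ^ (2 * \<beta> i)) \<ge> 0" by (intro sum_nonneg) auto
  moreover have "(a powr (1 / (2 * real c))) ^ (2 * c) = a" if "a \<ge> 0" for a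
  proof -
    have "1 / (2 * real c) * real (2 * c) = 1" using assms by simp
    then show ?thesis using assms that powr_power[of a "1 / (2 * real c)" "2 * c"]
      by (cases "a = 0") simp_all
  qed
  ultimately show ?thesis by (simp add: pfun_def)
qed

lemma pfun_nonneg: "pfun \<beta> c x \<ge> 0"
  by (simp add: pfun_def)

lemma image_dom_eq:
  assumes "admissible \<alpha> k K"
  shows "image_dom K = {x. weight K x > 0}"
proof (cases K)
  case (Poincare \<beta> c)
  then have "c \<ge> 1" using assms by simp
  then have "pfun \<beta> c x < 1 \<longleftrightarrow> (\<Sum>i\<in>UNIV. (x $ i) ^ (2 * \<beta> i)) < 1" for x
    using power_less_one_iff[of "pfun \<beta> c x" "2 * c"] pfun_nonneg[of \<beta> c x] pfun_power[of c \<beta> x] by simp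
  then show ?thesis by (simp add: Poincare)
next
  case (Parabolic \<beta> c)
  then have "c \<ge> 1" using assms by simp
  then have "pfun \<beta> c x < 1 \<longleftrightarrow> (\<Sum>i\<in>UNIV. (x $ i) ^ (2 * \<beta> i)) < 1" for x
    using power_less_one_iff[of "pfun \<beta> c x" "2 * c"] pfun_nonneg[of \<beta> c x] pfun_power[of c \<beta> x] by simp
  then show ?thesis by (simp add: Parabolic)
qed simp

lemma weight_exp_pos: "admissible \<alpha> k K \<Longrightarrow> weight_exp K \<ge> 1"
  by (cases K) auto

lemma weight_exp_dvd: "admissible \<alpha> k K \<Longrightarrow> weight_exp K dvd k"
  by (cases K) auto

lemma weight_le_1: "(\<And>d. K \<noteq> Directional d) \<Longrightarrow> weight K x \<le> 1"
  by (cases K) (auto intro!: sum_nonneg)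

lemma scaling_power:
  assumes "admissible \<alpha> k K" "weight K x > 0"
  shows "scaling K x > 0" "scaling K x ^ weight_exp K = inverse (weight K x)"
proof -
  show "scaling K x > 0" using assms by (simp add: scaling_def)
  have "scaling K x ^ weight_exp K = weight K x powr (real (weight_exp K) * (- 1 / real (weight_exp K)))"
    unfolding scaling_def using assms(2) by (simp add: powr_power mult.commute)
  also have "real (weight_exp K) * (- 1 / real (weight_exp K)) = - 1"
    using weight_exp_pos[OF assms(1)] by simp
  also have "weight K x powr (- 1) = inverse (weight K x)"
    using assms(2) by (simp add: powr_minus)
  finally show "scaling K x ^ weight_exp K = inverse (weight K x)" .
qed

lemma time_factor_pos:
  assumes "admissible \<alpha> k K" "weight K x > 0"
  shows "time_factor K x > 0"
proof (cases K)
  case (Parabolic \<beta> c)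
  have c: "c \<ge> 1" using assms Parabolic by simp
  have "weight K x \<le> 1" by (rule weight_le_1) (simp add: Parabolic)
  moreover have "(2 * real c - 1) / (2 * real c) < 1" "(2 * real c - 1) / (2 * real c) \<ge> 0"
    using c by (auto simp: field_simps)
  ultimately have "(2 * real c - 1) / (2 * real c) * weight K x \<le> (2 * real c - 1) / (2 * real c) * 1"
    by (intro mult_left_mono) auto
  with \<open>(2 * real c - 1) / (2 * real c) < 1\<close> show ?thesis unfolding Parabolic by (simp only: time_factor.simps)
qed auto

lemma hfun_eq_hpoly:
  assumes "admissible \<alpha> k K" "k \<ge> 1" "weight K x \<ge> 0"
  shows "hfun k K x = hpoly k K x"
proof (cases K)
  case (Poincare \<beta> c)
  then have c: "c \<ge> 1" "2 * c dvd k" using assms by auto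
  then obtain q where q: "k = 2 * c * q" by auto
  then have q0: "q > 0" using assms by (cases q) auto
  have "real k / (2 * real c) = real q" using q c by simp
  then have "hfun k K x = weight K x powr real q"
    by (simp add: Poincare pfun_power[OF c(1)])
  \<comment> \<open>At weight 0 the real power is 0 whereas \<open>0 ^ 0\<close> would be 1, so
    \<open>q > 0\<close> matters here; it comes from \<open>k \<ge> 1\<close>.\<close>
  also have "\<dots> = weight K x ^ q"
    using assms(3) q0 by (cases "weight K x = 0") (auto simp: powr_realpow)
  finally show ?thesis using q c by (simp add: Poincare)
next
  case (Parabolic \<beta> c)
  then have c: "c \<ge> 1" using assms by auto
  show ?thesis unfolding Parabolic hfun.simps hpoly.simps time_factor.simps weight.simps pfun_power[OF c] ..
qed simp

lemma hfun_eq: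
  assumes "admissible \<alpha> k K" "k \<ge> 1" "weight K x > 0"
  shows "hfun k K x = time_factor K x / scaling K x ^ k"
proof -
  obtain q where q: "k = weight_exp K * q" using weight_exp_dvd[OF assms(1)] by auto
  have "scaling K x ^ k = inverse (weight K x) ^ q"
    unfolding q power_mult using scaling_power(2)[OF assms(1,3)] by simp
  moreover have "hpoly k K x = time_factor K x * weight K x ^ q"
    using q assms(1) by (cases K) auto
  ultimately show ?thesis using hfun_eq_hpoly[OF assms(1,2)] assms(3) by (simp add: power_inverse divide_inverse)
qed

lemma hfun_pos:
  assumes "admissible \<alpha> k K" "k \<ge> 1" "weight K x > 0"
  shows "hfun k K x > 0"
  using hfun_eq[OF assms] time_factor_pos[OF assms(1,3)] scaling_power(1)[OF assms(1,3)] by simp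

lemma horizon_weight:
  assumes "admissible \<alpha> k K" "x \<in> horizon K"
  shows "weight K x = 0"
proof (cases K)
  case (Poincare \<beta> c)
  then show ?thesis using assms pfun_power[of c \<beta> x] by simp
next
  case (Parabolic \<beta> c)
  then show ?thesis using assms pfun_power[of c \<beta> x] by simp
qed (use assms in simp)

lemma hpoly_horizon:
  assumes "admissible \<alpha> k K" "k \<ge> 1" "x \<in> horizon K"
  shows "hpoly k K x = 0"
proof (cases K)
  case (Poincare \<beta> c)
  then have "c \<ge> 1" "2 * c dvd k" using assms by auto
  then have "k div (2 * c) > 0" using assms(2) by (auto elim!: dvdE)
  then show ?thesis using horizon_weight[OF assms(1,3)] Poincare by simp
qed (use horizon_weight[OF assms(1,3)] assms(2) in auto)

lemma power_series_bound_hpoly: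
  fixes P :: "real ^ 'm::finite \<Rightarrow> real ^ 'n::finite"
  assumes "\<And>i. power_series_bound 0 1 (\<lambda>\<theta>. P \<theta> $ i) (M i)"
  shows "\<exists>M'. power_series_bound 0 1 (\<lambda>\<theta>. hpoly k K (P \<theta>)) M'"
proof -
  have w: "\<exists>M'. power_series_bound 0 1 (\<lambda>\<theta>. 1 - (\<Sum>i\<in>UNIV. (P \<theta> $ i) ^ (2 * \<beta> i))) M'" for \<beta>
  proof -
    have "power_series_bound 0 1 (\<lambda>\<theta>. \<Sum>i\<in>UNIV. (P \<theta> $ i) ^ (2 * \<beta> i)) (\<Sum>i\<in>UNIV. M i ^ (2 * \<beta> i))"
      by (rule power_series_bound_sum[OF finite zero_less_one power_series_bound_power[OF zero_less_one assms]])
    from power_series_bound_diff[OF zero_less_one power_series_bound_const[OF order_refl zero_less_one, of 1] this]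
    show ?thesis by blast
  qed
  show ?thesis
  proof (cases K)
    case (Directional d)
    then show ?thesis using power_series_bound_power[OF zero_less_one assms] by auto
  next
    case (Poincare \<beta> c)
    obtain M' where "power_series_bound 0 1 (\<lambda>\<theta>. weight K (P \<theta>)) M'"
      using w[of \<beta>] by (auto simp: Poincare)
    from power_series_bound_power[OF zero_less_one this] show ?thesis using Poincare by auto
  next
    case (Parabolic \<beta> c)
    obtain M' where M': "power_series_bound 0 1 (\<lambda>\<theta>. weight K (P \<theta>)) M'"
      using w[of \<beta>] by (auto simp: Parabolic)
    have "\<exists>M'. power_series_bound 0 1 (\<lambda>\<theta>. (1 - (2 * real c - 1) / (2 * real c) * weight K (P \<theta>)) * weight K (P \<theta>) ^ k) M'"
      using power_series_bound_mult0[OF zero_less_one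
          power_series_bound_diff[OF zero_less_one power_series_bound_const[OF order_refl zero_less_one]
            power_series_bound_cmult[OF zero_less_one M']]
          power_series_bound_power[OF zero_less_one M']]
      by blast
    then show ?thesis by (simp only: Parabolic hpoly.simps time_factor.simps)
  qed
qed

lemma continuous_weight: "isCont (weight K) x"
proof (cases K)
  case (Directional d)
  then have "weight K = (\<lambda>x. x $ d)" by auto
  then show ?thesis by (auto intro!: continuous_intros)
next
  case (Poincare \<beta> c)
  then have "weight K = (\<lambda>x. 1 - (\<Sum>i\<in>UNIV. (x $ i) ^ (2 * \<beta> i)))" by auto
  then show ?thesis by (auto intro!: continuous_intros)
next
  case (Parabolic \<beta> c)
  then have "weight K = (\<lambda>x. 1 - (\<Sum>i\<in>UNIV. (x $ i) ^ (2 * \<beta> i)))" by auto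
  then show ?thesis by (auto intro!: continuous_intros)
qed

section \<open>Velocities in the charts\<close>

lemma rescaled_field_eq:
  assumes "admissible \<alpha> k K" "weight K x > 0"
  shows "rescaled_field \<alpha> k K f x $ j = inverse (scaling K x ^ (k + \<alpha> j)) * f (tinv \<alpha> K x) $ j"
proof (cases K)
  case (Directional d)
  have s: "scaling K x = inverse (x $ d)"
    using assms(2) by (simp add: scaling_def Directional powr_minus)
  have "(\<chi> i. if i = d then inverse ((x $ d) ^ \<alpha> i) else inverse ((x $ d) ^ \<alpha> i) * x $ i) = tinv \<alpha> K x"
    using s by (simp add: tinv_def qscale_def Directional vec_eq_iff power_inverse)
  then show ?thesis
    using s assms(2) by (simp add: Directional Let_def power_inverse)
next
  case (Poincare \<beta> c)
  then have c: "c \<ge> 1" using assms by simp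
  have "(1 - pfun \<beta> c x ^ (2 * c)) powr (- 1 / (2 * real c)) = scaling K x"
    by (simp add: scaling_def Poincare pfun_power[OF c])
  then show ?thesis by (simp add: Poincare tinv_def Let_def)
next
  case (Parabolic \<beta> c)
  then have c: "c \<ge> 1" using assms by simp
  have "inverse (1 - pfun \<beta> c x ^ (2 * c)) = scaling K x"
    using assms(2) by (simp add: scaling_def Parabolic pfun_power[OF c] powr_minus)
  then show ?thesis by (simp add: Parabolic tinv_def Let_def)
qed

text \<open>The computation shared by the two radial charts, with \<open>m\<close> as time factor.
  Since \<open>\<alpha> i * \<beta> i = c\<close> for all i, every summand carries the same factor 2
  c, and the terms with \<open>F\<close> add up to \<open>G\<close> again.\<close>

lemma radial_weight_velocity:
  fixes X :: "real \<Rightarrow> real ^ 'n::finite"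
  assumes c: "c \<ge> 1" "\<And>i. \<alpha> i * \<beta> i = c"
    and X: "\<And>i. ((\<lambda>t. X t $ i) has_real_derivative m * F i - real (\<alpha> i) * X t $ i * G) (at t within S)"
    and G: "G = (\<Sum>j\<in>UNIV. (X t $ j) ^ (2 * \<beta> j - 1) / real (\<alpha> j) * F j)"
  shows "((\<lambda>t. 1 - (\<Sum>i\<in>UNIV. (X t $ i) ^ (2 * \<beta> i))) has_real_derivative
    - 2 * real c * G * (m - (\<Sum>i\<in>UNIV. (X t $ i) ^ (2 * \<beta> i)))) (at t within S)"
proof -
  have pos: "\<alpha> i \<ge> 1" "\<beta> i \<ge> 1" for i
    using c(2)[of i] c(1) by (metis mult_0 One_nat_def Suc_leI gr0I not_one_le_zero,
      metis mult_0_right One_nat_def Suc_leI gr0I not_one_le_zero)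
  have pw: "x ^ (2 * \<beta> i - 1) * x = x ^ (2 * \<beta> i)" for x :: real and i
  proof -
    obtain b where "2 * \<beta> i = Suc b" using pos(2)[of i] by (cases "2 * \<beta> i") auto
    then show ?thesis by simp
  qed
  have ab: "real (\<alpha> i) * real (\<beta> i) = real c" for i
    using c(2)[of i] by (simp flip: of_nat_mult)
  have "((\<lambda>t. (X t $ i) ^ (2 * \<beta> i)) has_real_derivative
      2 * real c * (m * ((X t $ i) ^ (2 * \<beta> i - 1) / real (\<alpha> i) * F i) - (X t $ i) ^ (2 * \<beta> i) * G)) (at t within S)" for i
  proof -
    have "((\<lambda>t. (X t $ i) ^ (2 * \<beta> i)) has_real_derivative
       real (2 * \<beta> i) * (X t $ i) ^ (2 * \<beta> i - 1) * (m * F i - real (\<alpha> i) * X t $ i * G)) (at t within S)"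
      using DERIV_power[OF X[of i], of "2 * \<beta> i"] by (simp add: mult_ac)
    moreover have "real (2 * \<beta> i) * (X t $ i) ^ (2 * \<beta> i - 1) * (m * F i - real (\<alpha> i) * X t $ i * G)
       = 2 * real c * (m * ((X t $ i) ^ (2 * \<beta> i - 1) / real (\<alpha> i) * F i) - (X t $ i) ^ (2 * \<beta> i) * G)"
      unfolding ab[of i, symmetric] pw[symmetric] using pos(1)[of i] by (simp add: field_simps)
    ultimately show ?thesis by (rule DERIV_cong)
  qed
  then have "((\<lambda>t. 1 - (\<Sum>i\<in>UNIV. (X t $ i) ^ (2 * \<beta> i))) has_real_derivative
      0 - (\<Sum>i\<in>UNIV. 2 * real c * (m * ((X t $ i) ^ (2 * \<beta> i - 1) / real (\<alpha> i) * F i) - (X t $ i) ^ (2 * \<beta> i) * G))) (at t within S)"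
    by (intro DERIV_diff DERIV_const DERIV_sum)
  moreover have "0 - (\<Sum>i\<in>UNIV. 2 * real c * (m * ((X t $ i) ^ (2 * \<beta> i - 1) / real (\<alpha> i) * F i) - (X t $ i) ^ (2 * \<beta> i) * G))
     = - 2 * real c * G * (m - (\<Sum>i\<in>UNIV. (X t $ i) ^ (2 * \<beta> i)))"
    unfolding sum_distrib_left[symmetric] sum_subtractf sum_distrib_right[symmetric] G[symmetric]
    by (simp add: algebra_simps)
  ultimately show ?thesis by simp
qed

text \<open>In the directional chart the constant coordinate \<open>1\<close> of \<open>chart_point\<close> obeys the same equation as
  the others, which gives all three fields a common form.\<close>

lemma chart_velocity:
  fixes X :: "real \<Rightarrow> real ^ 'n::finite"
  assumes \<alpha>: "\<And>i. \<alpha> i \<ge> 1" and K: "admissible \<alpha> k K"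
    and X: "(X has_vector_derivative desing_field \<alpha> k K f (X t)) (at t within S)"
  defines "F \<equiv> rescaled_field \<alpha> k K f (X t)"
  defines "G \<equiv> radial_rate \<alpha> K (X t) F"
  shows "((\<lambda>t. chart_point K (X t) $ i) has_real_derivative
      time_factor K (X t) * F $ i - real (\<alpha> i) * chart_point K (X t) $ i * G) (at t within S)"
    and "((\<lambda>t. weight K (X t)) has_real_derivative - real (weight_exp K) * weight K (X t) * G) (at t within S)"
proof -
  have Xi: "((\<lambda>t. X t $ i) has_real_derivative desing_field \<alpha> k K f (X t) $ i) (at t within S)" for i
    unfolding has_real_derivative_iff_has_vector_derivative
    by (rule bounded_linear.has_vector_derivative[OF bounded_linear_vec_nth X])
  have "((\<lambda>t. chart_point K (X t) $ i) has_real_derivative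
      time_factor K (X t) * F $ i - real (\<alpha> i) * chart_point K (X t) $ i * G) (at t within S) \<and>
    ((\<lambda>t. weight K (X t)) has_real_derivative - real (weight_exp K) * weight K (X t) * G) (at t within S)"
  proof (cases K)
    case (Directional d)
    have "real (\<alpha> d) \<noteq> 0" using \<alpha>[of d] by simp
    then show ?thesis using Xi[of i] Xi[of d]
      by (cases "i = d") (simp_all add: Directional F_def G_def Let_def mult_ac)
  next
    case (Poincare \<beta> c)
    have c: "c \<ge> 1" "\<And>i. \<alpha> i * \<beta> i = c" using K Poincare by auto
    have V: "desing_field \<alpha> k K f (X t) $ i = 1 * F $ i - real (\<alpha> i) * X t $ i * G" for i
      by (simp add: Poincare F_def G_def Let_def)
    have "((\<lambda>t. weight K (X t)) has_real_derivative - 2 * real c * G * (1 - (\<Sum>i\<in>UNIV. (X t $ i) ^ (2 * \<beta> i)))) (at t within S)"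
      unfolding Poincare weight.simps
      by (rule radial_weight_velocity[where \<alpha> = \<alpha> and F = "\<lambda>i. F $ i", OF c Xi[unfolded V]])
         (simp add: G_def Poincare)
    then show ?thesis using Xi[of i, unfolded V] by (simp add: Poincare mult_ac)
  next
    case (Parabolic \<beta> c)
    have c: "c \<ge> 1" "\<And>i. \<alpha> i * \<beta> i = c" using K Parabolic by auto
    have V: "desing_field \<alpha> k K f (X t) $ i = time_factor K (X t) * F $ i - real (\<alpha> i) * X t $ i * G" for i
      by (simp add: Parabolic F_def G_def Let_def pfun_power[OF c(1)])
    have "((\<lambda>t. weight K (X t)) has_real_derivative - 2 * real c * G * (time_factor K (X t) - (\<Sum>i\<in>UNIV. (X t $ i) ^ (2 * \<beta> i)))) (at t within S)"
      unfolding Parabolic weight.simps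
      by (rule radial_weight_velocity[where \<alpha> = \<alpha> and F = "\<lambda>i. F $ i", OF c Xi[unfolded V, unfolded Parabolic]])
         (simp add: G_def Parabolic)
    moreover have "- 2 * real c * G * (time_factor K (X t) - (\<Sum>i\<in>UNIV. (X t $ i) ^ (2 * \<beta> i))) = - real (weight_exp K) * weight K (X t) * G"
    proof -
      define w where "w = weight K (X t)"
      have "(\<Sum>i\<in>UNIV. (X t $ i) ^ (2 * \<beta> i)) = 1 - w" by (simp add: w_def Parabolic)
      moreover have "time_factor K (X t) = 1 - (2 * real c - 1) / (2 * real c) * w"
        unfolding w_def Parabolic by (rule time_factor.simps)
      \<comment> \<open>The parabolic time factor is made for this: it exceeds 1 - w by exactly w /
        (2 c), so the factor 2 c cancels and the weight exponent is 1.\<close>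
      moreover have "- 2 * real c * G * ((1 - (2 * real c - 1) / (2 * real c) * w) - (1 - w)) = - real 1 * w * G"
        using c(1) by (simp add: field_simps)
      ultimately show ?thesis unfolding w_def[symmetric] by (simp only: Parabolic weight_exp.simps)
    qed
    ultimately show ?thesis using Xi[of i, unfolded V] by (simp add: Parabolic)
  qed
  then show "((\<lambda>t. chart_point K (X t) $ i) has_real_derivative
      time_factor K (X t) * F $ i - real (\<alpha> i) * chart_point K (X t) $ i * G) (at t within S)"
    and "((\<lambda>t. weight K (X t)) has_real_derivative - real (weight_exp K) * weight K (X t) * G) (at t within S)"
    by blast+
qed

lemma scaling_velocity:
  fixes X :: "real \<Rightarrow> real ^ 'n::finite"
  assumes \<alpha>: "\<And>i. \<alpha> i \<ge> 1" and K: "admissible \<alpha> k K" and w: "weight K (X t) > 0"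
    and X: "(X has_vector_derivative desing_field \<alpha> k K f (X t)) (at t within S)"
  shows "((\<lambda>t. scaling K (X t)) has_real_derivative
     scaling K (X t) * radial_rate \<alpha> K (X t) (rescaled_field \<alpha> k K f (X t))) (at t within S)"
proof -
  define G where "G = radial_rate \<alpha> K (X t) (rescaled_field \<alpha> k K f (X t))"
  define e where "e = real (weight_exp K)"
  have e: "e > 0" using weight_exp_pos[OF K] by (simp add: e_def)
  have "((\<lambda>t. weight K (X t)) has_real_derivative - e * weight K (X t) * G) (at t within S)"
    using chart_velocity(2)[where \<alpha> = \<alpha>, OF \<alpha> K X] by (simp add: G_def e_def)
  from DERIV_chain'[OF this has_real_derivative_powr[OF w, of "- 1 / e"]]
  have "((\<lambda>t. weight K (X t) powr (- 1 / e)) has_real_derivative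
      (- 1 / e * weight K (X t) powr (- 1 / e - 1)) * (- e * weight K (X t) * G)) (at t within S)" .
  moreover have "(- 1 / e * weight K (X t) powr (- 1 / e - 1)) * (- e * weight K (X t) * G) = weight K (X t) powr (- 1 / e) * G"
    using e w by (simp add: powr_diff)
  ultimately have "((\<lambda>t. weight K (X t) powr (- 1 / e)) has_real_derivative weight K (X t) powr (- 1 / e) * G) (at t within S)"
    by (rule DERIV_cong)
  then show ?thesis by (simp add: scaling_def e_def G_def)
qed

text \<open>Coordinate i is \<kappa>^\<alpha>(i) times that of the chart point. The radial
  contributions of the two factors cancel, and what remains is the rescaled field multiplied by the
  time factor and \<kappa>^\<alpha>(i), that is, h times f.\<close>

lemma tinv_velocity:
  fixes X :: "real \<Rightarrow> real ^ 'n::finite"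
  assumes \<alpha>: "\<And>i. \<alpha> i \<ge> 1" and K: "admissible \<alpha> k K" "k \<ge> 1" and w: "weight K (X t) > 0"
    and X: "(X has_vector_derivative desing_field \<alpha> k K f (X t)) (at t within S)"
  shows "((\<lambda>t. tinv \<alpha> K (X t)) has_vector_derivative hfun k K (X t) *\<^sub>R f (tinv \<alpha> K (X t))) (at t within S)"
proof -
  define F where "F = rescaled_field \<alpha> k K f (X t)"
  define G where "G = radial_rate \<alpha> K (X t) F"
  define \<kappa> where "\<kappa> = scaling K (X t)"
  define m where "m = time_factor K (X t)"
  have \<kappa>: "\<kappa> > 0" using scaling_power(1)[OF K(1) w] by (simp add: \<kappa>_def)
  have "((\<lambda>t. tinv \<alpha> K (X t) $ i) has_real_derivative (hfun k K (X t) *\<^sub>R f (tinv \<alpha> K (X t))) $ i) (at t within S)" for i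
  proof -
    define z where "z = chart_point K (X t) $ i"
    have "((\<lambda>t. scaling K (X t) ^ \<alpha> i) has_real_derivative real (\<alpha> i) * (\<kappa> * G) * \<kappa> ^ (\<alpha> i - 1)) (at t within S)"
      using DERIV_power[OF scaling_velocity[where \<alpha> = \<alpha>, OF \<alpha> K(1) w X], of "\<alpha> i"] by (simp add: F_def G_def \<kappa>_def mult_ac)
    moreover have "\<kappa> * \<kappa> ^ (\<alpha> i - 1) = \<kappa> ^ \<alpha> i"
      using \<alpha>[of i] by (cases "\<alpha> i") auto
    then have "real (\<alpha> i) * (\<kappa> * G) * \<kappa> ^ (\<alpha> i - 1) = real (\<alpha> i) * G * \<kappa> ^ \<alpha> i"
      by (simp add: mult_ac)
    ultimately have "((\<lambda>t. scaling K (X t) ^ \<alpha> i) has_real_derivative real (\<alpha> i) * G * \<kappa> ^ \<alpha> i) (at t within S)"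
      by (rule DERIV_cong)
    moreover have "((\<lambda>t. chart_point K (X t) $ i) has_real_derivative m * F $ i - real (\<alpha> i) * z * G) (at t within S)"
      using chart_velocity(1)[where \<alpha> = \<alpha>, OF \<alpha> K(1) X] by (simp add: F_def G_def m_def z_def)
    ultimately have "((\<lambda>t. scaling K (X t) ^ \<alpha> i * chart_point K (X t) $ i) has_real_derivative
       real (\<alpha> i) * G * \<kappa> ^ \<alpha> i * z + (m * F $ i - real (\<alpha> i) * z * G) * \<kappa> ^ \<alpha> i) (at t within S)"
      unfolding z_def \<kappa>_def by (rule DERIV_mult)
    moreover have "real (\<alpha> i) * G * \<kappa> ^ \<alpha> i * z + (m * F $ i - real (\<alpha> i) * z * G) * \<kappa> ^ \<alpha> i = m * \<kappa> ^ \<alpha> i * F $ i"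
      by (simp add: algebra_simps)
    moreover have "m * \<kappa> ^ \<alpha> i * F $ i = (hfun k K (X t) *\<^sub>R f (tinv \<alpha> K (X t))) $ i"
      unfolding vector_scaleR_component F_def rescaled_field_eq[OF K(1) w] hfun_eq[OF K w] m_def[symmetric] \<kappa>_def[symmetric]
      using \<kappa> by (simp add: power_add field_simps)
    ultimately show ?thesis by (simp add: tinv_def qscale_def)
  qed
  then show ?thesis
    unfolding has_vector_derivative_def has_real_derivative_iff_has_vector_derivative
    by (intro has_derivative_vecI) (simp add: mult.assoc)
qed

section \<open>The scaling factor as a function of the original point\<close>

fun yscaling :: "('n::finite \<Rightarrow> nat) \<Rightarrow> 'n compactification \<Rightarrow> real ^ 'n \<Rightarrow> real" where
  "yscaling \<alpha> (Directional d) y = (y $ d) powr (1 / real (\<alpha> d))"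
| "yscaling \<alpha> (Poincare \<beta> c) y = (1 + pfun \<beta> c y ^ (2 * c)) powr (1 / (2 * real c))"
| "yscaling \<alpha> (Parabolic \<beta> c) y =
     (THE \<kappa>. \<kappa> \<ge> 1 \<and> \<kappa> ^ (2 * c) - \<kappa> ^ (2 * c - 1) = pfun \<beta> c y ^ (2 * c))"

text \<open>\<open>yscaling\<close> is the positive root of \<open>scaling_poly \<alpha> K \<kappa> = scaling_rhs K y\<close>. The exponent
  \<open>2 * c - 2 * c\<close> displays the Poincare equation as \<open>\<kappa> ^ (2 * c) - \<kappa> ^ (2 * c - e)\<close> with
  \<open>e = weight_exp K\<close>, like the parabolic one.\<close>

fun scaling_poly :: "('n::finite \<Rightarrow> nat) \<Rightarrow> 'n compactification \<Rightarrow> real \<Rightarrow> real" where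
  "scaling_poly \<alpha> (Directional d) \<kappa> = \<kappa> ^ \<alpha> d"
| "scaling_poly \<alpha> (Poincare \<beta> c) \<kappa> = \<kappa> ^ (2 * c) - \<kappa> ^ (2 * c - 2 * c)"
| "scaling_poly \<alpha> (Parabolic \<beta> c) \<kappa> = \<kappa> ^ (2 * c) - \<kappa> ^ (2 * c - 1)"

fun scaling_rhs :: "'n::finite compactification \<Rightarrow> real ^ 'n \<Rightarrow> real" where
  "scaling_rhs (Directional d) y = y $ d"
| "scaling_rhs (Poincare \<beta> c) y = (\<Sum>i\<in>UNIV. (y $ i) ^ (2 * \<beta> i))"
| "scaling_rhs (Parabolic \<beta> c) y = (\<Sum>i\<in>UNIV. (y $ i) ^ (2 * \<beta> i))"

lemma radial_root_factor:
  assumes "e \<le> (n::nat)"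
  shows "(u::real) ^ n - u ^ (n - e) = u ^ (n - e) * (u ^ e - 1)"
  using assms by (simp add: algebra_simps flip: power_add)

text \<open>In the factored form u^(n - e) (u^e - 1) both factors are nonnegative and nondecreasing
  on [1, \<infinity>), and the second one is strictly increasing.\<close>

lemma radial_root_strict_mono:
  assumes "1 \<le> e" "e \<le> (n::nat)" "1 \<le> u" "u < (v::real)"
  shows "u ^ n - u ^ (n - e) < v ^ n - v ^ (n - e)"
proof -
  have "u ^ (n - e) * (u ^ e - 1) \<le> v ^ (n - e) * (u ^ e - 1)"
    using assms by (intro mult_right_mono power_mono) auto
  also have "\<dots> < v ^ (n - e) * (v ^ e - 1)"
    using assms by (intro mult_strict_left_mono) (auto intro!: power_strict_mono)
  finally show ?thesis by (simp only: radial_root_factor[OF assms(2)])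
qed

text \<open>Below 1 the expression is negative, so every positive root is at least 1. Uniqueness
  among all positive roots is the form needed later, when a root found by inversion is known only to
  be positive.\<close>

lemma radial_root_unique:
  assumes "1 \<le> e" "e \<le> (n::nat)" "0 < u" "0 < (v::real)" "q \<ge> 0"
    and "u ^ n - u ^ (n - e) = q" "v ^ n - v ^ (n - e) = q"
  shows "u = v"
proof -
  have ge: "x \<ge> 1" if "0 < x" "x ^ n - x ^ (n - e) = q" for x :: real
  proof (rule ccontr)
    assume "\<not> x \<ge> 1"
    then have "x ^ e < 1" using that(1) assms(1) by (intro power_less_one_iff[THEN iffD2]) auto
    then have "x ^ (n - e) * (x ^ e - 1) < 0" using that(1) by (intro mult_pos_neg) auto
    with that(2) assms(5) show False by (simp add: radial_root_factor[OF assms(2)])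
  qed
  have "u \<ge> 1" "v \<ge> 1" using ge assms by blast+
  then show ?thesis
    using radial_root_strict_mono[OF assms(1,2), of u v] radial_root_strict_mono[OF assms(1,2), of v u] assms(6,7)
    by linarith
qed

lemma radial_root_ex:
  assumes "1 \<le> e" "e \<le> (n::nat)" "q \<ge> 0"
  shows "\<exists>u\<ge>1. (u::real) ^ n - u ^ (n - e) = q"
proof -
  define \<phi> where "\<phi> u = u ^ n - u ^ (n - e)" for u :: real
  \<comment> \<open>At u = 1 + q the second factor is at least q and the first at least 1, so the
    value q is reached on [1, 1 + q].\<close>
  have "(1 + q) ^ 1 \<le> (1 + q) ^ e" using assms by (intro power_increasing) auto
  then have "1 * q \<le> (1 + q) ^ (n - e) * ((1 + q) ^ e - 1)"
    using assms one_le_power[of "1 + q"] by (intro mult_mono) auto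
  then have "q \<le> \<phi> (1 + q)" by (simp add: \<phi>_def radial_root_factor[OF assms(2)])
  moreover have "\<phi> 1 \<le> q" using assms by (simp add: \<phi>_def)
  moreover have "continuous_on {1..1 + q} \<phi>" unfolding \<phi>_def by (intro continuous_intros)
  ultimately obtain u where "u \<ge> 1" "\<phi> u = q"
    using IVT'[of \<phi> 1 q "1 + q"] assms(3) by auto
  then show ?thesis by (auto simp: \<phi>_def)
qed

lemma yscaling_root:
  assumes \<alpha>: "\<And>i. \<alpha> i \<ge> 1" and K: "admissible \<alpha> k K" and y: "y \<in> tdom K"
  shows "yscaling \<alpha> K y > 0" "scaling_poly \<alpha> K (yscaling \<alpha> K y) = scaling_rhs K y"
proof -
  have "yscaling \<alpha> K y > 0 \<and> scaling_poly \<alpha> K (yscaling \<alpha> K y) = scaling_rhs K y"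
  proof (cases K)
    case (Directional d)
    have "real (\<alpha> d) \<noteq> 0" using \<alpha>[of d] by simp
    then show ?thesis using y by (simp add: Directional powr_power)
  next
    case (Poincare \<beta> c)
    have c: "c \<ge> 1" using K Poincare by simp
    have "(\<Sum>i\<in>UNIV. (y $ i) ^ (2 * \<beta> i)) \<ge> 0" by (intro sum_nonneg) auto
    then show ?thesis using c by (simp add: Poincare pfun_power[OF c] powr_power)
  next
    case (Parabolic \<beta> c)
    have c: "c \<ge> 1" using K Parabolic by simp
    define q where "q = (\<Sum>i\<in>UNIV. (y $ i) ^ (2 * \<beta> i))"
    have q: "q \<ge> 0" unfolding q_def by (intro sum_nonneg) auto
    obtain u where u: "u \<ge> 1" "u ^ (2 * c) - u ^ (2 * c - 1) = q"
      using radial_root_ex[of 1 "2 * c" q] c q by auto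
    have "yscaling \<alpha> K y = u"
      unfolding Parabolic yscaling.simps pfun_power[OF c] q_def[symmetric]
    proof (rule the_equality)
      show "v = u" if "1 \<le> v \<and> v ^ (2 * c) - v ^ (2 * c - 1) = q" for v
        by (rule radial_root_unique[of 1 "2 * c"]) (use that u c q in auto)
    qed (use u in simp)
    with u show ?thesis by (simp add: Parabolic q_def)
  qed
  then show "yscaling \<alpha> K y > 0" "scaling_poly \<alpha> K (yscaling \<alpha> K y) = scaling_rhs K y" by blast+
qed

lemma yscaling_unique:
  assumes \<alpha>: "\<And>i. \<alpha> i \<ge> 1" and K: "admissible \<alpha> k K" and y: "y \<in> tdom K"
    and u: "u > 0" "scaling_poly \<alpha> K u = scaling_rhs K y"
  shows "u = yscaling \<alpha> K y"
proof -
  note r = yscaling_root[where \<alpha> = \<alpha>, OF \<alpha> K y]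
  show ?thesis
  proof (cases K)
    case (Directional d)
    have "\<alpha> d \<ge> 1" by (rule \<alpha>)
    moreover have "u ^ \<alpha> d = yscaling \<alpha> K y ^ \<alpha> d" using r u by (simp add: Directional)
    ultimately show ?thesis using r(1) u(1) power_eq_imp_eq_base[of u "\<alpha> d" "yscaling \<alpha> K y"] by auto
  next
    case (Poincare \<beta> c)
    show ?thesis
      by (rule radial_root_unique[of "2 * c" "2 * c" _ _ "scaling_rhs K y"])
         (use r u K in \<open>auto simp: Poincare intro: sum_nonneg\<close>)
  next
    case (Parabolic \<beta> c)
    show ?thesis
      by (rule radial_root_unique[of 1 "2 * c" _ _ "scaling_rhs K y"])
         (use r u K in \<open>auto simp: Parabolic intro: sum_nonneg\<close>)
  qed
qed

section \<open>\<open>tmap\<close> and \<open>tinv\<close> are mutually inverse\<close>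

lemma chart_point_tmap:
  assumes \<alpha>: "\<And>i. \<alpha> i \<ge> 1" and K: "admissible \<alpha> k K" and y: "y \<in> tdom K"
  shows "chart_point K (tmap \<alpha> K y) $ i = y $ i / yscaling \<alpha> K y ^ \<alpha> i"
proof (cases K)
  case (Directional d)
  have yd: "y $ d > 0" using y by (simp add: Directional)
  have "real (\<alpha> d) \<noteq> 0" using \<alpha>[of d] by simp
  then have "yscaling \<alpha> K y ^ \<alpha> d = y $ d" using yd by (simp add: Directional powr_power)
  moreover have "(y $ d) powr (- 1 / real (\<alpha> d)) = inverse (yscaling \<alpha> K y)"
    using powr_minus[of "y $ d" "1 / real (\<alpha> d)"] by (simp add: Directional)
  ultimately show ?thesis using yd
    by (simp add: Directional Let_def power_inverse divide_inverse mult.commute)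
qed (simp_all add: Let_def)

text \<open>In the radial charts, dividing the defining equation of \<kappa> by \<kappa>^(2 c) turns
  it into p(x)^(2 c) = 1 - \<kappa>^(- e), with e the weight exponent.\<close>

lemma weight_tmap:
  assumes \<alpha>: "\<And>i. \<alpha> i \<ge> 1" and K: "admissible \<alpha> k K" and y: "y \<in> tdom K"
  shows "weight K (tmap \<alpha> K y) = inverse (yscaling \<alpha> K y ^ weight_exp K)"
proof -
  define \<kappa> where "\<kappa> = yscaling \<alpha> K y"
  have \<kappa>: "\<kappa> > 0" "scaling_poly \<alpha> K \<kappa> = scaling_rhs K y"
    using yscaling_root[where \<alpha> = \<alpha>, OF \<alpha> K y] by (simp_all add: \<kappa>_def)
  have radial: "1 - (\<Sum>i\<in>UNIV. (x $ i) ^ (2 * \<beta> i)) = inverse (\<kappa> ^ e)"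
    if x: "\<And>i. x $ i = y $ i / \<kappa> ^ \<alpha> i" and c: "\<And>i. \<alpha> i * \<beta> i = c"
      and eq: "\<kappa> ^ (2 * c) - \<kappa> ^ (2 * c - e) = (\<Sum>i\<in>UNIV. (y $ i) ^ (2 * \<beta> i))" and e: "e \<le> 2 * c" for x \<beta> c e
  proof -
    have "(x $ i) ^ (2 * \<beta> i) = (y $ i) ^ (2 * \<beta> i) / \<kappa> ^ (2 * c)" for i
      unfolding x c[of i, symmetric] by (simp add: power_divide mult_ac flip: power_mult)
    then have "(\<Sum>i\<in>UNIV. (x $ i) ^ (2 * \<beta> i)) = (\<kappa> ^ (2 * c) - \<kappa> ^ (2 * c - e)) / \<kappa> ^ (2 * c)"
      unfolding eq by (simp add: sum_divide_distrib)
    also have "\<kappa> ^ (2 * c) = \<kappa> ^ (2 * c - e) * \<kappa> ^ e" using e by (simp flip: power_add)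
    also have "(A * B - A) / (A * B) = 1 - inverse B" if "A > 0" "B > 0" for A B :: real
      using that by (simp add: field_simps)
    then have "(\<kappa> ^ (2 * c - e) * \<kappa> ^ e - \<kappa> ^ (2 * c - e)) / (\<kappa> ^ (2 * c - e) * \<kappa> ^ e) = 1 - inverse (\<kappa> ^ e)"
      using \<kappa>(1) by simp
    finally show ?thesis by simp
  qed
  show ?thesis
  proof (cases K)
    case (Directional d)
    have "(y $ d) powr (- 1 / real (\<alpha> d)) = inverse (yscaling \<alpha> K y)"
      using powr_minus[of "y $ d" "1 / real (\<alpha> d)"] by (simp add: Directional)
    then show ?thesis by (simp add: Directional Let_def)
  next
    case (Poincare \<beta> c)
    have x: "tmap \<alpha> K y $ i = y $ i / \<kappa> ^ \<alpha> i" for i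
      using chart_point_tmap[where \<alpha> = \<alpha>, OF \<alpha> K y] by (simp add: Poincare \<kappa>_def)
    show ?thesis
      using radial[OF x, of \<beta> c "2 * c"] \<kappa>(2) K by (simp add: Poincare \<kappa>_def)
  next
    case (Parabolic \<beta> c)
    have x: "tmap \<alpha> K y $ i = y $ i / \<kappa> ^ \<alpha> i" for i
      using chart_point_tmap[where \<alpha> = \<alpha>, OF \<alpha> K y] unfolding Parabolic chart_point.simps \<kappa>_def .
    have "1 - (\<Sum>i\<in>UNIV. (tmap \<alpha> K y $ i) ^ (2 * \<beta> i)) = inverse (\<kappa> ^ 1)"
      by (rule radial[OF x, of \<beta> c 1]) (use \<kappa>(2) K in \<open>auto simp: Parabolic\<close>)
    then show ?thesis unfolding \<kappa>_def Parabolic weight.simps weight_exp.simps .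
  qed
qed

lemma weight_tmap_pos:
  assumes \<alpha>: "\<And>i. \<alpha> i \<ge> 1" and K: "admissible \<alpha> k K" and y: "y \<in> tdom K"
  shows "weight K (tmap \<alpha> K y) > 0"
  using weight_tmap[where \<alpha> = \<alpha>, OF assms] yscaling_root(1)[where \<alpha> = \<alpha>, OF assms] by simp

lemma scaling_tmap:
  assumes \<alpha>: "\<And>i. \<alpha> i \<ge> 1" and K: "admissible \<alpha> k K" and y: "y \<in> tdom K"
  shows "scaling K (tmap \<alpha> K y) = yscaling \<alpha> K y"
proof -
  note w = weight_tmap_pos[where \<alpha> = \<alpha>, OF assms]
  have "scaling K (tmap \<alpha> K y) ^ weight_exp K = yscaling \<alpha> K y ^ weight_exp K"
    using scaling_power(2)[OF K w] weight_tmap[where \<alpha> = \<alpha>, OF assms] by simp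
  then show ?thesis
    by (rule power_eq_imp_eq_base)
       (use scaling_power(1)[OF K w] yscaling_root(1)[where \<alpha> = \<alpha>, OF assms] weight_exp_pos[OF K] in auto)
qed

lemma tinv_tmap:
  assumes \<alpha>: "\<And>i. \<alpha> i \<ge> 1" and K: "admissible \<alpha> k K" and y: "y \<in> tdom K"
  shows "tinv \<alpha> K (tmap \<alpha> K y) = y"
  using scaling_tmap[where \<alpha> = \<alpha>, OF assms] chart_point_tmap[where \<alpha> = \<alpha>, OF assms]
    yscaling_root(1)[where \<alpha> = \<alpha>, OF assms]
  by (simp add: tinv_def qscale_def vec_eq_iff)

lemma tinv_in_tdom:
  assumes "admissible \<alpha> k K" "weight K x > 0"
  shows "tinv \<alpha> K x \<in> tdom K"
  using scaling_power(1)[OF assms] by (cases K) (auto simp: tinv_def qscale_def)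

text \<open>The scaling factor of \<open>x\<close> solves the equation that defines the one of
  \<open>tinv \<alpha> K x\<close>, and that equation has only one positive root.\<close>

lemma yscaling_tinv:
  assumes \<alpha>: "\<And>i. \<alpha> i \<ge> 1" and K: "admissible \<alpha> k K" and w: "weight K x > 0"
  shows "yscaling \<alpha> K (tinv \<alpha> K x) = scaling K x"
proof (rule yscaling_unique[where \<alpha> = \<alpha>, OF \<alpha> K tinv_in_tdom[OF K w], symmetric])
  note s = scaling_power[OF K w]
  show "scaling K x > 0" by (rule s)
  have radial: "\<kappa> ^ (2 * c) - \<kappa> ^ (2 * c - e) = (\<Sum>i\<in>UNIV. ((\<kappa> ^ \<alpha> i * x $ i)) ^ (2 * \<beta> i))"
    if c: "\<And>i. \<alpha> i * \<beta> i = c" and \<kappa>: "\<kappa> > 0" "\<kappa> ^ e = inverse (1 - (\<Sum>i\<in>UNIV. (x $ i) ^ (2 * \<beta> i)))"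
      and e: "e \<le> 2 * c" for \<beta> c e \<kappa>
  proof -
    have "(\<kappa> ^ \<alpha> i * x $ i) ^ (2 * \<beta> i) = \<kappa> ^ (2 * c) * (x $ i) ^ (2 * \<beta> i)" for i
      unfolding c[of i, symmetric] by (simp add: power_mult_distrib mult_ac flip: power_mult)
    then have "(\<Sum>i\<in>UNIV. ((\<kappa> ^ \<alpha> i * x $ i)) ^ (2 * \<beta> i)) = \<kappa> ^ (2 * c) * (1 - inverse (\<kappa> ^ e))"
      using \<kappa>(2) by (simp add: sum_distrib_left)
    also have "\<dots> = \<kappa> ^ (2 * c) - \<kappa> ^ (2 * c) * inverse (\<kappa> ^ e)" by (simp add: algebra_simps)
    also have "\<kappa> ^ (2 * c) * inverse (\<kappa> ^ e) = \<kappa> ^ (2 * c - e)"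
      using e \<kappa>(1) by (simp add: power_diff divide_inverse)
    finally show ?thesis ..
  qed
  show "scaling_poly \<alpha> K (scaling K x) = scaling_rhs K (tinv \<alpha> K x)"
  proof (cases K)
    case (Directional d)
    then show ?thesis by (simp add: tinv_def qscale_def)
  next
    case (Poincare \<beta> c)
    show ?thesis
      using radial[of \<beta> c "scaling K x" "2 * c"] s K by (simp add: Poincare tinv_def qscale_def)
  next
    case (Parabolic \<beta> c)
    have "scaling K x ^ (2 * c) - scaling K x ^ (2 * c - 1) = (\<Sum>i\<in>UNIV. ((scaling K x ^ \<alpha> i * x $ i)) ^ (2 * \<beta> i))"
      by (rule radial) (use s K in \<open>auto simp: Parabolic\<close>)
    then show ?thesis by (simp add: Parabolic tinv_def qscale_def)
  qed
qed

text \<open>In the directional chart \<open>chart_point\<close> forgets the coordinate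
  \<open>d\<close>, and the weight is exactly that coordinate.\<close>

lemma chart_point_weight_inject:
  "chart_point K x = chart_point K x' \<Longrightarrow> weight K x = weight K x' \<Longrightarrow> x = x'"
proof (cases K)
  case (Directional d)
  assume "chart_point K x = chart_point K x'" and w: "weight K x = weight K x'"
  then have cp: "(if i = d then 1 else x $ i) = (if i = d then 1 else x' $ i)" for i
    by (simp add: Directional vec_eq_iff)
  have "x $ i = x' $ i" for i using w cp[of i] by (cases "i = d") (simp_all add: Directional)
  then show ?thesis by (simp add: vec_eq_iff)
qed simp_all

lemma tmap_tinv:
  assumes \<alpha>: "\<And>i. \<alpha> i \<ge> 1" and K: "admissible \<alpha> k K" and w: "weight K x > 0"
  shows "tmap \<alpha> K (tinv \<alpha> K x) = x"
proof -
  define y where "y = tinv \<alpha> K x"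
  have y: "y \<in> tdom K" unfolding y_def by (rule tinv_in_tdom[OF K w])
  note s = scaling_power(1)[OF K w]
  have cp: "chart_point K (tmap \<alpha> K y) = chart_point K x"
    using chart_point_tmap[where \<alpha> = \<alpha>, OF \<alpha> K y] yscaling_tinv[where \<alpha> = \<alpha>, OF \<alpha> K w] s
    by (simp add: vec_eq_iff y_def tinv_def qscale_def)
  have "weight K (tmap \<alpha> K y) = inverse (scaling K x ^ weight_exp K)"
    using weight_tmap[where \<alpha> = \<alpha>, OF \<alpha> K y] yscaling_tinv[where \<alpha> = \<alpha>, OF \<alpha> K w] by (simp add: y_def)
  then have "weight K (tmap \<alpha> K y) = weight K x" using scaling_power(2)[OF K w] by simp
  with cp have "tmap \<alpha> K y = x" by (rule chart_point_weight_inject)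
  then show ?thesis by (simp add: y_def)
qed

section \<open>Analyticity of the compactification map\<close>

lemma open_tdom: "open (tdom K)"
  by (cases K) (auto intro!: open_Collect_less continuous_intros)

text \<open>The equation has its variables separated, so its root is the local inverse of \<phi>
  applied to \<open>Q y\<close>. The inverse function theorem yields some analytic positive root
  near \<open>y0\<close>, and uniqueness identifies it with \<open>\<kappa>\<close>. The type
  \<open>real ^ 1\<close> merely casts the scalar problem in vector form.\<close>

lemma analytic_implicit_root:
  fixes \<phi> :: "real \<Rightarrow> real" and Q \<kappa> :: "real ^ 'n::finite \<Rightarrow> real"
  assumes \<phi>: "real_analytic_at (\<lambda>v :: real ^ 1. \<phi> (v $ 1)) (vec \<kappa>0)"
    and l: "(\<phi> has_real_derivative l) (at \<kappa>0)" "l \<noteq> 0"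
    and Q: "real_analytic_at Q y0" "Q y0 = \<phi> \<kappa>0" and pos: "\<kappa>0 > 0"
    and uniq: "\<forall>\<^sub>F y in nhds y0. \<forall>u>0. \<phi> u = Q y \<longrightarrow> u = \<kappa> y"
  shows "real_analytic_at \<kappa> y0"
proof -
  define F :: "real ^ 1 \<Rightarrow> real ^ 1" where "F v = vec (\<phi> (v $ 1))" for v
  have F: "real_analytic_at (\<lambda>v. F v $ i) (vec \<kappa>0)" for i
    using \<phi> by (simp add: F_def)
  have F': "(F has_derivative (\<lambda>h. vec (l * h $ 1))) (at (vec \<kappa>0))"
  proof (rule has_derivative_vecI)
    have "((\<lambda>v :: real ^ 1. v $ 1) has_derivative (\<lambda>h. h $ 1)) (at (vec \<kappa>0))"
      by (rule bounded_linear_imp_has_derivative[OF bounded_linear_vec_nth])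
    moreover have "(\<phi> has_derivative (*) l) (at ((vec \<kappa>0 :: real ^ 1) $ 1))"
      using l(1) by (simp add: has_field_derivative_def)
    ultimately have "((\<lambda>v :: real ^ 1. \<phi> (v $ 1)) has_derivative (\<lambda>h. l * h $ 1)) (at (vec \<kappa>0))"
      by (rule has_derivative_compose)
    then show "((\<lambda>v. F v $ i) has_derivative (\<lambda>h. vec (l * h $ 1) $ i)) (at (vec \<kappa>0))" for i
      by (simp add: F_def)
  qed
  have inj: "inj (\<lambda>h :: real ^ 1. vec (l * h $ 1) :: real ^ 1)"
    using l(2) by (auto simp: inj_def vec_eq_iff)
  obtain L where L: "\<And>i. real_analytic_at (\<lambda>y. L y $ i) (F (vec \<kappa>0))" "L (F (vec \<kappa>0)) = vec \<kappa>0"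
    "\<forall>\<^sub>F y in nhds (F (vec \<kappa>0)). F (L y) = y"
    by (rule analytic_inverse_function[OF F F' inj]) blast
  have F0: "F (vec \<kappa>0) = vec (Q y0)" by (simp add: F_def Q(2))
  define u where "u y = L (vec (Q y)) $ 1" for y
  have u: "real_analytic_at u y0"
    unfolding u_def
    by (rule real_analytic_at_compose_vec[where Q = "\<lambda>v. L v $ 1" and u = "\<lambda>y. vec (Q y)"])
       (use L(1)[of 1] F0 Q(1) in simp_all)
  have "(u \<longlongrightarrow> u y0) (nhds y0)"
    using real_analytic_at_isCont[OF u] unfolding isCont_def tendsto_at_iff_tendsto_nhds .
  moreover have "u y0 = \<kappa>0" using L(2) F0 by (simp add: u_def)
  ultimately have "(u \<longlongrightarrow> \<kappa>0) (nhds y0)" by simp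
  then have ev1: "\<forall>\<^sub>F y in nhds y0. u y > 0" using pos by (rule order_tendstoD)
  have "(Q \<longlongrightarrow> Q y0) (nhds y0)"
    using real_analytic_at_isCont[OF Q(1)] unfolding isCont_def tendsto_at_iff_tendsto_nhds .
  then have "((\<lambda>y. vec (Q y) :: real ^ 1) \<longlongrightarrow> vec (Q y0)) (nhds y0)"
    by (intro vec_tendstoI) simp
  then have "\<forall>\<^sub>F y in nhds y0. F (L (vec (Q y))) = vec (Q y)"
    using L(3) unfolding F0 by (rule eventually_compose_filterlim[rotated])
  then have ev2: "\<forall>\<^sub>F y in nhds y0. \<phi> (u y) = Q y"
    by (rule eventually_mono) (simp add: F_def u_def vec_eq_iff)
  from ev1 ev2 uniq have "\<forall>\<^sub>F y in nhds y0. u y = \<kappa> y"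
    by eventually_elim blast
  with u show ?thesis by (rule real_analytic_at_cong)
qed

lemma real_analytic_at_yscaling:
  fixes y0 :: "real ^ 'n::finite"
  assumes \<alpha>: "\<And>i. \<alpha> i \<ge> 1" and K: "admissible \<alpha> k K" and y0: "y0 \<in> tdom K"
  shows "real_analytic_at (yscaling \<alpha> K) y0"
proof -
  define \<kappa> where "\<kappa> = yscaling \<alpha> K y0"
  have \<kappa>: "\<kappa> > 0" "scaling_poly \<alpha> K \<kappa> = scaling_rhs K y0"
    using yscaling_root[where \<alpha> = \<alpha>, OF \<alpha> K y0] by (simp_all add: \<kappa>_def)
  \<comment> \<open>The root is simple: a nonnegative right-hand side forces \<kappa> to be at least
    1, and there the derivative of the leading power dominates.\<close>
  have radial: "\<exists>l. ((\<lambda>u :: real. u ^ n - u ^ (n - e)) has_real_derivative l) (at \<kappa>) \<and> l \<noteq> 0"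
    if "1 \<le> e" "e \<le> n" "\<kappa> ^ n - \<kappa> ^ (n - e) \<ge> 0" for n e :: nat
  proof -
    have k1: "\<kappa> \<ge> 1"
    proof (rule ccontr)
      assume "\<not> \<kappa> \<ge> 1"
      then have "\<kappa> ^ e < 1" using \<kappa>(1) that by (intro power_less_one_iff[THEN iffD2]) auto
      then have "\<kappa> ^ (n - e) * (\<kappa> ^ e - 1) < 0" using \<kappa>(1) by (intro mult_pos_neg) auto
      with that show False by (simp add: radial_root_factor[OF that(2)])
    qed
    have "((\<lambda>u :: real. u ^ n - u ^ (n - e)) has_real_derivative
        (real n * \<kappa> ^ (n - 1) - real (n - e) * \<kappa> ^ (n - e - 1))) (at \<kappa>)"
      by (auto intro!: derivative_eq_intros)
    moreover have "real (n - e) * \<kappa> ^ (n - e - 1) < real n * \<kappa> ^ (n - 1)"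
    proof -
      have "real (n - e) * \<kappa> ^ (n - e - 1) \<le> real (n - e) * \<kappa> ^ (n - 1)"
        using k1 by (intro mult_left_mono power_increasing) auto
      also have "\<dots> < real n * \<kappa> ^ (n - 1)" using \<kappa>(1) that by (intro mult_strict_right_mono) auto
      finally show ?thesis .
    qed
    ultimately show ?thesis by (intro exI) auto
  qed
  have "\<exists>l. (scaling_poly \<alpha> K has_real_derivative l) (at \<kappa>) \<and> l \<noteq> 0"
  proof (cases K)
    case (Directional d)
    have eq: "scaling_poly \<alpha> K = (\<lambda>u. u ^ \<alpha> d)" by (auto simp: Directional)
    have "((\<lambda>u. u ^ \<alpha> d) has_real_derivative real (\<alpha> d) * \<kappa> ^ (\<alpha> d - 1)) (at \<kappa>)"
      by (auto intro!: derivative_eq_intros)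
    moreover have "real (\<alpha> d) * \<kappa> ^ (\<alpha> d - 1) \<noteq> 0" using \<alpha>[of d] \<kappa>(1) by simp
    ultimately show ?thesis unfolding eq by blast
  next
    case (Poincare \<beta> c)
    have eq: "scaling_poly \<alpha> K = (\<lambda>u. u ^ (2 * c) - u ^ (2 * c - 2 * c))" by (auto simp: Poincare)
    show ?thesis unfolding eq
      by (rule radial) (use K \<kappa>(2) in \<open>auto simp: Poincare intro: sum_nonneg\<close>)
  next
    case (Parabolic \<beta> c)
    have eq: "scaling_poly \<alpha> K = (\<lambda>u. u ^ (2 * c) - u ^ (2 * c - 1))" by (auto simp: Parabolic)
    show ?thesis unfolding eq
      by (rule radial) (use K \<kappa>(2) in \<open>auto simp: Parabolic intro: sum_nonneg\<close>)
  qed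
  then obtain l where l: "(scaling_poly \<alpha> K has_real_derivative l) (at \<kappa>)" "l \<noteq> 0" by blast
  have an: "real_analytic_at (\<lambda>v :: real ^ 1. scaling_poly \<alpha> K (v $ 1)) (vec \<kappa>)"
    by (cases K) (auto intro!: real_analytic_at_diff real_analytic_at_power)
  have rhs: "real_analytic_at (scaling_rhs K) y0"
  proof (cases K)
    case (Directional d)
    then have "scaling_rhs K = (\<lambda>y. y $ d)" by auto
    then show ?thesis by simp
  next
    case (Poincare \<beta> c)
    then have "scaling_rhs K = (\<lambda>y. \<Sum>i\<in>UNIV. (y $ i) ^ (2 * \<beta> i))" by auto
    then show ?thesis by (auto intro!: real_analytic_at_sum real_analytic_at_power)
  next
    case (Parabolic \<beta> c)
    then have "scaling_rhs K = (\<lambda>y. \<Sum>i\<in>UNIV. (y $ i) ^ (2 * \<beta> i))" by auto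
    then show ?thesis by (auto intro!: real_analytic_at_sum real_analytic_at_power)
  qed
  have uniq: "\<forall>\<^sub>F y in nhds y0. \<forall>u>0. scaling_poly \<alpha> K u = scaling_rhs K y \<longrightarrow> u = yscaling \<alpha> K y"
    using eventually_nhds_in_open[OF open_tdom y0]
  proof (rule eventually_mono, intro allI impI)
    fix y u assume "y \<in> tdom K" "0 < u" "scaling_poly \<alpha> K u = scaling_rhs K y"
    then show "u = yscaling \<alpha> K y" by (rule yscaling_unique[where \<alpha> = \<alpha>, OF \<alpha> K])
  qed
  show ?thesis
    by (rule analytic_implicit_root[OF an l rhs \<kappa>(2)[symmetric] \<kappa>(1) uniq])
qed

lemma real_analytic_at_tmap:
  fixes y0 :: "real ^ 'n::finite"
  assumes \<alpha>: "\<And>i. \<alpha> i \<ge> 1" and K: "admissible \<alpha> k K" and y0: "y0 \<in> tdom K"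
  shows "real_analytic_at (\<lambda>y. tmap \<alpha> K y $ i) y0"
proof -
  have inv: "real_analytic_at (\<lambda>y. inverse (yscaling \<alpha> K y)) y0"
    by (rule real_analytic_at_inverse[OF real_analytic_at_yscaling[where \<alpha> = \<alpha>, OF \<alpha> K y0]])
       (use yscaling_root(1)[where \<alpha> = \<alpha>, OF \<alpha> K y0] in simp)
  have q: "real_analytic_at (\<lambda>y. y $ i * inverse (yscaling \<alpha> K y) ^ \<alpha> i) y0"
    by (intro real_analytic_at_mult real_analytic_at_component real_analytic_at_power inv)
  \<comment> \<open>Coordinate \<open>d\<close> of the directional chart is 1 / \<kappa> itself;
    every other coordinate, in all charts, is that of y divided by a power of \<kappa>.\<close>
  have "(\<exists>d. K = Directional d \<and> i = d) \<or> (\<forall>x. chart_point K x $ i = x $ i)"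
    by (cases K) auto
  then show ?thesis
  proof
    assume "\<exists>d. K = Directional d \<and> i = d"
    then obtain d where d: "K = Directional d" "i = d" by blast
    have "\<forall>\<^sub>F y in nhds y0. inverse (yscaling \<alpha> K y) = tmap \<alpha> K y $ i"
      using eventually_nhds_in_open[OF open_tdom y0]
    proof (rule eventually_mono)
      fix y assume "y \<in> tdom K"
      from weight_tmap[where \<alpha> = \<alpha>, OF \<alpha> K this] show "inverse (yscaling \<alpha> K y) = tmap \<alpha> K y $ i"
        unfolding d by simp
    qed
    with inv show ?thesis by (rule real_analytic_at_cong)
  next
    assume cp: "\<forall>x. chart_point K x $ i = x $ i"
    have "\<forall>\<^sub>F y in nhds y0. y $ i * inverse (yscaling \<alpha> K y) ^ \<alpha> i = tmap \<alpha> K y $ i"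
      using eventually_nhds_in_open[OF open_tdom y0]
    proof (rule eventually_mono)
      fix y assume "y \<in> tdom K"
      from chart_point_tmap[where \<alpha> = \<alpha>, OF \<alpha> K this, of i]
      show "y $ i * inverse (yscaling \<alpha> K y) ^ \<alpha> i = tmap \<alpha> K y $ i"
        using cp by (simp add: divide_inverse power_inverse)
    qed
    with q show ?thesis by (rule real_analytic_at_cong)
  qed
qed

section \<open>Orbits do not reach the horizon in finite time\<close>

lemma qscale_mult: "qscale \<alpha> (s * t) x = qscale \<alpha> s (qscale \<alpha> t x)"
  by (simp add: qscale_def vec_eq_iff power_mult_distrib)

lemma qscale_one [simp]: "qscale \<alpha> 1 x = x"
  by (simp add: qscale_def vec_eq_iff)

lemma norm_qscale_le:
  fixes x :: "real ^ 'n::finite"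
  assumes "\<And>i. \<alpha> i \<ge> 1" "0 \<le> s" "s \<le> 1"
  shows "norm (qscale \<alpha> s x) \<le> s * norm x"
proof -
  have "norm (qscale \<alpha> s x) \<le> norm (s *\<^sub>R x)"
  proof (rule norm_le_componentwise_cart)
    fix i
    have "s ^ \<alpha> i \<le> s ^ 1" using assms by (intro power_decreasing) auto
    then show "norm (qscale \<alpha> s x $ i) \<le> norm ((s *\<^sub>R x) $ i)"
      using assms(2) by (simp add: qscale_def abs_mult mult_right_mono)
  qed
  then show ?thesis using assms(2) by simp
qed

text \<open>Quasi-homogeneous polar coordinates, from the intermediate value theorem: rescaling by 1
  / \<rho> leaves y outside the unit ball at \<rho> = 1 and has brought it inside at \<rho> = norm
  y.\<close>

lemma qscale_polar:
  fixes y :: "real ^ 'n::finite"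
  assumes \<alpha>: "\<And>i. \<alpha> i \<ge> 1" and y: "norm y > 1"
  obtains \<rho> u where "\<rho> \<ge> 1" "norm u = 1" "y = qscale \<alpha> \<rho> u"
proof -
  define \<phi> where "\<phi> \<rho> = norm (qscale \<alpha> (inverse \<rho>) y)" for \<rho>
  have "inverse (norm y) \<le> 1" using y by (simp add: inverse_le_1_iff)
  then have "\<phi> (norm y) \<le> inverse (norm y) * norm y" unfolding \<phi>_def
    using y by (intro norm_qscale_le[where \<alpha> = \<alpha>, OF \<alpha>]) auto
  then have "\<phi> (norm y) \<le> 1" using y by (cases "norm y = 0") auto
  moreover have "1 \<le> \<phi> 1" using y by (simp add: \<phi>_def)
  moreover have "continuous_on {1..norm y} \<phi>"
    unfolding \<phi>_def qscale_def
    by (intro continuous_intros continuous_on_vec_lambda) auto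
  ultimately obtain \<rho> where \<rho>: "\<rho> \<ge> 1" "\<phi> \<rho> = 1"
    using IVT2'[of \<phi> "norm y" 1 1] y by auto
  have "y = qscale \<alpha> \<rho> (qscale \<alpha> (inverse \<rho>) y)"
    using \<rho>(1) by (simp flip: qscale_mult)
  with \<rho> show thesis by (intro that[of \<rho> "qscale \<alpha> (inverse \<rho>) y"]) (auto simp: \<phi>_def)
qed

lemma C1_continuous: "C1 f \<Longrightarrow> continuous_on S f"
  unfolding C1_def
  by (meson continuous_at_imp_continuous_on has_derivative_continuous)

text \<open>For large \<rho> the uniform limit compares \<open>f\<close> with its quasi-homogeneous
  part, which is bounded on the sphere; the remaining \<rho> form a compact interval.\<close>

lemma asymptotic_growth:
  fixes f :: "real ^ 'n::finite \<Rightarrow> real ^ 'n"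
  assumes f: "C1 f" "asymptotically_quasi_homogeneous \<alpha> k f"
  shows "\<exists>C\<ge>0. \<forall>\<rho>\<ge>1. \<forall>u. norm u = 1 \<longrightarrow> \<bar>f (qscale \<alpha> \<rho> u) $ j\<bar> \<le> C * \<rho> ^ (k + \<alpha> j)"
proof -
  obtain fq where fq: "quasi_homogeneous_field \<alpha> k fq"
    and lim: "uniform_limit (sphere 0 1)
               (\<lambda>s x. inverse (s ^ (k + \<alpha> j)) *
                      (f (qscale \<alpha> s x) $ j - s ^ (k + \<alpha> j) * fq x $ j))
               (\<lambda>_. 0) at_top"
    using f(2) unfolding asymptotically_quasi_homogeneous_def by blast
  have "C1 (\<lambda>x. fq x $ j)"
    using fq unfolding quasi_homogeneous_field_def quasi_homogeneous_def by blast
  then have "compact ((\<lambda>x. fq x $ j) ` sphere 0 1)"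
    by (intro compact_continuous_image C1_continuous compact_sphere)
  then obtain A where A: "A > 0" "\<And>u. norm u = 1 \<Longrightarrow> \<bar>fq u $ j\<bar> \<le> A"
    using compact_imp_bounded[THEN bounded_pos[THEN iffD1]] by force
  have "\<forall>\<^sub>F s in at_top. \<forall>x\<in>sphere 0 1. dist (inverse (s ^ (k + \<alpha> j)) * (f (qscale \<alpha> s x) $ j - s ^ (k + \<alpha> j) * fq x $ j)) 0 < 1"
    using lim unfolding uniform_limit_iff by simp
  then obtain S where S': "\<forall>s\<ge>S. \<forall>x\<in>sphere 0 1.
      dist (inverse (s ^ (k + \<alpha> j)) * (f (qscale \<alpha> s x) $ j - s ^ (k + \<alpha> j) * fq x $ j)) 0 < 1"
    unfolding eventually_at_top_linorder by blast
  have S: "\<bar>inverse (s ^ (k + \<alpha> j)) * (f (qscale \<alpha> s x) $ j - s ^ (k + \<alpha> j) * fq x $ j)\<bar> < 1"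
    if "s \<ge> S" "norm x = 1" for s x
    using S'[rule_format, OF that(1), of x] that(2) by simp
  define T where "T = max S 1"
  have "continuous_on ({1..T} \<times> sphere 0 1) (\<lambda>(s, x). f (qscale \<alpha> s x) $ j)"
    unfolding case_prod_unfold qscale_def
    by (intro continuous_intros continuous_on_compose2[OF C1_continuous[OF f(1), of UNIV]] continuous_on_vec_lambda) auto
  then have "bounded ((\<lambda>(s, x). f (qscale \<alpha> s x) $ j) ` ({1..T} \<times> sphere 0 1))"
    by (intro compact_imp_bounded compact_continuous_image compact_Times compact_Icc compact_sphere)
  then obtain B where B: "B > 0" "\<And>v. v \<in> (\<lambda>(s, x). f (qscale \<alpha> s x) $ j) ` ({1..T} \<times> sphere 0 1) \<Longrightarrow> norm v \<le> B"
    unfolding bounded_pos by blast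
  have "\<bar>f (qscale \<alpha> \<rho> u) $ j\<bar> \<le> (1 + A + B) * \<rho> ^ (k + \<alpha> j)" if \<rho>: "\<rho> \<ge> 1" and u: "norm u = 1" for \<rho> u
  proof (cases "\<rho> \<ge> T")
    case True
    define r where "r = \<rho> ^ (k + \<alpha> j)"
    have r: "r > 0" using \<rho> by (simp add: r_def)
    have "\<bar>inverse r * (f (qscale \<alpha> \<rho> u) $ j - r * fq u $ j)\<bar> < 1"
      using S[of \<rho> u] True u by (simp add: T_def r_def)
    then have "\<bar>f (qscale \<alpha> \<rho> u) $ j - r * fq u $ j\<bar> < r"
      using r by (simp add: abs_mult field_simps)
    moreover have "\<bar>r * fq u $ j\<bar> \<le> r * A" using A(2)[OF u] r by (simp add: abs_mult)
    moreover have "r * B \<ge> 0" using r B(1) by simp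
    ultimately show ?thesis unfolding r_def[symmetric] by (simp add: algebra_simps)
  next
    case False
    then have "norm (f (qscale \<alpha> \<rho> u) $ j) \<le> B"
      using \<rho> u by (intro B(2)) (auto intro!: image_eqI[of _ _ "(\<rho>, u)"])
    moreover have "B * 1 \<le> B * \<rho> ^ (k + \<alpha> j)"
      using B(1) \<rho> by (intro mult_left_mono one_le_power) auto
    moreover have "(1 + A) * \<rho> ^ (k + \<alpha> j) \<ge> 0" using A(1) \<rho> by simp
    ultimately show ?thesis by (simp add: algebra_simps)
  qed
  then show ?thesis using A(1) B(1) by (intro exI[of _ "1 + A + B"]) auto
qed

text \<open>If the scaled point lies in the unit ball, then \<open>f\<close> is bounded there and
  \<kappa> is bounded below. Otherwise its quasi-polar radius is at most \<kappa> B, and the growth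
  estimate cancels the power of \<kappa>.\<close>

lemma rescaled_bounded:
  fixes f :: "real ^ 'n::finite \<Rightarrow> real ^ 'n"
  assumes \<alpha>: "\<And>i. \<alpha> i \<ge> 1" and f: "C1 f" "asymptotically_quasi_homogeneous \<alpha> k f"
    and \<kappa>m: "\<kappa>m > 0" and B: "B \<ge> 1"
  shows "\<exists>C\<ge>0. \<forall>\<kappa>\<ge>\<kappa>m. \<forall>z. norm z \<le> B \<longrightarrow> \<bar>inverse (\<kappa> ^ (k + \<alpha> j)) * f (qscale \<alpha> \<kappa> z) $ j\<bar> \<le> C"
proof -
  define n where "n = k + \<alpha> j"
  obtain C where C: "C \<ge> 0" "\<And>\<rho> u. \<rho> \<ge> 1 \<Longrightarrow> norm u = 1 \<Longrightarrow> \<bar>f (qscale \<alpha> \<rho> u) $ j\<bar> \<le> C * \<rho> ^ n"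
    using asymptotic_growth[OF f, of j] unfolding n_def by blast
  have "compact ((\<lambda>x. f x $ j) ` cball 0 1)"
    by (intro compact_continuous_image continuous_intros C1_continuous[OF f(1)] compact_cball)
  then obtain M where M: "M > 0" "\<And>y. norm y \<le> 1 \<Longrightarrow> \<bar>f y $ j\<bar> \<le> M"
    using compact_imp_bounded[THEN bounded_pos[THEN iffD1]] by force
  have "\<bar>inverse (\<kappa> ^ n) * f (qscale \<alpha> \<kappa> z) $ j\<bar> \<le> M * inverse (\<kappa>m ^ n) + C * B ^ n"
    if \<kappa>: "\<kappa> \<ge> \<kappa>m" and z: "norm z \<le> B" for \<kappa> z
  proof -
    have \<kappa>0: "\<kappa> > 0" using \<kappa> \<kappa>m by simp
    have t1: "C * B ^ n \<ge> 0" "M * inverse (\<kappa>m ^ n) \<ge> 0" using C(1) B M(1) \<kappa>m by auto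
    show ?thesis
    proof (cases "norm (qscale \<alpha> \<kappa> z) \<le> 1")
      case True
      have "\<bar>inverse (\<kappa> ^ n) * f (qscale \<alpha> \<kappa> z) $ j\<bar> = inverse (\<kappa> ^ n) * \<bar>f (qscale \<alpha> \<kappa> z) $ j\<bar>"
        using \<kappa>0 by (simp add: abs_mult)
      also have "\<dots> \<le> inverse (\<kappa>m ^ n) * M"
        using M(2)[OF True] \<kappa> \<kappa>m by (intro mult_mono le_imp_inverse_le power_mono) auto
      finally show ?thesis using t1 by (simp add: mult.commute)
    next
      case False
      then obtain \<rho> u where \<rho>: "\<rho> \<ge> 1" "norm u = 1" "qscale \<alpha> \<kappa> z = qscale \<alpha> \<rho> u"
        using qscale_polar[where \<alpha> = \<alpha>, OF \<alpha>, of "qscale \<alpha> \<kappa> z"] by (metis not_le)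
      \<comment> \<open>With a larger \<rho>, the unit vector \<open>u\<close> would be
        \<open>z\<close> rescaled by \<kappa> / \<rho> < 1 / B, hence of norm less than 1.\<close>
      have le: "\<rho> \<le> \<kappa> * B"
      proof (rule ccontr)
        assume "\<not> \<rho> \<le> \<kappa> * B"
        then have lt: "\<kappa> * B < \<rho>" by simp
        have "u = qscale \<alpha> (inverse \<rho>) (qscale \<alpha> \<rho> u)" using \<rho>(1) by (simp flip: qscale_mult)
        also have "\<dots> = qscale \<alpha> (inverse \<rho> * \<kappa>) z" unfolding \<rho>(3)[symmetric] by (simp flip: qscale_mult)
        finally have u: "u = qscale \<alpha> (inverse \<rho> * \<kappa>) z" .
        have "\<kappa> * 1 \<le> \<kappa> * B" using \<kappa>0 B by (intro mult_left_mono) auto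
        with lt have "inverse \<rho> * \<kappa> \<le> 1" using \<rho>(1) by (simp add: field_simps)
        then have "norm u \<le> inverse \<rho> * \<kappa> * norm z"
          unfolding u using \<rho>(1) \<kappa>0 by (intro norm_qscale_le[where \<alpha> = \<alpha>, OF \<alpha>]) auto
        also have "\<dots> \<le> inverse \<rho> * \<kappa> * B" using z \<rho>(1) \<kappa>0 by (intro mult_left_mono) auto
        also have "\<dots> < 1" using lt \<rho>(1) by (simp add: field_simps)
        finally show False using \<rho>(2) by simp
      qed
      have "\<bar>inverse (\<kappa> ^ n) * f (qscale \<alpha> \<kappa> z) $ j\<bar> = inverse (\<kappa> ^ n) * \<bar>f (qscale \<alpha> \<rho> u) $ j\<bar>"
        using \<kappa>0 \<rho>(3) by (simp add: abs_mult)
      also have "\<dots> \<le> inverse (\<kappa> ^ n) * (C * \<rho> ^ n)"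
        using C(2)[OF \<rho>(1,2)] \<kappa>0 by (intro mult_left_mono) auto
      also have "\<dots> \<le> inverse (\<kappa> ^ n) * (C * (\<kappa> * B) ^ n)"
        using C(1) \<kappa>0 le \<rho>(1) by (intro mult_left_mono power_mono) auto
      also have "\<dots> = C * B ^ n" using \<kappa>0 by (simp add: power_mult_distrib)
      finally show ?thesis using t1 by simp
    qed
  qed
  then show ?thesis unfolding n_def using C(1) B M(1) \<kappa>m
    by (intro exI[of _ "M * inverse (\<kappa>m ^ (k + \<alpha> j)) + C * B ^ (k + \<alpha> j)"]) auto
qed

text \<open>In the radial charts \<kappa> is at least 1; in the directional chart \<kappa> = 1 / s
  with 0 < s \<le> B.\<close>

lemma scaling_lower_bound:
  assumes K: "admissible \<alpha> k K" and w: "weight K x > 0" and B: "B \<ge> 1" "norm x \<le> B"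
  shows "scaling K x \<ge> inverse B"
proof (cases K)
  case (Directional d)
  have "x $ d > 0" using w Directional by simp
  moreover have "x $ d \<le> B" using component_le_norm_cart[of x d] B by simp
  moreover have "scaling K x = inverse (x $ d)"
    using \<open>x $ d > 0\<close> by (simp add: Directional scaling_def powr_minus)
  ultimately show ?thesis by (simp add: le_imp_inverse_le)
next
  case (Poincare \<beta> c)
  have "inverse (weight K x) \<ge> 1"
    using w weight_le_1[of K x] by (intro one_le_inverse) (auto simp: Poincare)
  then have "\<not> scaling K x ^ weight_exp K < 1" using scaling_power(2)[OF K w] by simp
  then have "scaling K x \<ge> 1"
    using power_less_one_iff[of "scaling K x" "weight_exp K"] scaling_power(1)[OF K w] weight_exp_pos[OF K] by auto
  then show ?thesis using B(1) by (meson inverse_le_1_iff order_trans)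
next
  case (Parabolic \<beta> c)
  have "inverse (weight K x) \<ge> 1"
    using w weight_le_1[of K x] by (intro one_le_inverse) (auto simp only: Parabolic compactification.distinct)
  then have "\<not> scaling K x ^ weight_exp K < 1" using scaling_power(2)[OF K w] by simp
  then have "scaling K x \<ge> 1"
    using power_less_one_iff[of "scaling K x" "weight_exp K"] scaling_power(1)[OF K w] weight_exp_pos[OF K] by auto
  then show ?thesis using B(1) by (meson inverse_le_1_iff order_trans)
qed

lemma norm_chart_point_le:
  fixes x :: "real ^ 'n::finite"
  assumes "B \<ge> 1" "norm x \<le> B"
  shows "norm (chart_point K x) \<le> real CARD('n) * B"
proof (rule norm_le_card_mult)
  show "\<bar>chart_point K x $ i\<bar> \<le> B" for i
    using component_le_norm_cart[of x i] assms by (cases K) auto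
qed

text \<open>The bound holds uniformly up to the horizon and comes from the growth of
  \<open>f\<close> at infinity, so no value of the field on the horizon is involved.\<close>

lemma radial_rate_bounded:
  fixes f :: "real ^ 'n::finite \<Rightarrow> real ^ 'n"
  assumes \<alpha>: "\<And>i. \<alpha> i \<ge> 1" and K: "admissible \<alpha> k K"
    and f: "C1 f" "asymptotically_quasi_homogeneous \<alpha> k f" and B: "B \<ge> 1"
  shows "\<exists>C\<ge>0. \<forall>x. weight K x > 0 \<longrightarrow> norm x \<le> B \<longrightarrow> \<bar>radial_rate \<alpha> K x (rescaled_field \<alpha> k K f x)\<bar> \<le> C"
proof -
  have "real CARD('n) * B \<ge> 1"
    using mult_mono[of 1 "real CARD('n)" 1 B] B by (simp add: Suc_leI)
  from rescaled_bounded[where \<alpha> = \<alpha>, OF \<alpha> f _ this, of "inverse B"] B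
  have "\<exists>C. \<forall>j. C j \<ge> 0 \<and> (\<forall>\<kappa>\<ge>inverse B. \<forall>z. norm z \<le> real CARD('n) * B \<longrightarrow>
       \<bar>inverse (\<kappa> ^ (k + \<alpha> j)) * f (qscale \<alpha> \<kappa> z) $ j\<bar> \<le> C j)"
    by (intro choice allI) simp
  then obtain C where C0: "\<And>j. C j \<ge> 0" and C: "\<And>j \<kappa> z. \<kappa> \<ge> inverse B \<Longrightarrow> norm z \<le> real CARD('n) * B \<Longrightarrow>
       \<bar>inverse (\<kappa> ^ (k + \<alpha> j)) * f (qscale \<alpha> \<kappa> z) $ j\<bar> \<le> C j"
    by blast
  have F: "\<bar>rescaled_field \<alpha> k K f x $ j\<bar> \<le> C j" if "weight K x > 0" "norm x \<le> B" for x j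
    unfolding rescaled_field_eq[OF K that(1)] tinv_def
    by (intro C scaling_lower_bound[OF K that(1) B that(2)] norm_chart_point_le[OF B that(2)])
  have radial: "\<bar>\<Sum>j\<in>UNIV. (x $ j) ^ (2 * \<beta> j - 1) / real (\<alpha> j) * rescaled_field \<alpha> k K f x $ j\<bar>
      \<le> (\<Sum>j\<in>UNIV. B ^ (2 * \<beta> j - 1) * C j)" if "weight K x > 0" "norm x \<le> B" for x \<beta>
  proof -
    have "\<bar>\<Sum>j\<in>UNIV. (x $ j) ^ (2 * \<beta> j - 1) / real (\<alpha> j) * rescaled_field \<alpha> k K f x $ j\<bar>
        \<le> (\<Sum>j\<in>UNIV. \<bar>(x $ j) ^ (2 * \<beta> j - 1) / real (\<alpha> j) * rescaled_field \<alpha> k K f x $ j\<bar>)"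
      by (rule sum_abs)
    also have "\<dots> \<le> (\<Sum>j\<in>UNIV. B ^ (2 * \<beta> j - 1) * C j)"
    proof (rule sum_mono)
      fix j
      have a: "real (\<alpha> j) \<ge> 1" using \<alpha>[of j] by simp
      have "\<bar>x $ j\<bar> ^ (2 * \<beta> j - 1) \<le> B ^ (2 * \<beta> j - 1)"
        using component_le_norm_cart[of x j] that by (intro power_mono) auto
      moreover have "\<bar>x $ j\<bar> ^ (2 * \<beta> j - 1) / real (\<alpha> j) \<le> \<bar>x $ j\<bar> ^ (2 * \<beta> j - 1)"
        using a mult_left_mono[OF a, of "\<bar>x $ j\<bar> ^ (2 * \<beta> j - 1)"] by (simp add: divide_le_eq)
      ultimately have "\<bar>(x $ j) ^ (2 * \<beta> j - 1) / real (\<alpha> j)\<bar> \<le> B ^ (2 * \<beta> j - 1)"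
        by (simp add: abs_div power_abs)
      then show "\<bar>(x $ j) ^ (2 * \<beta> j - 1) / real (\<alpha> j) * rescaled_field \<alpha> k K f x $ j\<bar> \<le> B ^ (2 * \<beta> j - 1) * C j"
        unfolding abs_mult[of "_ / _"] using F[OF that] B by (intro mult_mono) auto
    qed
    finally show ?thesis .
  qed
  show ?thesis
  proof (cases K)
    case (Directional d)
    have a: "real (\<alpha> d) \<ge> 1" using \<alpha>[of d] by simp
    have "\<bar>rescaled_field \<alpha> k K f x $ d / real (\<alpha> d)\<bar> \<le> C d" if "weight K x > 0" "norm x \<le> B" for x
    proof -
      have "\<bar>rescaled_field \<alpha> k K f x $ d / real (\<alpha> d)\<bar> \<le> \<bar>rescaled_field \<alpha> k K f x $ d\<bar>"
        using a mult_left_mono[OF a, of "\<bar>rescaled_field \<alpha> k K f x $ d\<bar>"] by (simp add: abs_div divide_le_eq)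
      with F[OF that, of d] show ?thesis by simp
    qed
    then show ?thesis using C0[of d] unfolding Directional radial_rate.simps by (intro exI[of _ "C d"]) blast
  next
    case (Poincare \<beta> c)
    show ?thesis using radial[where \<beta> = \<beta>] C0 B unfolding Poincare radial_rate.simps
      by (intro exI[of _ "\<Sum>j\<in>UNIV. B ^ (2 * \<beta> j - 1) * C j"] conjI sum_nonneg mult_nonneg_nonneg) auto
  next
    case (Parabolic \<beta> c)
    show ?thesis using radial[where \<beta> = \<beta>] C0 B unfolding Parabolic radial_rate.simps
      by (intro exI[of _ "\<Sum>j\<in>UNIV. B ^ (2 * \<beta> j - 1) * C j"] conjI sum_nonneg mult_nonneg_nonneg) auto
  qed
qed

text \<open>The weight has bounded logarithmic derivative along a bounded orbit, so it cannot reach \<open>0\<close>,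
  that is the horizon, in finite time.\<close>

lemma weight_pos_invariant:
  fixes f g :: "real ^ 'n::finite \<Rightarrow> real ^ 'n"
  assumes \<alpha>: "\<And>i. \<alpha> i \<ge> 1" and K: "admissible \<alpha> k K"
    and f: "C1 f" "asymptotically_quasi_homogeneous \<alpha> k f"
    and g: "\<And>z. weight K z > 0 \<Longrightarrow> g z = desing_field \<alpha> k K f z"
    and X: "\<And>s. s \<ge> 0 \<Longrightarrow> (X has_vector_derivative g (X s)) (at s within {0..})"
    and bdd: "bounded (X ` {0..})" and X0: "weight K (X 0) > 0" and s: "s \<ge> 0"
  shows "weight K (X s) > 0"
proof (rule ccontr)
  assume neg: "\<not> weight K (X s) > 0"
  obtain B where B: "\<And>s. s \<ge> 0 \<Longrightarrow> norm (X s) \<le> B" "B \<ge> 1"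
  proof -
    obtain B where "\<And>x. x \<in> X ` {0..} \<Longrightarrow> norm x \<le> B" using bdd bounded_pos by metis
    then show thesis by (intro that[of "max B 1"]) (auto simp: le_max_iff_disj)
  qed
  obtain C where C: "C \<ge> 0" "\<And>x. weight K x > 0 \<Longrightarrow> norm x \<le> B \<Longrightarrow> \<bar>radial_rate \<alpha> K x (rescaled_field \<alpha> k K f x)\<bar> \<le> C"
    using radial_rate_bounded[where \<alpha> = \<alpha>, OF \<alpha> K f B(2)] by blast
  define v where "v t = weight K (X t)" for t
  have contX: "continuous_on {0..} X"
    using X has_vector_derivative_continuous unfolding continuous_on_eq_continuous_within by fastforce
  have "continuous_on UNIV (weight K)"
    by (intro continuous_at_imp_continuous_on ballI continuous_weight)
  from continuous_on_compose2[OF this contX] have contv: "continuous_on {0..} v"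
    unfolding v_def by simp
  have contv': "continuous_on {0..t} v" for t
    by (rule continuous_on_subset[OF contv]) auto
  have zero: "\<exists>t. 0 \<le> t \<and> t \<le> r \<and> v t = 0" if "r \<ge> 0" "v r \<le> 0" for r
    using IVT2'[of v r 0 0] that X0 contv'[of r] by (auto simp: v_def)
  define Z where "Z = {t \<in> {0..s}. v t = 0}"
  have "compact Z"
  proof -
    have "Z = {0..s} \<inter> v -` {0}" by (auto simp: Z_def)
    moreover have "closed ({0..s} \<inter> v -` {0})"
      by (intro continuous_closed_preimage contv' closed_atLeastAtMost closed_singleton)
    moreover have "bounded Z" by (rule bounded_subset[of "{0..s}"]) (auto simp: Z_def)
    ultimately show ?thesis by (simp add: compact_eq_bounded_closed)
  qed
  moreover obtain t0 where "t0 \<in> Z"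
  proof -
    have "v s \<le> 0" using neg by (simp add: v_def)
    from zero[OF s this] show thesis using that by (auto simp: Z_def)
  qed
  \<comment> \<open>The earliest zero is taken because \<open>g\<close> is known to be the
    desingularized field only while the weight is positive.\<close>
  ultimately obtain t1 where t1: "t1 \<in> Z" "\<And>t. t \<in> Z \<Longrightarrow> t1 \<le> t"
    using compact_attains_inf[of Z] by blast
  have t1': "0 \<le> t1" "t1 \<le> s" "v t1 = 0" using t1(1) by (auto simp: Z_def)
  have pos: "v t > 0" if "0 \<le> t" "t < t1" for t
  proof (rule ccontr)
    assume "\<not> v t > 0"
    then have "v t \<le> 0" by simp
    from zero[OF that(1) this] obtain t' where "0 \<le> t'" "t' \<le> t" "v t' = 0" by blast
    then have "t' \<in> Z" using that t1' by (simp add: Z_def)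
    with t1(2) \<open>t' \<le> t\<close> that show False by fastforce
  qed
  define e where "e = real (weight_exp K)"
  \<comment> \<open>The logarithmic derivative of the weight is at least - e C, so this exponential
    factor makes \<open>u\<close> nondecreasing up to the first zero.\<close>
  define u where "u t = v t * exp (e * C * t)" for t
  have "u 0 \<le> u t1"
  proof (rule DERIV_nonneg_imp_increasing_open[OF t1'(1)])
    show "continuous_on {0..t1} u"
      unfolding u_def by (intro continuous_intros contv')
    fix t assume t: "0 < t" "t < t1"
    define G where "G = radial_rate \<alpha> K (X t) (rescaled_field \<alpha> k K f (X t))"
    have w: "weight K (X t) > 0" using pos[of t] t by (simp add: v_def)
    have "at t within {0..} = at t" using t by (intro at_within_interior) auto
    then have "(X has_vector_derivative desing_field \<alpha> k K f (X t)) (at t)"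
      using X[of t] t g[OF w] by simp
    from chart_velocity(2)[where \<alpha> = \<alpha>, OF \<alpha> K this]
    have "(v has_real_derivative - e * v t * G) (at t)"
      by (simp add: v_def[abs_def] e_def G_def)
    then have "(u has_real_derivative (- e * v t * G) * exp (e * C * t) + v t * (e * C * exp (e * C * t))) (at t)"
      unfolding u_def[abs_def] by (auto intro!: derivative_eq_intros)
    moreover have "(- e * v t * G) * exp (e * C * t) + v t * (e * C * exp (e * C * t)) = e * v t * exp (e * C * t) * (C - G)"
      by (simp add: algebra_simps)
    moreover have "e * v t * exp (e * C * t) * (C - G) \<ge> 0"
    proof -
      have "G \<le> C" using C(2)[OF w B(1)[of t]] t by (auto simp: G_def)
      then show ?thesis using pos[of t] t by (intro mult_nonneg_nonneg) (auto simp: e_def)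
    qed
    ultimately show "\<exists>y. (u has_real_derivative y) (at t) \<and> y \<ge> 0" by auto
  qed
  moreover have "u 0 > 0" using X0 by (simp add: u_def v_def)
  ultimately show False using t1'(3) by (simp add: u_def)
qed

section \<open>Image trajectories and the blow-up time\<close>

lemma tmap_differentiable:
  fixes y :: "real ^ 'n::finite"
  assumes "\<And>i. \<alpha> i \<ge> 1" "admissible \<alpha> k K" "y \<in> tdom K"
  shows "tmap \<alpha> K differentiable (at y)"
  by (rule real_analytic_components_differentiable[OF real_analytic_at_tmap[where \<alpha> = \<alpha>, OF assms]])

lemma continuous_on_tmap:
  fixes K :: "'n::finite compactification"
  assumes "\<And>i. \<alpha> i \<ge> 1" "admissible \<alpha> k K"
  shows "continuous_on (tdom K) (tmap \<alpha> K)"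
  using differentiable_imp_continuous_within[OF tmap_differentiable[where \<alpha> = \<alpha>, OF assms]]
  by (intro continuous_at_imp_continuous_on ballI)

text \<open>The derivative of \<open>tmap\<close> is read off from that of its explicit inverse \<open>tinv\<close>.\<close>

lemma tmap_velocity:
  fixes Y :: "real \<Rightarrow> real ^ 'n::finite"
  assumes \<alpha>: "\<And>i. \<alpha> i \<ge> 1" and K: "admissible \<alpha> k K" "k \<ge> 1" and y: "Y \<tau> \<in> tdom K"
    and Y: "(Y has_vector_derivative hfun k K (tmap \<alpha> K (Y \<tau>)) *\<^sub>R f (Y \<tau>)) (at \<tau> within S)"
  shows "((\<lambda>t. tmap \<alpha> K (Y t)) has_vector_derivative desing_field \<alpha> k K f (tmap \<alpha> K (Y \<tau>))) (at \<tau> within S)"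
proof -
  define x where "x = tmap \<alpha> K (Y \<tau>)"
  define V where "V = desing_field \<alpha> k K f x"
  \<comment> \<open>A straight line with velocity \<open>V\<close> suffices as test curve: only its
    first-order behaviour at 0 is needed, not a solution of the equation.\<close>
  define c where "c \<epsilon> = x + \<epsilon> *\<^sub>R V" for \<epsilon> :: real
  have c0: "c 0 = x" by (simp add: c_def)
  have w: "weight K x > 0" unfolding x_def by (rule weight_tmap_pos[where \<alpha> = \<alpha>, OF \<alpha> K(1) y])
  have tx: "tinv \<alpha> K x = Y \<tau>" unfolding x_def by (rule tinv_tmap[where \<alpha> = \<alpha>, OF \<alpha> K(1) y])
  obtain D where D: "(tmap \<alpha> K has_derivative D) (at (Y \<tau>))"
    using tmap_differentiable[where \<alpha> = \<alpha>, OF \<alpha> K(1) y] unfolding differentiable_def by blast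
  have c: "(c has_vector_derivative V) (at 0)"
    unfolding c_def[abs_def] by (auto intro!: derivative_eq_intros)
  then have "(c has_vector_derivative desing_field \<alpha> k K f (c 0)) (at 0)" by (simp add: c0 V_def)
  from tinv_velocity[where \<alpha> = \<alpha>, OF \<alpha> K _ this]
  have "((\<lambda>\<epsilon>. tinv \<alpha> K (c \<epsilon>)) has_vector_derivative hfun k K x *\<^sub>R f (Y \<tau>)) (at 0)"
    using w by (simp add: c0 tx)
  from vector_derivative_diff_chain_within[OF this, of "tmap \<alpha> K" D]
  have 1: "((\<lambda>\<epsilon>. tmap \<alpha> K (tinv \<alpha> K (c \<epsilon>))) has_vector_derivative D (hfun k K x *\<^sub>R f (Y \<tau>))) (at 0)"
    using has_derivative_at_withinI[OF D] by (simp add: c0 tx o_def)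
  have "isCont (\<lambda>\<epsilon>. weight K (c \<epsilon>)) 0"
    by (rule isCont_o2[OF has_vector_derivative_continuous[OF c] continuous_weight])
  then have "((\<lambda>\<epsilon>. weight K (c \<epsilon>)) \<longlongrightarrow> weight K (c 0)) (nhds 0)"
    unfolding isCont_def by (rule tendsto_at_iff_tendsto_nhds[where g = "\<lambda>\<epsilon>. weight K (c \<epsilon>)", THEN iffD1])
  then have "\<forall>\<^sub>F \<epsilon> in nhds 0. weight K (c \<epsilon>) > 0"
    by (rule order_tendstoD(1)) (use w in \<open>simp add: c0\<close>)
  then have ev: "\<forall>\<^sub>F \<epsilon> in nhds 0. tmap \<alpha> K (tinv \<alpha> K (c \<epsilon>)) = c \<epsilon>"
    by (rule eventually_mono) (rule tmap_tinv[where \<alpha> = \<alpha>, OF \<alpha> K(1)])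
  have "(c has_vector_derivative D (hfun k K x *\<^sub>R f (Y \<tau>))) (at 0)"
  proof -
    obtain U where "open U" "0 \<in> U" "\<And>\<epsilon>. \<epsilon> \<in> U \<Longrightarrow> tmap \<alpha> K (tinv \<alpha> K (c \<epsilon>)) = c \<epsilon>"
      using ev unfolding eventually_nhds by blast
    from has_vector_derivative_transform_within_open[OF 1 this] show ?thesis .
  qed
  then have "D (hfun k K x *\<^sub>R f (Y \<tau>)) = V" using c vector_derivative_unique_at by blast
  moreover have "((tmap \<alpha> K \<circ> Y) has_vector_derivative D (hfun k K x *\<^sub>R f (Y \<tau>))) (at \<tau> within S)"
    by (rule vector_derivative_diff_chain_within) (use Y has_derivative_at_withinI[OF D] in \<open>simp_all add: x_def\<close>)
  ultimately show ?thesis by (simp add: V_def x_def o_def)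
qed

lemma image_trajectoryD:
  fixes x :: "real \<Rightarrow> real ^ 'n::finite"
  assumes \<alpha>: "\<And>i. \<alpha> i \<ge> 1" and K: "admissible \<alpha> k K" "k \<ge> 1"
    and traj: "image_trajectory \<alpha> k K f t0 \<tau>0 y x"
  shows "y \<in> tdom K" "x \<tau>0 = tmap \<alpha> K y"
    "\<And>\<tau>. \<tau> \<ge> \<tau>0 \<Longrightarrow> weight K (x \<tau>) > 0"
    "\<And>\<tau>. \<tau> \<ge> \<tau>0 \<Longrightarrow> (x has_vector_derivative desing_field \<alpha> k K f (x \<tau>)) (at \<tau> within {\<tau>0..})"
proof -
  obtain J Y t where Y0: "Y t0 = y" and t0: "t \<tau>0 = t0"
    and Y: "\<And>u. u \<in> J \<Longrightarrow> (Y has_vector_derivative f (Y u)) (at u within J)"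
    and t: "\<And>\<tau>. \<tau> \<ge> \<tau>0 \<Longrightarrow> t \<tau> \<in> J" "\<And>\<tau>. \<tau> \<ge> \<tau>0 \<Longrightarrow> Y (t \<tau>) \<in> tdom K"
      "\<And>\<tau>. \<tau> \<ge> \<tau>0 \<Longrightarrow> x \<tau> = tmap \<alpha> K (Y (t \<tau>))"
      "\<And>\<tau>. \<tau> \<ge> \<tau>0 \<Longrightarrow> (t has_real_derivative hfun k K (x \<tau>)) (at \<tau> within {\<tau>0..})"
    using traj unfolding image_trajectory_def by blast
  show "y \<in> tdom K" "x \<tau>0 = tmap \<alpha> K y" using t(2,3)[of \<tau>0] Y0 t0 by auto
  show "weight K (x \<tau>) > 0" if "\<tau> \<ge> \<tau>0" for \<tau>
    unfolding t(3)[OF that] by (rule weight_tmap_pos[where \<alpha> = \<alpha>, OF \<alpha> K(1) t(2)[OF that]])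
  show "(x has_vector_derivative desing_field \<alpha> k K f (x \<tau>)) (at \<tau> within {\<tau>0..})" if \<tau>: "\<tau> \<ge> \<tau>0" for \<tau>
  proof -
    have "((Y \<circ> t) has_vector_derivative hfun k K (x \<tau>) *\<^sub>R f (Y (t \<tau>))) (at \<tau> within {\<tau>0..})"
    proof (rule vector_diff_chain_within)
      show "(t has_vector_derivative hfun k K (x \<tau>)) (at \<tau> within {\<tau>0..})"
        using t(4)[OF \<tau>] by (simp add: has_real_derivative_iff_has_vector_derivative)
      show "(Y has_vector_derivative f (Y (t \<tau>))) (at (t \<tau>) within t ` {\<tau>0..})"
        by (rule has_vector_derivative_within_subset[OF Y[OF t(1)[OF \<tau>]]]) (use t(1) in auto)
    qed
    then have "((\<lambda>s. tmap \<alpha> K ((Y \<circ> t) s)) has_vector_derivative desing_field \<alpha> k K f (tmap \<alpha> K ((Y \<circ> t) \<tau>))) (at \<tau> within {\<tau>0..})"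
      by (intro tmap_velocity[where \<alpha> = \<alpha>, OF \<alpha> K]) (use t(2,3)[OF \<tau>] in \<open>simp_all add: o_def\<close>)
    then have "((\<lambda>s. tmap \<alpha> K ((Y \<circ> t) s)) has_vector_derivative desing_field \<alpha> k K f (x \<tau>)) (at \<tau> within {\<tau>0..})"
      using t(3)[OF \<tau>] by simp
    then show ?thesis
      by (rule has_vector_derivative_transform[rotated 2]) (use t(3) \<tau> in auto)
  qed
qed

text \<open>\<open>t\<close> is the primitive of \<open>h\<close>, and \<open>r\<close> is its
  inverse. At the initial time the derivatives are one-sided, so the derivative of \<open>r\<close>
  is computed from difference quotients within the range of \<open>t\<close>.\<close>

lemma inverse_time_change:
  fixes h :: "real \<Rightarrow> real"
  assumes h: "continuous_on {a..} h" "\<And>\<tau>. \<tau> \<ge> a \<Longrightarrow> h \<tau> > 0"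
  obtains t r where "t a = b" "\<And>\<tau>. \<tau> \<ge> a \<Longrightarrow> (t has_real_derivative h \<tau>) (at \<tau> within {a..})"
    "\<And>\<tau>. \<tau> \<ge> a \<Longrightarrow> r (t \<tau>) = \<tau>" "\<And>\<tau>. \<tau> \<ge> a \<Longrightarrow> t \<tau> \<ge> b"
    "\<And>\<tau>. \<tau> \<ge> a \<Longrightarrow> (r has_real_derivative inverse (h \<tau>)) (at (t \<tau>) within t ` {a..})"
    "is_interval (t ` {a..})"
proof -
  define t where "t \<tau> = b + integral {a..\<tau>} h" for \<tau>
  have loc: "at \<tau> within {a..\<tau> + 1} = at \<tau> within {a..}" for \<tau>
    by (rule at_within_nhd[of \<tau> "{..<\<tau> + 1}"]) auto
  have t: "(t has_real_derivative h \<tau>) (at \<tau> within {a..})" if "\<tau> \<ge> a" for \<tau>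
  proof -
    have "continuous_on {a..\<tau> + 1} h" by (rule continuous_on_subset[OF h(1)]) auto
    then have "((\<lambda>u. integral {a..u} h) has_real_derivative h \<tau>) (at \<tau> within {a..\<tau> + 1})"
      by (rule integral_has_real_derivative) (use that in auto)
    then show ?thesis unfolding t_def[abs_def] loc by (auto intro!: derivative_eq_intros)
  qed
  have contt: "continuous_on {a..} t" using t by (intro DERIV_continuous_on) auto
  have mono: "t \<sigma> < t \<tau>" if "a \<le> \<sigma>" "\<sigma> < \<tau>" for \<sigma> \<tau>
  proof (rule DERIV_pos_imp_increasing_open[OF that(2)])
    show "continuous_on {\<sigma>..\<tau>} t" by (rule continuous_on_subset[OF contt]) (use that in auto)
    fix s assume s: "\<sigma> < s" "s < \<tau>"
    have "at s within {a..} = at s" using s that by (intro at_within_interior) auto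
    then show "\<exists>y. (t has_real_derivative y) (at s) \<and> 0 < y" using t[of s] h(2)[of s] s that by auto
  qed
  have inj: "inj_on t {a..}"
  proof (rule inj_onI)
    fix x y assume "x \<in> {a..}" "y \<in> {a..}" "t x = t y"
    then show "x = y" using mono[of x y] mono[of y x] by (cases x y rule: linorder_cases) auto
  qed
  define r where "r = inv_into {a..} t"
  have r: "r (t \<tau>) = \<tau>" if "\<tau> \<ge> a" for \<tau>
    unfolding r_def by (rule inv_into_f_f[OF inj]) (use that in auto)
  have ta: "t a = b" by (simp add: t_def)
  have "(r has_real_derivative inverse (h \<tau>)) (at (t \<tau>) within t ` {a..})" if \<tau>: "\<tau> \<ge> a" for \<tau>
  proof -
    \<comment> \<open>Compactness of the interval gives continuity of the inverse; one extra unit of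
      time makes its image a neighbourhood of \<open>t \<tau>\<close> in the full range.\<close>
    have "continuous_on (t ` {a..\<tau> + 1}) r"
      by (rule continuous_on_inv) (use r in \<open>auto intro: continuous_on_subset[OF contt]\<close>)
    then have "(r \<longlongrightarrow> r (t \<tau>)) (at (t \<tau>) within t ` {a..\<tau> + 1})"
      using \<tau> unfolding continuous_on_def by auto
    moreover have "at (t \<tau>) within t ` {a..\<tau> + 1} = at (t \<tau>) within t ` {a..}"
    proof (rule at_within_nhd[of _ "{..<t (\<tau> + 1)}"])
      have "\<sigma> \<le> \<tau> + 1" if "t \<sigma> < t (\<tau> + 1)" "a \<le> \<sigma>" for \<sigma>
        using mono[of "\<tau> + 1" \<sigma>] that \<tau> by (cases "\<sigma> \<le> \<tau> + 1") auto
      then show "t ` {a..\<tau> + 1} \<inter> {..<t (\<tau> + 1)} - {t \<tau>} = t ` {a..} \<inter> {..<t (\<tau> + 1)} - {t \<tau>}"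
        by force
    qed (use mono[OF \<tau>, of "\<tau> + 1"] in auto)
    ultimately have rlim: "(r \<longlongrightarrow> \<tau>) (at (t \<tau>) within t ` {a..})" using r[OF \<tau>] by simp
    have "filterlim r (at \<tau> within {a..}) (at (t \<tau>) within t ` {a..})"
      unfolding filterlim_at
    proof
      show "\<forall>\<^sub>F v in at (t \<tau>) within t ` {a..}. r v \<in> {a..} \<and> r v \<noteq> \<tau>"
        unfolding eventually_at_filter by (rule always_eventually) (use r in auto)
    qed (rule rlim)
    moreover have "((\<lambda>\<sigma>. inverse ((t \<sigma> - t \<tau>) / (\<sigma> - \<tau>))) \<longlongrightarrow> inverse (h \<tau>)) (at \<tau> within {a..})"
      using t[OF \<tau>] h(2)[OF \<tau>] unfolding has_field_derivative_iff by (intro tendsto_inverse) auto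
    ultimately have "((\<lambda>v. inverse ((t (r v) - t \<tau>) / (r v - \<tau>))) \<longlongrightarrow> inverse (h \<tau>)) (at (t \<tau>) within t ` {a..})"
      by (rule filterlim_compose[rotated])
    moreover have "\<forall>\<^sub>F v in at (t \<tau>) within t ` {a..}. inverse ((t (r v) - t \<tau>) / (r v - \<tau>)) = (r v - r (t \<tau>)) / (v - t \<tau>)"
      unfolding eventually_at_filter by (rule always_eventually) (use r \<tau> in auto)
    ultimately show ?thesis
      unfolding has_field_derivative_iff by (rule Lim_transform_eventually)
  qed
  moreover have "t \<tau> \<ge> b" if "\<tau> \<ge> a" for \<tau>
    using mono[of a \<tau>] that ta by (cases "\<tau> = a") auto
  moreover have "is_interval (t ` {a..})"
    unfolding is_interval_connected_1 by (intro connected_continuous_image contt connected_Ici)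
  ultimately show thesis using ta t r by (intro that[of t r])
qed

lemma continuous_hpoly: "continuous_on UNIV (hpoly k K)"
proof (cases K)
  case (Directional d)
  then have eq: "hpoly k K = (\<lambda>x. (x $ d) ^ k)" by auto
  show ?thesis unfolding eq by (intro continuous_intros)
next
  case (Poincare \<beta> c)
  then have eq: "hpoly k K = (\<lambda>x. weight K x ^ (k div (2 * c)))" by auto
  show ?thesis unfolding eq
    by (intro continuous_intros continuous_at_imp_continuous_on ballI continuous_weight)
next
  case (Parabolic \<beta> c)
  then have eq: "hpoly k K = (\<lambda>x. (1 - (2 * real c - 1) / (2 * real c) * weight K x) * weight K x ^ k)"
    by (intro ext) (simp only: Parabolic hpoly.simps time_factor.simps)
  show ?thesis unfolding eq
    by (intro continuous_intros continuous_at_imp_continuous_on ballI continuous_weight)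
qed

text \<open>The converse passage from the chart to the original equation: the time t is recovered by
  integrating h along \<open>X\<close>, and the solution is \<open>tinv\<close> of \<open>X\<close>
  read in that time, on the interval of all times so reached.\<close>

lemma image_trajectory_exists:
  fixes X :: "real \<Rightarrow> real ^ 'n::finite"
  assumes \<alpha>: "\<And>i. \<alpha> i \<ge> 1" and K: "admissible \<alpha> k K" "k \<ge> 1"
    and y: "y \<in> tdom K" and X0: "X \<tau>0 = tmap \<alpha> K y"
    and w: "\<And>\<tau>. \<tau> \<ge> \<tau>0 \<Longrightarrow> weight K (X \<tau>) > 0"
    and X: "\<And>\<tau>. \<tau> \<ge> \<tau>0 \<Longrightarrow> (X has_vector_derivative desing_field \<alpha> k K f (X \<tau>)) (at \<tau> within {\<tau>0..})"
  shows "image_trajectory \<alpha> k K f t0 \<tau>0 y X"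
proof -
  define h where "h \<tau> = hfun k K (X \<tau>)" for \<tau>
  have h: "h \<tau> > 0" if "\<tau> \<ge> \<tau>0" for \<tau> unfolding h_def by (rule hfun_pos[OF K w[OF that]])
  have contX: "continuous_on {\<tau>0..} X"
    using X has_vector_derivative_continuous unfolding continuous_on_eq_continuous_within by fastforce
  have ch: "continuous_on UNIV (hpoly k K)" by (rule continuous_hpoly)
  have "continuous_on {\<tau>0..} (\<lambda>\<tau>. hpoly k K (X \<tau>))"
    using continuous_on_compose2[OF ch contX] by simp
  then have conth: "continuous_on {\<tau>0..} h"
    by (rule continuous_on_eq) (use w in \<open>auto simp: h_def hfun_eq_hpoly[OF K] less_imp_le\<close>)
  obtain t r where t: "t \<tau>0 = t0" "\<And>\<tau>. \<tau> \<ge> \<tau>0 \<Longrightarrow> (t has_real_derivative h \<tau>) (at \<tau> within {\<tau>0..})"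
    "\<And>\<tau>. \<tau> \<ge> \<tau>0 \<Longrightarrow> r (t \<tau>) = \<tau>" "\<And>\<tau>. \<tau> \<ge> \<tau>0 \<Longrightarrow> t \<tau> \<ge> t0"
    "\<And>\<tau>. \<tau> \<ge> \<tau>0 \<Longrightarrow> (r has_real_derivative inverse (h \<tau>)) (at (t \<tau>) within t ` {\<tau>0..})"
    "is_interval (t ` {\<tau>0..})"
    by (rule inverse_time_change[OF conth h, of t0], assumption) (rule that)
  define Y where "Y u = tinv \<alpha> K (X (r u))" for u
  have "(Y has_vector_derivative f (Y u)) (at u within t ` {\<tau>0..})" if "u \<in> t ` {\<tau>0..}" for u
  proof -
    from that obtain \<tau> where \<tau>: "\<tau> \<ge> \<tau>0" "u = t \<tau>" unfolding image_iff by fastforce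
    have "(((\<lambda>\<tau>. tinv \<alpha> K (X \<tau>)) \<circ> r) has_vector_derivative inverse (h \<tau>) *\<^sub>R (h \<tau> *\<^sub>R f (tinv \<alpha> K (X \<tau>)))) (at u within t ` {\<tau>0..})"
    proof (rule vector_diff_chain_within)
      show "(r has_vector_derivative inverse (h \<tau>)) (at u within t ` {\<tau>0..})"
        using t(5)[OF \<tau>(1)] by (simp add: \<tau>(2) has_real_derivative_iff_has_vector_derivative)
      have "((\<lambda>\<tau>. tinv \<alpha> K (X \<tau>)) has_vector_derivative h \<tau> *\<^sub>R f (tinv \<alpha> K (X \<tau>))) (at \<tau> within {\<tau>0..})"
        unfolding h_def by (rule tinv_velocity[where \<alpha> = \<alpha>, OF \<alpha> K w[OF \<tau>(1)] X[OF \<tau>(1)]])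
      then have "((\<lambda>\<tau>. tinv \<alpha> K (X \<tau>)) has_vector_derivative h \<tau> *\<^sub>R f (tinv \<alpha> K (X \<tau>))) (at \<tau> within r ` t ` {\<tau>0..})"
        by (rule has_vector_derivative_within_subset) (use t(3) in auto)
      then show "((\<lambda>\<tau>. tinv \<alpha> K (X \<tau>)) has_vector_derivative h \<tau> *\<^sub>R f (tinv \<alpha> K (X \<tau>))) (at (r u) within r ` t ` {\<tau>0..})"
        by (simp add: \<tau> t(3))
    qed
    then show ?thesis using h[OF \<tau>(1)] t(3)[OF \<tau>(1)] by (simp add: Y_def[abs_def] o_def \<tau>(2))
  qed
  moreover have "Y t0 = y"
    using t(1) t(3)[of \<tau>0] X0 tinv_tmap[where \<alpha> = \<alpha>, OF \<alpha> K(1) y] by (simp add: Y_def)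
  moreover have "Y (t \<tau>) \<in> tdom K" "X \<tau> = tmap \<alpha> K (Y (t \<tau>))" if "\<tau> \<ge> \<tau>0" for \<tau>
    using tinv_in_tdom[OF K(1) w[OF that]] tmap_tinv[where \<alpha> = \<alpha>, OF \<alpha> K(1) w[OF that]] t(3)[OF that]
    by (simp_all add: Y_def)
  moreover have "t0 \<in> t ` {\<tau>0..}" using t(1) by force
  moreover have "t ` {\<tau>0..} \<subseteq> {t0..}" using t(4) by auto
  ultimately show ?thesis
    unfolding image_trajectory_def using t(1,2,6)
    by (intro exI[of _ "t ` {\<tau>0..}"] exI[of _ Y] exI[of _ t]) (auto simp: h_def)
qed

lemma diag_flow_add: "diag_flow lam a (diag_flow lam b \<theta>) = diag_flow lam (a + b) \<theta>"
  by (simp add: diag_flow_def vec_eq_iff algebra_simps exp_add)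

text \<open>The orbit of \<theta> keeps positive weight, hence is itself an image trajectory. Any
  image trajectory from \<open>y\<close> solves the same polynomial equation and agrees with it by
  uniqueness. This makes the definite description in \<open>blowup_time\<close> well
  determined.\<close>

lemma stable_manifold_blowup_time:
  fixes f g :: "real ^ 'n::finite \<Rightarrow> real ^ 'n" and P :: "real ^ 'm::finite \<Rightarrow> real ^ 'n"
  assumes \<alpha>: "\<And>i. \<alpha> i \<ge> 1" and K: "admissible \<alpha> k K" "k \<ge> 1"
    and f: "C1 f" "asymptotically_quasi_homogeneous \<alpha> k f"
    and g_eq: "\<And>z. weight K z > 0 \<Longrightarrow> g z = desing_field \<alpha> k K f z"
    and g: "polynomial_function g" and param: "stable_parameterization g p lam \<xi> a P"
    and lam: "\<And>j. lam j < 0"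
    and \<Phi>: "\<And>\<theta> a. \<theta> \<in> unit_cube \<Longrightarrow> (\<And>s. s \<ge> a \<Longrightarrow> hpoly k K (P (diag_flow lam (s - a) \<theta>)) \<ge> 0) \<Longrightarrow>
       ((\<lambda>s. hpoly k K (P (diag_flow lam (s - a) \<theta>))) has_integral \<Phi> \<theta>) {a..}"
    and y: "y \<in> tdom K" and \<theta>: "\<theta> \<in> unit_cube" "tmap \<alpha> K y = P \<theta>"
  shows "blowup_time \<alpha> k K f t0 \<tau>0 y = t0 + \<Phi> \<theta>"
    and "\<And>x \<tau>. image_trajectory \<alpha> k K f t0 \<tau>0 y x \<Longrightarrow> \<tau> \<ge> \<tau>0 \<Longrightarrow> x \<tau> = P (diag_flow lam (\<tau> - \<tau>0) \<theta>)"
    and "\<And>\<sigma>. \<sigma> \<ge> \<tau>0 \<Longrightarrow> ((\<lambda>\<tau>. hfun k K (P (diag_flow lam (\<tau> - \<tau>0) \<theta>))) has_integral \<Phi> (diag_flow lam (\<sigma> - \<tau>0) \<theta>)) {\<sigma>..}"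
proof -
  define X where "X \<tau> = P (diag_flow lam (\<tau> - \<tau>0) \<theta>)" for \<tau>
  obtain M where M: "\<And>i. power_series_bound 0 1 (\<lambda>\<theta>. P \<theta> $ i) (M i)"
    by (rule stable_parameterization_power_series[OF param]) blast
  have w0: "weight K (P \<theta>) > 0"
    using weight_tmap_pos[where \<alpha> = \<alpha>, OF \<alpha> K(1) y] \<theta>(2) by simp
  have bdd: "bounded ((\<lambda>s. P (diag_flow lam s \<theta>)) ` {0..})"
    by (rule bounded_subset[OF bounded_if_power_series_bound[OF M]])
       (use diag_flow_in_unit_cube[where lam = lam, OF lam _ \<theta>(1)] in auto)
  have wP: "weight K (P (diag_flow lam s \<theta>)) > 0" if "s \<ge> 0" for s
    by (rule weight_pos_invariant[where \<alpha> = \<alpha> and X = "\<lambda>s. P (diag_flow lam s \<theta>)",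
          OF \<alpha> K(1) f g_eq stable_parameterization_solution[OF g param \<theta>(1)] bdd _ that])
       (use w0 in simp_all)
  have w: "weight K (X \<tau>) > 0" if "\<tau> \<ge> \<tau>0" for \<tau>
    unfolding X_def by (rule wP) (use that in simp)
  have Xg: "(X has_vector_derivative g (X \<tau>)) (at \<tau> within {\<tau>0..})" if "\<tau> \<ge> \<tau>0" for \<tau>
  proof -
    have "(((\<lambda>s. P (diag_flow lam s \<theta>)) \<circ> (\<lambda>\<tau>. \<tau> - \<tau>0)) has_vector_derivative 1 *\<^sub>R g (P (diag_flow lam (\<tau> - \<tau>0) \<theta>))) (at \<tau> within {\<tau>0..})"
    proof (rule vector_diff_chain_within)
      show "((\<lambda>\<tau>. \<tau> - \<tau>0) has_vector_derivative 1) (at \<tau> within {\<tau>0..})"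
        by (auto intro!: derivative_eq_intros)
      show "((\<lambda>s. P (diag_flow lam s \<theta>)) has_vector_derivative g (P (diag_flow lam (\<tau> - \<tau>0) \<theta>)))
          (at (\<tau> - \<tau>0) within (\<lambda>\<tau>. \<tau> - \<tau>0) ` {\<tau>0..})"
        by (rule has_vector_derivative_within_subset[OF stable_parameterization_solution[OF g param \<theta>(1)]])
           (use that in auto)
    qed
    then show ?thesis by (simp add: X_def[abs_def] o_def)
  qed
  have Xd: "(X has_vector_derivative desing_field \<alpha> k K f (X \<tau>)) (at \<tau> within {\<tau>0..})" if "\<tau> \<ge> \<tau>0" for \<tau>
    using Xg[OF that] g_eq[OF w[OF that]] by simp
  have X0: "X \<tau>0 = tmap \<alpha> K y" using \<theta>(2) by (simp add: X_def)
  have ex: "image_trajectory \<alpha> k K f t0 \<tau>0 y X"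
    by (rule image_trajectory_exists[where \<alpha> = \<alpha>, OF \<alpha> K y X0 w Xd])
  have uniq: "x \<tau> = X \<tau>" if x: "image_trajectory \<alpha> k K f t0 \<tau>0 y x" and \<tau>: "\<tau> \<ge> \<tau>0" for x \<tau>
  proof (rule polynomial_ode_unique[OF g \<tau>])
    note D = image_trajectoryD[where \<alpha> = \<alpha>, OF \<alpha> K x]
    fix s assume s: "s \<in> {\<tau>0..\<tau>}"
    have "(x has_vector_derivative g (x s)) (at s within {\<tau>0..})"
      using D(4)[of s] g_eq[OF D(3)[of s]] s by simp
    then show "(x has_vector_derivative g (x s)) (at s within {\<tau>0..\<tau>})"
      by (rule has_vector_derivative_within_subset) auto
    show "(X has_vector_derivative g (X s)) (at s within {\<tau>0..\<tau>})"
      by (rule has_vector_derivative_within_subset[OF Xg]) (use s in auto)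
  next
    show "x \<tau>0 = X \<tau>0" using image_trajectoryD(2)[where \<alpha> = \<alpha>, OF \<alpha> K x] X0 by simp
  qed
  then show "x \<tau> = P (diag_flow lam (\<tau> - \<tau>0) \<theta>)" if "image_trajectory \<alpha> k K f t0 \<tau>0 y x" "\<tau> \<ge> \<tau>0" for x \<tau>
    using that by (simp add: X_def)
  have hX: "hpoly k K (X \<tau>) = hfun k K (X \<tau>)" "hfun k K (X \<tau>) > 0" if "\<tau> \<ge> \<tau>0" for \<tau>
    using hfun_eq_hpoly[OF K, of "X \<tau>"] hfun_pos[OF K, of "X \<tau>"] w[OF that] by auto
  have int: "((\<lambda>\<tau>. hfun k K (X \<tau>)) has_integral \<Phi> (diag_flow lam (\<sigma> - \<tau>0) \<theta>)) {\<sigma>..}" if \<sigma>: "\<sigma> \<ge> \<tau>0" for \<sigma>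
  proof -
    \<comment> \<open>By the semigroup property the tail from \<sigma> on is the orbit of the flowed
      parameter, so the integral formula can be restarted there.\<close>
    have eq: "P (diag_flow lam (s - \<sigma>) (diag_flow lam (\<sigma> - \<tau>0) \<theta>)) = X s" for s
      by (simp add: diag_flow_add X_def)
    have "diag_flow lam (\<sigma> - \<tau>0) \<theta> \<in> unit_cube"
      using diag_flow_in_unit_cube[where lam = lam, OF lam _ \<theta>(1)] \<sigma> by simp
    from \<Phi>[OF this, of \<sigma>, unfolded eq]
    have "((\<lambda>s. hpoly k K (X s)) has_integral \<Phi> (diag_flow lam (\<sigma> - \<tau>0) \<theta>)) {\<sigma>..}"
      using hX \<sigma> by (simp add: less_imp_le)
    then show ?thesis
      by (rule has_integral_eq[rotated]) (use hX \<sigma> in auto)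
  qed
  then show "((\<lambda>\<tau>. hfun k K (P (diag_flow lam (\<tau> - \<tau>0) \<theta>))) has_integral \<Phi> (diag_flow lam (\<sigma> - \<tau>0) \<theta>)) {\<sigma>..}" if "\<sigma> \<ge> \<tau>0" for \<sigma>
    using that by (simp add: X_def)
  have int0: "((\<lambda>\<tau>. hfun k K (X \<tau>)) has_integral \<Phi> \<theta>) {\<tau>0..}"
    using int[of \<tau>0] by simp
  show "blowup_time \<alpha> k K f t0 \<tau>0 y = t0 + \<Phi> \<theta>"
    unfolding blowup_time_def
  proof (rule the_equality)
    show "\<exists>x. image_trajectory \<alpha> k K f t0 \<tau>0 y x \<and> ((\<lambda>\<tau>. hfun k K (x \<tau>)) has_integral (t0 + \<Phi> \<theta> - t0)) {\<tau>0..}"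
      using ex int0 by (intro exI[of _ X]) simp
    fix b assume "\<exists>x. image_trajectory \<alpha> k K f t0 \<tau>0 y x \<and> ((\<lambda>\<tau>. hfun k K (x \<tau>)) has_integral (b - t0)) {\<tau>0..}"
    then obtain x where x: "image_trajectory \<alpha> k K f t0 \<tau>0 y x" "((\<lambda>\<tau>. hfun k K (x \<tau>)) has_integral (b - t0)) {\<tau>0..}"
      by blast
    have "((\<lambda>\<tau>. hfun k K (X \<tau>)) has_integral (b - t0)) {\<tau>0..}"
      by (rule has_integral_eq[OF _ x(2)]) (use uniq[OF x(1)] in auto)
    with int0 have "b - t0 = \<Phi> \<theta>" using has_integral_unique by blast
    then show "b = t0 + \<Phi> \<theta>" by simp
  qed
qed

text \<open>The first conjunct certifies that the integral converges, so that
  \<open>blowup_time\<close> is its value and not an unspecified number. An interior point in the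
  sense of the second conjunct can exist only if the manifold has full dimension; the third conjunct
  expresses analyticity along a manifold of any dimension.\<close>

theorem theorem4p5:
  fixes f g :: "real ^ 'n::finite \<Rightarrow> real ^ 'n"
    and \<alpha> :: "'n \<Rightarrow> nat" and k :: nat
    and K :: "'n compactification"
    and p :: "real ^ 'n"
    and lam :: "'m::finite \<Rightarrow> real" and \<xi> :: "'m \<Rightarrow> real ^ 'n"
    and a :: "('m \<Rightarrow> nat) \<Rightarrow> real ^ 'n" and P :: "real ^ 'm \<Rightarrow> real ^ 'n"
    and W :: "(real ^ 'n) set"
    and t0 \<tau>0 :: real and y0 :: "real ^ 'n" and x :: "real \<Rightarrow> real ^ 'n"
  assumes "\<And>i. \<alpha> i \<ge> 1" and "k \<ge> 1"
    and "C1 f" and "asymptotically_quasi_homogeneous \<alpha> k f"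
    and "admissible \<alpha> k K"
    and g_eq: "\<And>z. z \<in> image_dom K \<Longrightarrow> g z = desing_field \<alpha> k K f z"
    and p_horizon: "p \<in> horizon K"
    and g_analytic: "\<exists>U. open U \<and> p \<in> U \<and> (\<forall>z\<in>U. \<forall>i. real_analytic_at (\<lambda>v. g v $ i) z)"
    and A1: "polynomial_function g" "g p = 0"
    and A2: "spectral_conditions g p lam \<xi>"
    and A3: "non_resonant lam"
    and param: "stable_parameterization g p lam \<xi> a P"
    and W_eq: "W = P ` unit_cube"
    and traj: "image_trajectory \<alpha> k K f t0 \<tau>0 y0 x"
    and traj_in_W: "\<And>\<tau>. \<tau> \<ge> \<tau>0 \<Longrightarrow> x \<tau> \<in> W"
  shows "((\<lambda>\<tau>. hfun k K (x \<tau>)) has_integral (blowup_time \<alpha> k K f t0 \<tau>0 y0 - t0)) {\<tau>0..} \<and>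
         (y0 \<in> (top_of_set (tpreimage \<alpha> K (image_dom K))) interior_of (tpreimage \<alpha> K W) \<longrightarrow>
            real_analytic_at (blowup_time \<alpha> k K f t0 \<tau>0) y0) \<and>
         (y0 \<in> tpreimage \<alpha> K (P ` open_unit_cube) \<longrightarrow>
            real_analytic_within (blowup_time \<alpha> k K f t0 \<tau>0) y0 (tpreimage \<alpha> K W)) \<and>
         ((\<lambda>\<sigma>. integral {\<sigma>..} (\<lambda>\<tau>. hfun k K (x \<tau>))) \<longlongrightarrow> 0) at_top"
proof -

  \<comment> \<open>Spectral data, the series \<open>\<Phi>\<close> and the global estimate\<close>
  note \<alpha> = assms(1) and k = assms(2) and f = assms(3,4) and K = assms(5)
  have dom: "image_dom K = {x. weight K x > 0}" by (rule image_dom_eq[OF K])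
  have g_eq': "g z = desing_field \<alpha> k K f z" if "weight K z > 0" for z
    by (rule g_eq) (use that in \<open>simp add: dom\<close>)
  have g: "polynomial_function g" by (rule A1(1))
  define A where "A = frechet_derivative g (at p)"
  have A2': "card (eigenvalues A) = CARD('n)" "inj lam" "range lam = {\<mu> \<in> eigenvalues A. \<mu> < 0}"
    "\<And>j. \<xi> j \<noteq> 0" "\<And>j. A (\<xi> j) = lam j *\<^sub>R \<xi> j"
    using A2 unfolding spectral_conditions_def A_def Let_def by blast+
  have lam: "lam j < 0" for j using A2'(3) by blast
  \<comment> \<open>Distinct rates are distinct eigenvalues, of which there are
    \<open>CARD('n)\<close>. Invariance of domain will need this inequality.\<close>
  have dimle: "CARD('m) \<le> CARD('n)"
  proof -
    have "finite (eigenvalues A)" using A2'(1) card.infinite by fastforce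
    then have "card (range lam) \<le> card (eigenvalues A)" by (rule card_mono) (use A2'(3) in blast)
    then show ?thesis using A2'(1) card_image[OF A2'(2)] by simp
  qed
  have linA: "linear A"
    unfolding A_def using linear_frechet_derivative differentiable_at_polynomial_function[OF g] by blast
  have inj\<xi>: "inj (\<lambda>v :: real ^ 'm. \<Sum>j\<in>UNIV. v $ j *\<^sub>R \<xi> j)"
  proof -
    have lin: "linear (\<lambda>v :: real ^ 'm. \<Sum>j\<in>UNIV. v $ j *\<^sub>R \<xi> j)"
      by (intro linear_compose_sum ballI linearI) (auto simp: algebra_simps)
    have "v = 0" if "(\<Sum>j\<in>UNIV. v $ j *\<^sub>R \<xi> j) = 0" for v :: "real ^ 'm"
      using independent_eigenvectors[where \<xi> = \<xi> and v = "\<lambda>j. v $ j", OF linA A2'(2,4,5) finite that] by (simp add: vec_eq_iff)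
    then show ?thesis using linear_injective_0[OF lin] by blast
  qed
  obtain M where M: "\<And>i. power_series_bound 0 1 (\<lambda>\<theta>. P \<theta> $ i) (M i)"
    by (rule stable_parameterization_power_series[OF param]) blast
  have P0: "P 0 = p" using param by (simp add: stable_parameterization_def)
  obtain Mh where "power_series_bound 0 1 (\<lambda>\<theta>. hpoly k K (P \<theta>)) Mh"
    using power_series_bound_hpoly[where P = P, OF M] by blast
  \<comment> \<open>The parameter 0 is sent to \<open>p\<close> on the horizon, where h vanishes;
    this removes the constant term, which could not be integrated to infinity.\<close>
  then have hP: "power_series_bound 1 1 (\<lambda>\<theta>. hpoly k K (P \<theta>)) Mh"
    by (rule power_series_bound_vanish) (use P0 hpoly_horizon[OF K k p_horizon] in simp_all)
  obtain \<Phi> M\<Phi> where \<Phi>: "power_series_bound 1 1 \<Phi> M\<Phi>"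
    and \<Phi>_int: "\<And>\<theta> a. \<theta> \<in> unit_cube \<Longrightarrow> (\<And>s. s \<ge> a \<Longrightarrow> hpoly k K (P (diag_flow lam (s - a) \<theta>)) \<ge> 0) \<Longrightarrow>
       ((\<lambda>s. hpoly k K (P (diag_flow lam (s - a) \<theta>))) has_integral \<Phi> \<theta>) {a..}"
    by (rule improper_diag_flow_integral[where lam = lam, OF hP lam]) blast
  note st = stable_manifold_blowup_time[where \<alpha> = \<alpha> and \<Phi> = \<Phi>, OF \<alpha> K k f g_eq' g param lam \<Phi>_int]
  have st1: "blowup_time \<alpha> k K f t0 \<tau>0 y = t0 + \<Phi> \<theta>"
    if "y \<in> tdom K" "\<theta> \<in> unit_cube" "tmap \<alpha> K y = P \<theta>" for y \<theta>
    by (rule st(1)[OF _ _ _ that]) simp_all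
  obtain c where c: "c > 0" and expanding:
    "\<And>\<theta> \<theta>'. \<theta> \<in> unit_cube \<Longrightarrow> \<theta>' \<in> unit_cube \<Longrightarrow> c * norm (\<theta> - \<theta>') \<le> norm (P \<theta> - P \<theta>')"
    by (rule stable_parameterization_expanding[OF g param lam inj\<xi>]) blast

  \<comment> \<open>The given trajectory and its integral\<close>
  have y0: "y0 \<in> tdom K" "x \<tau>0 = tmap \<alpha> K y0"
    using image_trajectoryD(1,2)[where \<alpha> = \<alpha>, OF \<alpha> K k traj] by blast+
  obtain \<theta>0 where \<theta>0: "\<theta>0 \<in> unit_cube" "tmap \<alpha> K y0 = P \<theta>0"
    using traj_in_W[of \<tau>0] y0(2) unfolding W_eq by auto
  have x: "x \<tau> = P (diag_flow lam (\<tau> - \<tau>0) \<theta>0)" if "\<tau> \<ge> \<tau>0" for \<tau>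
    by (rule st(2)[OF _ _ _ y0(1) \<theta>0 traj that]) simp_all
  have int: "((\<lambda>\<tau>. hfun k K (x \<tau>)) has_integral \<Phi> (diag_flow lam (\<sigma> - \<tau>0) \<theta>0)) {\<sigma>..}" if "\<sigma> \<ge> \<tau>0" for \<sigma>
  proof -
    have "((\<lambda>\<tau>. hfun k K (P (diag_flow lam (\<tau> - \<tau>0) \<theta>0))) has_integral \<Phi> (diag_flow lam (\<sigma> - \<tau>0) \<theta>0)) {\<sigma>..}"
      by (rule st(3)[OF _ _ _ y0(1) \<theta>0 that]) simp_all
    then show ?thesis by (rule has_integral_eq[rotated]) (use x that in auto)
  qed
  have 1: "((\<lambda>\<tau>. hfun k K (x \<tau>)) has_integral (blowup_time \<alpha> k K f t0 \<tau>0 y0 - t0)) {\<tau>0..}"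
    using int[of \<tau>0] st1[OF y0(1) \<theta>0] by simp

  \<comment> \<open>The remaining time tends to zero\<close>
  have 4: "((\<lambda>\<sigma>. integral {\<sigma>..} (\<lambda>\<tau>. hfun k K (x \<tau>))) \<longlongrightarrow> 0) at_top"
  proof -
    have \<Phi>0: "\<Phi> 0 = 0"
      using power_series_bound_abs_le[OF power_series_bound_shrink[OF \<Phi>, of 0], of 0] by simp
    have "isCont \<Phi> 0"
      by (intro real_analytic_at_isCont power_series_bound_imp_real_analytic_at[OF \<Phi>]) auto
    moreover have "((\<lambda>\<sigma>. diag_flow lam (\<sigma> - \<tau>0) \<theta>0) \<longlongrightarrow> 0) at_top"
      by (rule filterlim_compose[OF diag_flow_tendsto_0[where lam = lam, OF lam]])
         (use filterlim_tendsto_add_at_top[OF tendsto_const[of "- \<tau>0"] filterlim_ident] in simp)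
    ultimately have "((\<lambda>\<sigma>. \<Phi> (diag_flow lam (\<sigma> - \<tau>0) \<theta>0)) \<longlongrightarrow> \<Phi> 0) at_top"
      by (rule isCont_tendsto_compose)
    moreover have "\<forall>\<^sub>F \<sigma> in at_top. \<Phi> (diag_flow lam (\<sigma> - \<tau>0) \<theta>0) = integral {\<sigma>..} (\<lambda>\<tau>. hfun k K (x \<tau>))"
      using eventually_ge_at_top[of \<tau>0] by eventually_elim (rule integral_unique[symmetric, OF int])
    ultimately show ?thesis unfolding \<Phi>0 by (rule Lim_transform_eventually)
  qed

  \<comment> \<open>Analyticity relative to the preimage of the manifold\<close>
  have 3: "real_analytic_within (blowup_time \<alpha> k K f t0 \<tau>0) y0 (tpreimage \<alpha> K W)"
    if "y0 \<in> tpreimage \<alpha> K (P ` open_unit_cube)"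
  proof -
    from that obtain \<theta>1 where \<theta>1: "\<theta>1 \<in> open_unit_cube" "tmap \<alpha> K y0 = P \<theta>1"
      unfolding tpreimage_def by blast
    have \<theta>1': "\<bar>\<theta>1 $ i\<bar> < 1" for i using \<theta>1(1) by (simp add: open_unit_cube_def)
    have \<theta>1c: "\<theta>1 \<in> unit_cube" using \<theta>1' by (auto simp: unit_cube_def less_imp_le)
    have anP: "real_analytic_at (\<lambda>\<theta>. P \<theta> $ i) \<theta>1" for i
      by (rule power_series_bound_imp_real_analytic_at[OF M _ \<theta>1']) simp
    obtain P' where P': "(P has_derivative P') (at \<theta>1)"
      using real_analytic_components_differentiable[OF anP] unfolding differentiable_def by blast
    have cube: "\<forall>\<^sub>F \<theta> in nhds \<theta>1. \<theta> \<in> unit_cube"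
    proof -
      have "open (open_unit_cube :: (real ^ 'm) set)"
      proof -
        have "open_unit_cube = (\<Inter>i :: 'm. {\<theta> :: real ^ 'm. \<bar>\<theta> $ i\<bar> < 1})"
          by (auto simp: open_unit_cube_def)
        moreover have "open (\<Inter>i :: 'm. {\<theta> :: real ^ 'm. \<bar>\<theta> $ i\<bar> < 1})"
          by (intro open_INT finite ballI open_Collect_less continuous_intros)
        ultimately show ?thesis by simp
      qed
      then have "\<forall>\<^sub>F \<theta> in nhds \<theta>1. \<theta> \<in> open_unit_cube" using \<theta>1(1) by (rule eventually_nhds_in_open)
      then show ?thesis by (rule eventually_mono) (auto simp: unit_cube_def open_unit_cube_def less_imp_le)
    qed
    have "inj P'"
      by (rule expanding_imp_derivative_injective[OF P' c])
         (use cube in eventually_elim, rule expanding[OF _ \<theta>1c])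
    then obtain L where L: "\<And>i. real_analytic_at (\<lambda>z. L z $ i) (P \<theta>1)" "\<forall>\<^sub>F \<theta> in nhds \<theta>1. L (P \<theta>) = \<theta>"
      using analytic_left_inverse[OF anP P'] by metis
    obtain d where d: "d > 0" "\<And>\<theta>. dist \<theta> \<theta>1 < d \<Longrightarrow> L (P \<theta>) = \<theta>"
      using L(2) unfolding eventually_nhds_metric by blast
    define G where "G y = t0 + \<Phi> (L (tmap \<alpha> K y))" for y
    have an\<Phi>: "real_analytic_at \<Phi> \<theta>1"
      by (rule power_series_bound_imp_real_analytic_at[OF \<Phi> _ \<theta>1']) simp
    have anL: "real_analytic_at (\<lambda>y. L (tmap \<alpha> K y) $ i) y0" for i
      by (rule real_analytic_at_compose_vec[where Q = "\<lambda>z. L z $ i" and u = "tmap \<alpha> K"])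
         (use L(1) \<theta>1(2) real_analytic_at_tmap[where \<alpha> = \<alpha>, OF \<alpha> K y0(1)] in simp_all)
    have "L (tmap \<alpha> K y0) = \<theta>1" using d \<theta>1(2) by simp
    then have "real_analytic_at \<Phi> (L (tmap \<alpha> K y0))" using an\<Phi> by simp
    then have "real_analytic_at (\<lambda>y. \<Phi> (L (tmap \<alpha> K y))) y0"
      by (rule real_analytic_at_compose_vec[where Q = \<Phi> and u = "\<lambda>y. L (tmap \<alpha> K y)"]) (rule anL)
    then have anG: "real_analytic_at G y0"
      unfolding G_def[abs_def] by (intro real_analytic_at_add real_analytic_at_const)
    have "isCont (tmap \<alpha> K) y0"
      using tmap_differentiable[where \<alpha> = \<alpha>, OF \<alpha> K y0(1)] differentiable_imp_continuous_within by blast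
    then have "(tmap \<alpha> K \<longlongrightarrow> tmap \<alpha> K y0) (nhds y0)"
      unfolding isCont_def tendsto_at_iff_tendsto_nhds .
    then have "\<forall>\<^sub>F y in nhds y0. dist (tmap \<alpha> K y) (P \<theta>1) < c * d"
      using c d(1) \<theta>1(2) unfolding tendsto_iff by simp
    then have "\<forall>\<^sub>F y in nhds y0. y \<in> tpreimage \<alpha> K W \<longrightarrow> blowup_time \<alpha> k K f t0 \<tau>0 y = G y"
    proof (rule eventually_mono, intro impI)
      fix y assume near: "dist (tmap \<alpha> K y) (P \<theta>1) < c * d" and "y \<in> tpreimage \<alpha> K W"
      then obtain \<theta> where \<theta>: "y \<in> tdom K" "\<theta> \<in> unit_cube" "tmap \<alpha> K y = P \<theta>"
        unfolding tpreimage_def W_eq by blast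
      \<comment> \<open>The radius c d was prepared for this step: by the estimate on the whole
        cube, every nearby point of the preimage has its parameter within \<open>d\<close> of
        \<open>\<theta>1\<close>, where \<open>L\<close> inverts \<open>P\<close>.\<close>
      have "c * norm (\<theta> - \<theta>1) < c * d"
        using expanding[OF \<theta>(2) \<theta>1c] near \<theta>(3) by (simp add: dist_norm)
      then have "L (P \<theta>) = \<theta>" using c by (intro d(2)) (simp add: dist_norm)
      then show "blowup_time \<alpha> k K f t0 \<tau>0 y = G y"
        using st1[OF \<theta>] \<theta>(3) by (simp add: G_def)
    qed
    then show ?thesis
      unfolding real_analytic_within_def eventually_inf_principal using anG by blast
  qed

  \<comment> \<open>Analyticity at interior points\<close>
  have 2: "real_analytic_at (blowup_time \<alpha> k K f t0 \<tau>0) y0"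
    if "y0 \<in> (top_of_set (tpreimage \<alpha> K (image_dom K))) interior_of (tpreimage \<alpha> K W)"
  proof -
    \<comment> \<open>The surrounding space is the open set \<open>tdom K\<close>, so the relative
      interior is an ordinary one.\<close>
    have "tpreimage \<alpha> K (image_dom K) = tdom K"
      using weight_tmap_pos[where \<alpha> = \<alpha>, OF \<alpha> K] by (auto simp: tpreimage_def dom)
    with that obtain U where "openin (top_of_set (tdom K)) U" and U: "y0 \<in> U" "U \<subseteq> tpreimage \<alpha> K W"
      unfolding interior_of_def by auto
    then have oU: "open U" using open_tdom openin_open_eq by blast
    have Ud: "U \<subseteq> tdom K" using U(2) by (auto simp: tpreimage_def)
    have "\<forall>y\<in>U. \<exists>\<theta>. \<theta> \<in> unit_cube \<and> tmap \<alpha> K y = P \<theta>"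
      using U(2) unfolding tpreimage_def W_eq by blast
    then obtain \<psi> where \<psi>: "\<And>y. y \<in> U \<Longrightarrow> \<psi> y \<in> unit_cube" "\<And>y. y \<in> U \<Longrightarrow> tmap \<alpha> K y = P (\<psi> y)"
      by metis
    have "continuous_on U \<psi>"
      unfolding continuous_on_iff
    proof (intro ballI allI impI)
      fix y \<epsilon> assume y: "y \<in> U" and \<epsilon>: "0 < (\<epsilon> :: real)"
      have "continuous_on U (tmap \<alpha> K)"
        by (rule continuous_on_subset[OF continuous_on_tmap[where \<alpha> = \<alpha>, OF \<alpha> K] Ud])
      moreover have "c * \<epsilon> > 0" using c \<epsilon> by simp
      ultimately obtain d where d: "d > 0" "\<And>y'. y' \<in> U \<Longrightarrow> dist y' y < d \<Longrightarrow> dist (tmap \<alpha> K y') (tmap \<alpha> K y) < c * \<epsilon>"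
        using y unfolding continuous_on_iff by blast
      have "dist (\<psi> y') (\<psi> y) < \<epsilon>" if y': "y' \<in> U" "dist y' y < d" for y'
      proof -
        have "c * dist (\<psi> y') (\<psi> y) \<le> dist (tmap \<alpha> K y') (tmap \<alpha> K y)"
          using expanding[OF \<psi>(1)[OF y'(1)] \<psi>(1)[OF y]] \<psi>(2)[OF y'(1)] \<psi>(2)[OF y] by (simp add: dist_norm)
        also have "\<dots> < c * \<epsilon>" by (rule d(2)[OF y'])
        finally show ?thesis using c by simp
      qed
      with d(1) show "\<exists>d>0. \<forall>y'\<in>U. dist y' y < d \<longrightarrow> dist (\<psi> y') (\<psi> y) < \<epsilon>" by blast
    qed
    moreover have "inj_on \<psi> U"
      using \<psi>(2) tinv_tmap[where \<alpha> = \<alpha>, OF \<alpha> K] Ud by (metis inj_onI subsetD)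
    \<comment> \<open>The parameter map is injective because \<open>tmap\<close> is, and it goes
      from dimension n to dimension m \<le> n, as invariance of domain requires.\<close>
    ultimately have "open (\<psi> ` U)"
      using oU dimle by (intro invariance_of_domain_gen) simp_all
    then obtain e where e: "e > 0" "\<And>\<theta>. dist \<theta> (\<psi> y0) < e \<Longrightarrow> \<theta> \<in> \<psi> ` U"
      using U(1) unfolding open_dist by blast
    \<comment> \<open>An open neighbourhood of the parameter consists of points of the closed cube;
      moving by e / 2 in both directions of each axis shows that no coordinate has absolute value
      1.\<close>
    have "\<bar>\<psi> y0 $ i\<bar> < 1" for i
    proof -
      have "\<bar>\<psi> y0 $ i + t\<bar> \<le> 1" if "\<bar>t\<bar> < e" for t
      proof -
        have "dist (\<psi> y0 + t *\<^sub>R axis i 1) (\<psi> y0) = \<bar>t\<bar>" by (simp add: dist_norm)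
        then have "dist (\<psi> y0 + t *\<^sub>R axis i 1) (\<psi> y0) < e" using that by (simp only:)
        from e(2)[OF this] obtain y where "y \<in> U" "\<psi> y0 + t *\<^sub>R axis i 1 = \<psi> y" by blast
        then have "\<bar>(\<psi> y0 + t *\<^sub>R axis i 1) $ i\<bar> \<le> 1" using \<psi>(1)[of y] by (simp add: unit_cube_def)
        then show ?thesis by simp
      qed
      from this[of "e / 2"] this[of "- e / 2"] show ?thesis using e(1) by auto
    qed
    then have "y0 \<in> tpreimage \<alpha> K (P ` open_unit_cube)"
      using U(1) Ud \<psi>(2)[OF U(1)] by (auto simp: tpreimage_def open_unit_cube_def)
    from 3[OF this] obtain G where G: "real_analytic_at G y0"
      and ev: "\<forall>\<^sub>F y in nhds y0. y \<in> tpreimage \<alpha> K W \<longrightarrow> blowup_time \<alpha> k K f t0 \<tau>0 y = G y"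
      unfolding real_analytic_within_def eventually_inf_principal by blast
    have "\<forall>\<^sub>F y in nhds y0. G y = blowup_time \<alpha> k K f t0 \<tau>0 y"
      using ev eventually_nhds_in_open[OF oU U(1)] by eventually_elim (use U(2) in auto)
    with G show ?thesis by (rule real_analytic_at_cong)
  qed

  from 1 2 3 4 show ?thesis by blast
qed

end
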